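(* Let $G$ be a $CD1$-group. Then $N=C_G(N)$ if and only if $b_k=-1$.
   Context: All groups are finite. Let $\mathrm{Irr}(G)=\{\chi_1,\dots,\chi_k\}$ be the set of complex irreducible characters of $G$, with $\chi_1=1_G$ and $\chi_1(1)=1\le\chi_2(1)\le\dots\le\chi_k(1)$. A group $G$ is a $CD1$-group if $|G|>2$ and two columns of its character table differ by exactly one entry, i.e. there are non-conjugate $a,b\in G$ and an index $j$ with $\chi_j(a)\ne\chi_j(b)$ and $\chi_i(a)=\chi_i(b)$ for all $i\ne j$. For a $CD1$-group it is known that one of the two conjugacy classes is $\{1\}$, that the other one, denoted $b^G$, is uniquely determined, and that the two columns differ exactly in the row of $\chi_k$, whose degree is strictly larger than that of all other irreducible characters. Put $b_k=\chi_k(b)$ and $N=\bigcap_{i=1}^{k-1}\ker\chi_i$. *)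

theory Defs
  imports "Jordan_Normal_Form.VS_Connect" "HOL-Algebra.Coset"
begin

text \<open>
  Complex representations are matrix representations, with matrices over the complex
  numbers whose size is an ordinary natural number.
\<close>

abbreviation GL :: "nat \<Rightarrow> complex mat monoid" where
  "GL n \<equiv> units_of (ring_mat TYPE(complex) n ())"

definition mat_trace :: "complex mat \<Rightarrow> complex" where
  "mat_trace A = sum_list (diag_mat A)"

definition irreducible_rep ::
    "('a, 'm) monoid_scheme \<Rightarrow> nat \<Rightarrow> ('a \<Rightarrow> complex mat) \<Rightarrow> bool" where
  "irreducible_rep G n \<rho> \<longleftrightarrow>
     \<rho> \<in> hom G (GL n) \<and> n > 0 \<and>
     (\<forall>W. VectorSpace.subspace class_ring W (module_vec TYPE(complex) n) \<longrightarrow>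
          (\<forall>g\<in>carrier G. \<forall>w\<in>W. \<rho> g *\<^sub>v w \<in> W) \<longrightarrow>
          W = {0\<^sub>v n} \<or> W = carrier_vec n)"

text \<open>
  Characters are made extensional on the carrier, so that two characters that agree on the
  group are equal as functions and the set below has one element per irreducible character.
\<close>

definition rep_character ::
    "('a, 'm) monoid_scheme \<Rightarrow> ('a \<Rightarrow> complex mat) \<Rightarrow> 'a \<Rightarrow> complex" where
  "rep_character G \<rho> = (\<lambda>g\<in>carrier G. mat_trace (\<rho> g))"

definition Irr :: "('a, 'm) monoid_scheme \<Rightarrow> ('a \<Rightarrow> complex) set" where
  "Irr G = {rep_character G \<rho> | n \<rho>. irreducible_rep G n \<rho>}"

definition trivial_character :: "('a, 'm) monoid_scheme \<Rightarrow> 'a \<Rightarrow> complex" where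
  "trivial_character G = (\<lambda>g\<in>carrier G. 1)"

text \<open>
  The value of a character at the identity is a natural number, viewed as a complex number
  (see \<open>Irr_one\<close> below); the real part makes the usual order available.
\<close>

definition char_degree :: "('a, 'm) monoid_scheme \<Rightarrow> ('a \<Rightarrow> complex) \<Rightarrow> real" where
  "char_degree G \<chi> = Re (\<chi> \<one>\<^bsub>G\<^esub>)"

definition char_kernel :: "('a, 'm) monoid_scheme \<Rightarrow> ('a \<Rightarrow> complex) \<Rightarrow> 'a set" where
  "char_kernel G \<chi> = {g \<in> carrier G. \<chi> g = \<chi> \<one>\<^bsub>G\<^esub>}"

definition Irr_enumeration ::
    "('a, 'm) monoid_scheme \<Rightarrow> nat \<Rightarrow> (nat \<Rightarrow> 'a \<Rightarrow> complex) \<Rightarrow> bool" where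
  "Irr_enumeration G k \<chi> \<longleftrightarrow>
     bij_betw \<chi> {1..k} (Irr G) \<and> \<chi> 1 = trivial_character G \<and>
     mono_on {1..k} (\<lambda>i. char_degree G (\<chi> i))"

definition conjugate_in :: "('a, 'm) monoid_scheme \<Rightarrow> 'a \<Rightarrow> 'a \<Rightarrow> bool" where
  "conjugate_in G a b \<longleftrightarrow>
     (\<exists>g\<in>carrier G. b = inv\<^bsub>G\<^esub> g \<otimes>\<^bsub>G\<^esub> a \<otimes>\<^bsub>G\<^esub> g)"

definition centralizer :: "('a, 'm) monoid_scheme \<Rightarrow> 'a set \<Rightarrow> 'a set" where
  "centralizer G S = {g \<in> carrier G. \<forall>s\<in>S. g \<otimes>\<^bsub>G\<^esub> s = s \<otimes>\<^bsub>G\<^esub> g}"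

definition columns_differ_once :: "('a, 'm) monoid_scheme \<Rightarrow> 'a \<Rightarrow> 'a \<Rightarrow> bool" where
  "columns_differ_once G a b \<longleftrightarrow>
     a \<in> carrier G \<and> b \<in> carrier G \<and> \<not> conjugate_in G a b \<and>
     (\<exists>\<chi>\<in>Irr G. \<chi> a \<noteq> \<chi> b \<and> (\<forall>\<psi>\<in>Irr G - {\<chi>}. \<psi> a = \<psi> b))"

definition CD1_group :: "('a, 'm) monoid_scheme \<Rightarrow> bool" where
  "CD1_group G \<longleftrightarrow>
     group G \<and> finite (carrier G) \<and> Coset.order G > 2 \<and> (\<exists>a b. columns_differ_once G a b)"

lemma mat_trace_one: "mat_trace (1\<^sub>m n) = of_nat n"
  by (simp add: mat_trace_def diag_mat_def interv_sum_list_conv_sum_set_nat)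

lemma Irr_one:
  assumes "group G" and "\<chi> \<in> Irr G"
  shows "\<exists>n>0. \<chi> \<one>\<^bsub>G\<^esub> = of_nat n"
proof -
  obtain n \<rho> where chi: "\<chi> = rep_character G \<rho>" and irr: "irreducible_rep G n \<rho>"
    using assms(2) by (auto simp: Irr_def)
  interpret R: Ring.ring "ring_mat TYPE(complex) n ()"
    by (rule ring_mat)
  have "group_hom G (GL n) \<rho>"
    using assms(1) R.units_group irr
    by (simp add: group_hom_def group_hom_axioms_def irreducible_rep_def)
  then have "\<rho> \<one>\<^bsub>G\<^esub> = 1\<^sub>m n"
    using group_hom.hom_one by (fastforce simp: units_of_def ring_mat_def)
  moreover have "\<one>\<^bsub>G\<^esub> \<in> carrier G"
    using assms(1) by (simp add: group.is_monoid)
  ultimately show ?thesis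
    using irr by (auto simp: chi rep_character_def mat_trace_one irreducible_rep_def)
qed

end

theory Submission
  imports Defs "HOL-Algebra.Group_Action" "HOL-Algebra.Sylow" "HOL-Algebra.Multiplicative_Group"
    "Jordan_Normal_Form.Spectral_Radius" "HOL-Library.Function_Algebras"
begin

text \<open>Let \<open>\<chi>\<close> be the irreducible character that separates \<open>1\<close> from \<open>b\<close>, let \<open>d\<close> be its degree and \<open>s\<close> the
sum of \<open>\<psi>(1)\<^sup>2\<close> over the other irreducible characters \<open>\<psi>\<close>. Column orthogonality forces \<open>\<chi>\<close> to vanish off
\<open>M = {1} \<union> b\<^sup>G\<close> and gives \<open>|G| = d\<^sup>2 + s\<close> and \<open>\<chi>(b) = - s / d\<close>, so that \<open>\<chi>\<close> is explicitly a combination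
of the delta function at \<open>1\<close> and the indicator function of \<open>M\<close>. The convolution relations
\<open>\<chi> * \<chi> = (|G| / d) \<chi>\<close> and \<open>\<psi> * \<chi> = 0\<close>, read for this explicit function, say that \<open>M\<close> is a subgroup of
order \<open>|G| / s\<close> and that every other \<open>\<psi>\<close> is constant on the cosets of \<open>M\<close>. Hence \<open>M\<close> is the common
kernel \<open>N\<close> of the other characters, every element outside \<open>M\<close> is conjugate to all elements of its
coset of \<open>M\<close>, and \<open>|C(b)| d\<^sup>2 = s\<^sup>2 |M|\<close>. The last equation turns the condition \<open>\<chi>(b) = -1\<close>, that is
\<open>s = d\<close>, into \<open>|C(b)| = |M|\<close>, and the characters can be forgotten.

What remains is the group-theoretic theorem \<open>self_centralizing_iff_card_centralizer\<close>. As the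
nonidentity elements of \<open>M\<close> are conjugate, \<open>M\<close> is an elementary abelian \<open>p\<close>-group. If
\<open>|C(b)| = |M|\<close>, then \<open>C(b) = M\<close> and \<open>M\<close> is self-centralizing. Conversely let \<open>M\<close> be self-centralizing;
the point is that \<open>C(b)\<close> is not larger than \<open>M\<close>. If \<open>t\<close> is an involution outside \<open>M\<close>, then all elements
of \<open>t M\<close> are conjugate to \<open>t\<close>, hence involutions, so \<open>t\<close> inverts \<open>M\<close>.

For odd \<open>p\<close> there is such a \<open>t\<close>, and a Frattini argument shows that \<open>C(t)\<close> is a complement of \<open>M\<close>. An
element \<open>h\<close> of \<open>C(t) \<inter> C(b)\<close> outside \<open>M\<close> would be conjugate under \<open>M\<close> to all elements of \<open>M h\<close>; these
are \<open>|M|\<close> elements, but \<open>b\<close> centralizes \<open>h\<close>.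

For \<open>p = 2\<close> an involution outside \<open>M\<close> would centralize \<open>M\<close>, so there is none. If \<open>C(b)\<close> is larger than
\<open>M\<close>, then some elements outside \<open>M\<close> have their square in \<open>M\<close>. An argument in the style of the
Baer-Suzuki theorem finds two of them, \<open>x\<close> and \<open>y\<close>, without a common fixed point in \<open>M - {1}\<close>. Counting
then gives \<open>|C\<^sub>M(x)|\<^sup>2 = |M|\<close>, so that \<open>[M, x] = C\<^sub>M(x)\<close> contains \<open>x\<^sup>2\<close>; but then the coset \<open>M x\<close>
contains an involution.\<close>

section \<open>Finite groups of prime power order\<close>

context group
begin

lemma inv_mult_cancel: "\<lbrakk>x \<in> carrier G; y \<in> carrier G\<rbrakk> \<Longrightarrow> inv x \<otimes> (x \<otimes> y) = y"
  by (simp flip: m_assoc)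

lemma mult_inv_cancel: "\<lbrakk>x \<in> carrier G; y \<in> carrier G\<rbrakk> \<Longrightarrow> x \<otimes> (inv x \<otimes> y) = y"
  by (simp flip: m_assoc)

lemmas word_simps = m_assoc inv_mult_group inv_mult_cancel mult_inv_cancel

end

lemma group_actionI:
  fixes G (structure)
  assumes "group G"
    and closed: "\<And>g x. \<lbrakk>g \<in> carrier G; x \<in> E\<rbrakk> \<Longrightarrow> f g x \<in> E"
    and one: "\<And>x. x \<in> E \<Longrightarrow> f \<one> x = x"
    and mult: "\<And>g h x. \<lbrakk>g \<in> carrier G; h \<in> carrier G; x \<in> E\<rbrakk> \<Longrightarrow> f (g \<otimes> h) x = f g (f h x)"
  shows "group_action G E (\<lambda>g. \<lambda>x\<in>E. f g x)"
proof -
  interpret group G by fact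
  have bij: "(\<lambda>x\<in>E. f g x) \<in> Bij E" if g: "g \<in> carrier G" for g
  proof -
    have "bij_betw (f g) E E"
      by (rule bij_betw_byWitness[where f' = "f (inv g)"])
        (use g in \<open>auto simp: closed one simp flip: mult\<close>)
    then show ?thesis
      by (simp add: Bij_def cong: bij_betw_cong)
  qed
  have "(\<lambda>g. \<lambda>x\<in>E. f g x) \<in> hom G (BijGroup E)"
    using bij by (auto simp: hom_def BijGroup_def compose_def mult closed intro!: ext)
  then show ?thesis
    by (simp add: group_action_def group_hom_def group_hom_axioms_def group_BijGroup \<open>group G\<close>)
qed

text \<open>The moved points form a union of orbits, and an orbit with more than one point has as length a
nontrivial power of \<open>p\<close>.\<close>
lemma (in group_action) prime_dvd_card_moved_points:
  assumes "prime p" and "Coset.order G = p ^ a" and "finite E"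
  shows "p dvd card {x \<in> E. \<exists>g\<in>carrier G. \<phi> g x \<noteq> x}"
proof -
  interpret group_hom G "BijGroup E" \<phi> by (rule group_hom)
  let ?D = "{x \<in> E. \<exists>g\<in>carrier G. \<phi> g x \<noteq> x}"
  let ?C = "{T \<in> orbits G E \<phi>. T \<subseteq> ?D}"
  have union: "\<Union>?C = ?D"
  proof (intro equalityI subsetI)
    fix x assume x: "x \<in> ?D"
    have "orbit G \<phi> x \<subseteq> ?D"
    proof
      fix y assume y: "y \<in> orbit G \<phi> x"
      then have yE: "y \<in> E" using x element_image by (auto simp: orbit_def)
      have xy: "x \<in> orbit G \<phi> y" using orbit_sym[of x y] x y yE by auto
      have "\<exists>g\<in>carrier G. \<phi> g y \<noteq> y"
      proof (rule ccontr)
        assume "\<not> ?thesis"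
        then have fix_y: "\<forall>g\<in>carrier G. \<phi> g y = y" by blast
        then have "x = y" using xy by (auto simp: orbit_def)
        then show False using fix_y x by auto
      qed
      then show "y \<in> ?D" using yE by auto
    qed
    then have "orbit G \<phi> x \<in> ?C" using x by (auto simp: orbits_def)
    then show "x \<in> \<Union>?C" using orbit_refl[of x] x by blast
  qed auto
  have "p dvd card T" if T: "T \<in> ?C" for T
  proof -
    from T obtain x where x: "x \<in> E" "T = orbit G \<phi> x" "T \<subseteq> ?D" by (auto simp: orbits_def)
    have xO: "x \<in> T" using x orbit_refl by auto
    have "card T dvd p ^ a"
      using orbit_stabilizer_theorem[OF x(1)] assms(2) x(2) by (metis dvd_triv_left)
    then obtain i where i: "card T = p ^ i"
      using \<open>prime p\<close> divides_primepow_nat by blast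
    have "card T \<noteq> 1"
    proof
      assume "card T = 1"
      then have "T = {x}" using xO by (metis card_1_singletonE singletonD)
      moreover obtain g where "g \<in> carrier G" "\<phi> g x \<noteq> x" using xO x(3) by auto
      ultimately show False using x(2) by (auto simp: orbit_def)
    qed
    then show ?thesis using i by (cases i) auto
  qed
  moreover have "disjoint ?C"
    using disjoint_union by (auto simp: pairwise_def disjnt_def)
  ultimately have "p dvd card (\<Union>?C)"
    using assms(3) by (intro dvd_partition) (auto simp: pairwise_def disjnt_def union)
  then show ?thesis by (simp add: union)
qed

context group
begin

lemma conj_closed: "\<lbrakk>g \<in> carrier G; x \<in> carrier G\<rbrakk> \<Longrightarrow> g \<otimes> x \<otimes> inv g \<in> carrier G"
  by simp

lemma conj_mult:
  "\<lbrakk>g \<in> carrier G; x \<in> carrier G; y \<in> carrier G\<rbrakk> \<Longrightarrow>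
    g \<otimes> (x \<otimes> y) \<otimes> inv g = (g \<otimes> x \<otimes> inv g) \<otimes> (g \<otimes> y \<otimes> inv g)"
  by (simp add: word_simps)

lemma conj_conj:
  "\<lbrakk>g \<in> carrier G; h \<in> carrier G; x \<in> carrier G\<rbrakk> \<Longrightarrow>
    g \<otimes> (h \<otimes> x \<otimes> inv h) \<otimes> inv g = (g \<otimes> h) \<otimes> x \<otimes> inv (g \<otimes> h)"
  by (simp add: word_simps)

lemma conj_pow:
  "\<lbrakk>g \<in> carrier G; x \<in> carrier G\<rbrakk> \<Longrightarrow>
    (g \<otimes> x \<otimes> inv g) [^] (n::nat) = g \<otimes> x [^] n \<otimes> inv g"
  by (induction n) (simp_all add: word_simps)

lemma conj_eq_iff_commute:
  "\<lbrakk>g \<in> carrier G; x \<in> carrier G\<rbrakk> \<Longrightarrow> g \<otimes> x \<otimes> inv g = x \<longleftrightarrow> g \<otimes> x = x \<otimes> g"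
  by (metis inv_solve_right m_closed)

lemma conj_inj_on: "\<lbrakk>g \<in> carrier G; A \<subseteq> carrier G\<rbrakk> \<Longrightarrow> inj_on (\<lambda>x. g \<otimes> x \<otimes> inv g) A"
  by (intro inj_onI) (auto simp: subset_iff)

text \<open>Left translation by \<open>x \<in> H\<close> is injective on the finite set \<open>H\<close>, hence onto \<open>H\<close>; this produces the
identity and the inverse of \<open>x\<close>.\<close>
lemma finite_mult_closed_imp_subgroup:
  assumes H: "H \<subseteq> carrier G" "finite H" "H \<noteq> {}"
    and mult: "\<And>x y. \<lbrakk>x \<in> H; y \<in> H\<rbrakk> \<Longrightarrow> x \<otimes> y \<in> H"
  shows "subgroup H G"
proof (rule subgroupI)
  fix x assume x: "x \<in> H"
  have "inj_on (\<lambda>y. x \<otimes> y) H"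
    using x H(1) by (intro inj_onI) (auto simp: subset_iff)
  then have surj: "(\<lambda>y. x \<otimes> y) ` H = H"
    using H(2) mult x by (intro endo_inj_surj) auto
  then obtain y where y: "y \<in> H" "x \<otimes> y = x"
    using x by (metis imageE)
  then have "y = \<one>"
    using x H(1) by (auto simp: subset_iff)
  then obtain z where z: "z \<in> H" "x \<otimes> z = \<one>"
    using surj y by (metis imageE)
  then have "inv x = z"
    using x H(1) by (metis inv_equality inv_comm subsetD)
  then show "inv x \<in> H" using z by simp
qed (use assms in auto)

lemma subgroup_centralizer:
  assumes "A \<subseteq> carrier G"
  shows "subgroup (centralizer G A) G"
proof (rule subgroupI)
  fix x assume x: "x \<in> centralizer G A"
  have "inv x \<otimes> s = s \<otimes> inv x" if s: "s \<in> A" for s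
  proof -
    have xs: "x \<in> carrier G" "s \<in> carrier G" "x \<otimes> s = s \<otimes> x"
      using x s assms by (auto simp: centralizer_def)
    have "inv x \<otimes> s = inv x \<otimes> (s \<otimes> x) \<otimes> inv x" using xs by (simp add: word_simps)
    also have "\<dots> = s \<otimes> inv x" using xs by (simp add: word_simps flip: xs(3))
    finally show ?thesis .
  qed
  then show "inv x \<in> centralizer G A" using x by (auto simp: centralizer_def)
next
  fix x y assume xy: "x \<in> centralizer G A" "y \<in> centralizer G A"
  show "x \<otimes> y \<in> centralizer G A"
    using xy assms
    by (auto simp: centralizer_def subset_iff) (metis m_assoc)
next
  have "\<one> \<in> centralizer G A" using assms by (auto simp: centralizer_def)
  then show "centralizer G A \<noteq> {}" by blast
qed (auto simp: centralizer_def)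

lemma mem_centralizer_singleton:
  "x \<in> centralizer G {w} \<longleftrightarrow> x \<in> carrier G \<and> x \<otimes> w = w \<otimes> x"
  by (auto simp: centralizer_def)

lemma subgroup_card_dvd:
  assumes "subgroup H G" "subgroup K G" "H \<subseteq> K"
  shows "card H dvd card K"
proof -
  interpret K: group "G\<lparr>carrier := K\<rparr>" by (rule subgroup_imp_group) fact
  have "subgroup H (G\<lparr>carrier := K\<rparr>)"
    using assms by (simp add: subgroup_incl)
  from K.lagrange[OF this] show ?thesis
    by (simp add: Coset.order_def) (metis dvd_triv_right)
qed

text \<open>Cauchy's theorem: Sylow's theorem for the exponent \<open>1\<close> yields a subgroup of order \<open>q\<close>.\<close>
lemma cauchy:
  assumes "finite (carrier G)" "subgroup H G" "prime q" "q dvd card H"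
  obtains x where "x \<in> H" "x \<noteq> \<one>" "x [^] q = \<one>"
proof -
  let ?H = "G\<lparr>carrier := H\<rparr>"
  interpret H: group ?H by (rule subgroup_imp_group) fact
  have finH: "finite H" using assms(1,2) finite_subset subgroup.subset by blast
  obtain m where "Coset.order ?H = q ^ 1 * m"
    using assms(4) by (auto simp: Coset.order_def)
  then obtain K where K: "subgroup K ?H" "card K = q ^ 1"
    using sylow_thm[of q ?H 1 m] assms(3) finH H.is_group by auto
  have KG: "subgroup K G" using K(1) assms(2) incl_subgroup by blast
  interpret K: group "G\<lparr>carrier := K\<rparr>" by (rule subgroup_imp_group) fact
  have "card K > 1" using K(2) assms(3) prime_gt_1_nat by simp
  then have "\<not> K \<subseteq> {\<one>}" by (metis card_mono card.empty card_insert_disjoint empty_iff finite.emptyI finite.insertI leD One_nat_def)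
  then obtain x where x: "x \<in> K" "x \<noteq> \<one>" by blast
  have "x [^]\<^bsub>G\<lparr>carrier := K\<rparr>\<^esub> q = \<one>"
    using K.pow_order_eq_1[of x] x K(2) by (simp add: Coset.order_def)
  then have "x [^] q = \<one>" by (simp add: nat_pow_consistent[symmetric])
  moreover have "x \<in> H" using K(1) x subgroup.subset by fastforce
  ultimately show thesis using that x by blast
qed

lemma pow_coprime_eq_one:
  assumes "x \<in> carrier G" "x [^] (m::nat) = \<one>" "x [^] (n::nat) = \<one>" "coprime m n"
  shows "x = \<one>"
proof -
  have "ord x dvd m" "ord x dvd n" using assms pow_eq_id by auto
  then have "ord x = 1" using assms(4) by (meson coprime_common_divisor_nat)
  then show ?thesis using assms(1) ord_eq_1 by blast
qed

text \<open>The number of points of \<open>F\<close> that \<open>K\<close> fixes is divisible by \<open>p\<close> and positive, so the identity is not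
the only one.\<close>
lemma p_group_conj_fixed_point:
  assumes K: "subgroup K G" "card K = p ^ a" "prime p"
    and F: "finite F" "F \<subseteq> carrier G" "p dvd card F" "\<one> \<in> F"
    and conj: "\<And>k x. \<lbrakk>k \<in> K; x \<in> F\<rbrakk> \<Longrightarrow> k \<otimes> x \<otimes> inv k \<in> F"
  obtains x where "x \<in> F" "x \<noteq> \<one>" "\<And>k. k \<in> K \<Longrightarrow> k \<otimes> x = x \<otimes> k"
proof -
  let ?K = "G\<lparr>carrier := K\<rparr>"
  have KG: "K \<subseteq> carrier G" using K(1) subgroup.subset by blast
  interpret A: group_action ?K F "\<lambda>g. \<lambda>x\<in>F. g \<otimes> x \<otimes> inv g"
  proof (rule group_actionI)
    show "group ?K" by (rule subgroup_imp_group) fact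
  qed (use conj KG F(2) in \<open>auto simp: subset_iff word_simps\<close>)
  let ?D = "{x \<in> F. \<exists>g\<in>K. g \<otimes> x \<otimes> inv g \<noteq> x}"
  let ?Fix = "{x \<in> F. \<forall>g\<in>K. g \<otimes> x \<otimes> inv g = x}"
  have "{x \<in> F. \<exists>g\<in>carrier ?K. (\<lambda>x\<in>F. g \<otimes> x \<otimes> inv g) x \<noteq> x} = ?D"
    by auto
  then have D: "p dvd card ?D"
    using A.prime_dvd_card_moved_points[of p a] K F(1) by (simp add: Coset.order_def)
  have "finite ?Fix" "finite ?D" using F(1) by (auto intro: finite_subset)
  moreover have "?Fix \<inter> ?D = {}" by blast
  ultimately have "card (?Fix \<union> ?D) = card ?Fix + card ?D" by (rule card_Un_disjoint)
  moreover have "?Fix \<union> ?D = F" by blast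
  ultimately have "card F = card ?Fix + card ?D" by (simp only:)
  then have "p dvd card ?Fix"
    using D F(3) dvd_add_left_iff[OF D] by simp
  moreover have "\<one> \<in> ?Fix" using F(4) KG by auto
  moreover have "?Fix \<noteq> {\<one>}"
  proof
    assume "?Fix = {\<one>}"
    then have "card ?Fix = 1" by simp
    then show False using \<open>p dvd card ?Fix\<close> K(3) by auto
  qed
  ultimately obtain x where x: "x \<in> ?Fix" "x \<noteq> \<one>" by blast
  then show thesis
    using that[of x] conj_eq_iff_commute KG F(2) by blast
qed

text \<open>\<open>Q\<close> acts by right multiplication on its right cosets in \<open>S\<close>. Their number is a multiple of \<open>p\<close>, and the
coset \<open>Q\<close> is fixed, so a second coset \<open>Q s\<close> is fixed, which means that \<open>s\<close> normalizes \<open>Q\<close>.\<close>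
lemma p_group_normalizer_grows:
  assumes fin: "finite (carrier G)" and S: "subgroup S G" "card S = p ^ a" "prime p"
    and Q: "subgroup Q G" "Q \<subset> S"
  obtains s where "s \<in> S" "s \<notin> Q" "\<And>q. q \<in> Q \<Longrightarrow> s \<otimes> q \<otimes> inv s \<in> Q"
proof -
  let ?S = "G\<lparr>carrier := S\<rparr>" and ?Q = "G\<lparr>carrier := Q\<rparr>"
  interpret S: group ?S by (rule subgroup_imp_group) fact
  have SG: "S \<subseteq> carrier G" and QG: "Q \<subseteq> carrier G" using S Q subgroup.subset by blast+
  have finS: "finite S" using fin SG finite_subset by blast
  have QS: "subgroup Q ?S" using S Q by (simp add: subgroup_incl)
  define E where "E = (\<lambda>s. Q #> s) ` S"
  have E_eq: "E = rcosets\<^bsub>?S\<^esub> Q"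
    by (auto simp: E_def RCOSETS_def r_coset_def)
  have cardE: "card E * card Q = p ^ a"
    using S.lagrange[OF QS] S(2) by (simp add: E_eq Coset.order_def)
  have finE: "finite E" using finS by (simp add: E_def)
  obtain c where c: "card Q = p ^ c" using cardE S(3) divides_primepow_nat by (metis dvd_triv_right)
  have "card Q < card S" using Q(2) finS psubset_card_mono by blast
  then have "card E \<noteq> 1" using cardE S(2) by auto
  then have pE: "p dvd card E"
    using cardE S(3) divides_primepow_nat[of p "card E" a]
    by (metis dvd_triv_left dvd_power gr0I power_0)
  interpret A: group_action ?Q E "\<lambda>q. \<lambda>C\<in>E. C #> inv q"
  proof (rule group_actionI)
    show "group ?Q" by (rule subgroup_imp_group) fact
    fix g C assume "g \<in> carrier ?Q" "C \<in> E"
    then obtain s where s: "g \<in> Q" "s \<in> S" "C = Q #> s" by (auto simp: E_def)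
    moreover have "s \<otimes> inv g \<in> S"
      using s Q(2) S(1) by (meson subgroup.m_closed subgroup.m_inv_closed psubsetE subsetD)
    ultimately show "C #> inv g \<in> E"
      using QG SG by (auto simp: E_def coset_mult_assoc subset_iff)
  qed (use QG SG in \<open>auto simp: E_def subset_iff coset_mult_assoc word_simps\<close>)
  let ?D = "{C \<in> E. \<exists>q\<in>Q. C #> inv q \<noteq> C}"
  let ?Fix = "{C \<in> E. \<forall>q\<in>Q. C #> inv q = C}"
  have "{C \<in> E. \<exists>q\<in>carrier ?Q. (\<lambda>C\<in>E. C #> inv q) C \<noteq> C} = ?D"
    by auto
  then have D: "p dvd card ?D"
    using A.prime_dvd_card_moved_points[of p c] S finE c by (simp add: Coset.order_def)
  have "finite ?Fix" "finite ?D" using finE by (auto intro: finite_subset)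
  moreover have "?Fix \<inter> ?D = {}" by blast
  ultimately have "card (?Fix \<union> ?D) = card ?Fix + card ?D" by (rule card_Un_disjoint)
  moreover have "?Fix \<union> ?D = E" by blast
  ultimately have "card E = card ?Fix + card ?D" by (simp only:)
  then have pFix: "p dvd card ?Fix"
    using D pE dvd_add_left_iff[OF D] by simp
  have "Q \<in> E"
    unfolding E_def using S(1) QG by (intro image_eqI[of _ _ \<one>]) (auto simp: subgroup.one_closed)
  moreover have "Q #> inv q = Q" if "q \<in> Q" for q
    using that Q(1) QG by (metis coset_join2 subgroup.m_inv_closed subsetD)
  ultimately have "Q \<in> ?Fix" by auto
  moreover have "?Fix \<noteq> {Q}"
  proof
    assume "?Fix = {Q}"
    then have "card ?Fix = 1" by simp
    then show False using pFix S(3) by auto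
  qed
  ultimately obtain C where C: "C \<in> ?Fix" "C \<noteq> Q" by blast
  then obtain s where s: "s \<in> S" "C = Q #> s" by (auto simp: E_def)
  have "s \<notin> Q" using C(2) s Q(1) QG by (metis coset_join2 subsetD)
  moreover have "s \<otimes> q \<otimes> inv s \<in> Q" if q: "q \<in> Q" for q
  proof -
    have sG: "s \<in> carrier G" and qG: "q \<in> carrier G" using s q QG SG by blast+
    have "inv q \<in> Q" by (rule subgroup.m_inv_closed[OF Q(1) q])
    then have "C #> inv (inv q) = C" using C(1) by blast
    then have "C #> q = C" by (simp only: inv_inv[OF qG])
    moreover have "C #> q = Q #> (s \<otimes> q)"
      unfolding s(2) by (rule coset_mult_assoc[OF QG sG qG])
    ultimately have "Q #> (s \<otimes> q) = Q #> s" using s(2) by (simp only:)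
    moreover have "s \<otimes> q \<in> Q #> (s \<otimes> q)"
      using rcos_self[OF _ Q(1)] sG qG by blast
    ultimately have "s \<otimes> q \<in> Q #> s" by (simp only:)
    then obtain q' where q': "q' \<in> Q" "s \<otimes> q = q' \<otimes> s" unfolding r_coset_def by blast
    then have "s \<otimes> q \<otimes> inv s = q' \<otimes> s \<otimes> inv s" by (simp only:)
    also have "\<dots> = q'" using sG q'(1) QG by (simp add: m_assoc subset_iff)
    finally have "s \<otimes> q \<otimes> inv s = q'" .
    then show ?thesis using q' by simp
  qed
  ultimately show thesis using that s by blast
qed

text \<open>An element of \<open>X\<close> that normalizes \<open>Q\<close> also normalizes \<open>X \<inter> Q\<close>, so it is enough to find one outside \<open>Q\<close>.
If the normalizer of \<open>Q\<close> in \<open>S\<close> contains none, then \<open>Q\<close> can be replaced by this normalizer, which is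
larger and has the same intersection with \<open>X\<close>.\<close>
lemma p_group_normal_set_normalizer:
  assumes fin: "finite (carrier G)" and S: "subgroup S G" "card S = p ^ a" "prime p"
    and X: "X \<subseteq> S" "\<And>s x. \<lbrakk>s \<in> S; x \<in> X\<rbrakk> \<Longrightarrow> s \<otimes> x \<otimes> inv s \<in> X"
    and Q: "subgroup Q G" "Q \<subseteq> S" "\<not> X \<subseteq> Q"
  obtains x where "x \<in> X" "x \<notin> Q" "(\<lambda>d. x \<otimes> d \<otimes> inv x) ` (X \<inter> Q) = X \<inter> Q"
  using Q
proof (induction "card S - card Q" arbitrary: Q thesis rule: less_induct)
  case less
  have SG: "S \<subseteq> carrier G" and QG: "Q \<subseteq> carrier G" using S less.prems subgroup.subset by blast+
  have finS: "finite S" using fin SG finite_subset by blast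
  have finQ: "finite Q" using finS less.prems finite_subset by blast
  define N where "N = {s \<in> S. \<forall>q\<in>Q. s \<otimes> q \<otimes> inv s \<in> Q}"
  have QN: "Q \<subseteq> N"
    using less.prems by (auto simp: N_def subgroup.m_closed subgroup.m_inv_closed)
  have NS: "N \<subseteq> S" by (auto simp: N_def)
  have finN: "finite N" using finS NS finite_subset by blast
  have "N \<noteq> {}" using QN less.prems(2) subgroup.one_closed by blast
  then have N: "subgroup N G"
  proof (intro finite_mult_closed_imp_subgroup)
    fix s t assume st: "s \<in> N" "t \<in> N"
    have "(s \<otimes> t) \<otimes> q \<otimes> inv (s \<otimes> t) \<in> Q" if "q \<in> Q" for q
      using st that SG QG by (subst conj_conj[symmetric]) (auto simp: N_def)
    then show "s \<otimes> t \<in> N" using st S(1) by (auto simp: N_def subgroup.m_closed)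
  qed (use NS SG finN in auto)
  have "Q \<subset> S" using less.prems X(1) by auto
  then obtain s where s: "s \<in> S" "s \<notin> Q" "\<And>q. q \<in> Q \<Longrightarrow> s \<otimes> q \<otimes> inv s \<in> Q"
    using p_group_normalizer_grows[OF fin S less.prems(2)] by metis
  then have "Q \<subset> N" using QN by (auto simp: N_def)
  show ?case
  proof (cases "X \<inter> N \<subseteq> Q")
    case True
    then have XN: "X \<inter> N = X \<inter> Q" using QN by blast
    have "card Q < card N" using \<open>Q \<subset> N\<close> finN psubset_card_mono by blast
    moreover have "card N \<le> card S" using NS finS card_mono by blast
    ultimately have "card S - card N < card S - card Q" by linarith
    moreover have "\<not> X \<subseteq> N" using True less.prems(4) by blast
    ultimately obtain x where "x \<in> X" "x \<notin> N" "(\<lambda>d. x \<otimes> d \<otimes> inv x) ` (X \<inter> N) = X \<inter> N"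
      using less.hyps[OF _ _ N NS] by metis
    then show thesis using less.prems(1) XN QN by auto
  next
    case False
    then obtain x where x: "x \<in> X" "x \<in> N" "x \<notin> Q" by blast
    have xS: "x \<in> S" using x X(1) by blast
    have "(\<lambda>d. x \<otimes> d \<otimes> inv x) ` (X \<inter> Q) = X \<inter> Q"
    proof (rule endo_inj_surj)
      show "(\<lambda>d. x \<otimes> d \<otimes> inv x) ` (X \<inter> Q) \<subseteq> X \<inter> Q"
        using x xS X(2) by (auto simp: N_def)
      show "inj_on (\<lambda>d. x \<otimes> d \<otimes> inv x) (X \<inter> Q)"
        using xS SG QG by (intro conj_inj_on) auto
    qed (use finQ in auto)
    then show thesis using less.prems(1) x by blast
  qed
qed

end

lemma prime_power_if_unique_prime_divisor:
  fixes n p :: nat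
  assumes "n > 0" "prime p" "\<And>q. \<lbrakk>prime q; q dvd n\<rbrakk> \<Longrightarrow> q = p"
  obtains a where "n = p ^ a"
proof -
  obtain m where m: "n = p ^ multiplicity p n * m" "\<not> p dvd m"
    using assms(1,2) by (metis multiplicity_decompose' not_prime_unit not_less_zero)
  have "m = 1"
  proof (rule ccontr)
    assume "m \<noteq> 1"
    then obtain q where "prime q" "q dvd m" using prime_factor_nat by blast
    then show False using assms(3)[of q] m by (metis dvd_mult)
  qed
  then show thesis using that m(1) by simp
qed

section \<open>Normal subgroups with a single nontrivial class\<close>

locale finite_group = group G for G (structure) +
  assumes finite_carrier: "finite (carrier G)"

text \<open>The pair \<open>(G, M)\<close> is a Camina pair (an element outside \<open>M\<close> is conjugate to its whole coset) in which the
nonidentity elements of \<open>M\<close> form a single conjugacy class.\<close>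
locale camina_single_class = finite_group +
  fixes M :: "'a set" and b :: 'a
  assumes b: "b \<in> carrier G" "b \<noteq> \<one>"
    and M_eq: "M = insert \<one> {g \<otimes> b \<otimes> inv g | g. g \<in> carrier G}"
    and subgroup_M: "subgroup M G"
    and camina: "\<lbrakk>g \<in> carrier G; g \<notin> M; x \<in> M\<rbrakk> \<Longrightarrow> \<exists>z\<in>carrier G. g \<otimes> x = z \<otimes> g \<otimes> inv z"
begin

lemma M_carrier: "x \<in> M \<Longrightarrow> x \<in> carrier G"
  using subgroup_M subgroup.mem_carrier by fast

lemma M_mult: "\<lbrakk>x \<in> M; y \<in> M\<rbrakk> \<Longrightarrow> x \<otimes> y \<in> M"
  by (rule subgroup.m_closed[OF subgroup_M])

lemma M_inv: "x \<in> M \<Longrightarrow> inv x \<in> M"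
  by (rule subgroup.m_inv_closed[OF subgroup_M])

lemma M_one: "\<one> \<in> M"
  by (rule subgroup.one_closed[OF subgroup_M])

lemma M_pow: "x \<in> M \<Longrightarrow> x [^] (n::nat) \<in> M"
  by (induction n) (auto intro: M_mult M_one)

lemma b_M: "b \<in> M"
  using b(1) by (auto simp: M_eq intro!: exI[of _ \<one>])

lemma finite_M: "finite M"
  by (rule finite_subset[OF _ finite_carrier]) (use M_carrier in blast)

lemma M_conj:
  assumes "g \<in> carrier G" "x \<in> M"
  shows "g \<otimes> x \<otimes> inv g \<in> M"
proof (cases "x = \<one>")
  case True
  then show ?thesis using assms M_one by simp
next
  case False
  then obtain h where h: "h \<in> carrier G" "x = h \<otimes> b \<otimes> inv h"
    using assms(2) by (auto simp: M_eq)
  then have "g \<otimes> x \<otimes> inv g = (g \<otimes> h) \<otimes> b \<otimes> inv (g \<otimes> h)"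
    using assms(1) b(1) by (simp add: conj_conj)
  then show ?thesis using h(1) assms(1) by (auto simp: M_eq)
qed

lemma M_conj_left:
  assumes "g \<in> carrier G" "x \<in> M"
  shows "inv g \<otimes> x \<otimes> g \<in> M"
  using M_conj[of "inv g" x] assms by simp

lemma conj_eq_one_iff:
  assumes "g \<in> carrier G" "x \<in> carrier G"
  shows "g \<otimes> x \<otimes> inv g = \<one> \<longleftrightarrow> x = \<one>"
proof
  assume "g \<otimes> x \<otimes> inv g = \<one>"
  moreover have "x = inv g \<otimes> (g \<otimes> x \<otimes> inv g) \<otimes> g" using assms by (simp add: word_simps)
  ultimately show "x = \<one>" using assms by simp
qed (use assms in simp)

lemma conj_transitive:
  assumes "x \<in> M" "x \<noteq> \<one>" "y \<in> M" "y \<noteq> \<one>"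
  obtains g where "g \<in> carrier G" "y = g \<otimes> x \<otimes> inv g"
proof -
  obtain h where h: "h \<in> carrier G" "x = h \<otimes> b \<otimes> inv h" using assms by (auto simp: M_eq)
  obtain k where k: "k \<in> carrier G" "y = k \<otimes> b \<otimes> inv k" using assms by (auto simp: M_eq)
  have "y = (k \<otimes> inv h) \<otimes> x \<otimes> inv (k \<otimes> inv h)"
    using h k b(1) by (simp add: word_simps)
  then show thesis by (rule that[rotated]) (use h(1) k(1) in simp)
qed

text \<open>Some power of \<open>b\<close> has prime order, and all nonidentity elements of \<open>M\<close> are conjugate to it.\<close>
lemma exponent_prime:
  obtains p :: nat where "prime p" "\<And>x. x \<in> M \<Longrightarrow> x [^] p = \<one>"
proof -
  have "ord b \<noteq> 1" using ord_eq_1 b by blast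
  then obtain p where p: "prime p" "p dvd ord b" using prime_factor_nat by blast
  have "ord b > 0" using ord_ge_1[OF finite_carrier b(1)] by simp
  from p(2) obtain m where m1: "ord b = p * m" by (elim dvdE)
  then have m: "ord b = p * m" "m > 0" using \<open>ord b > 0\<close> by auto
  define x where "x = b [^] m"
  have "m < ord b" using m p(1) prime_gt_1_nat by simp
  then have x1: "x \<noteq> \<one>"
    unfolding x_def using pow_eq_id[OF b(1), of m] m(2) by (auto dest: dvd_imp_le)
  have xp: "x [^] p = \<one>"
    unfolding x_def using b(1) m(1) by (simp add: nat_pow_pow pow_eq_id mult.commute)
  have xM: "x \<in> M"
    unfolding x_def by (rule M_pow[OF b_M])
  have "y [^] p = \<one>" if y: "y \<in> M" for y
  proof (cases "y = \<one>")
    case False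
    obtain g where "g \<in> carrier G" "y = g \<otimes> x \<otimes> inv g"
      using conj_transitive[OF xM x1 y False] .
    then show ?thesis using xp M_carrier[OF xM] by (simp add: conj_pow)
  qed simp
  then show thesis using that p(1) by blast
qed

lemma card_M_prime_power:
  assumes p: "prime p" "\<And>x. x \<in> M \<Longrightarrow> x [^] p = \<one>"
  obtains n where "card M = p ^ n"
proof -
  have "q = p" if q: "prime q" "q dvd card M" for q
  proof (rule ccontr)
    assume "q \<noteq> p"
    then have "coprime p q" using p(1) q(1) by (metis primes_coprime)
    moreover obtain x where "x \<in> M" "x \<noteq> \<one>" "x [^] q = \<one>"
      using cauchy[OF finite_carrier subgroup_M q] by blast
    ultimately show False using pow_coprime_eq_one p(2) M_carrier by blast
  qed
  moreover have "card M > 0" using finite_M M_one card_gt_0_iff by blast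
  ultimately show thesis
    using prime_power_if_unique_prime_divisor[OF _ p(1)] that by metis
qed

lemma prime_dvd_card_subgroup_M:
  assumes p: "prime p" "\<And>x. x \<in> M \<Longrightarrow> x [^] p = \<one>"
    and F: "subgroup F G" "F \<subseteq> M" "w \<in> F" "w \<noteq> \<one>"
  shows "p dvd card F"
proof -
  obtain n where "card M = p ^ n" using card_M_prime_power[OF p] .
  then have "card F dvd p ^ n" using subgroup_card_dvd[OF F(1) subgroup_M F(2)] by simp
  then obtain i where i: "card F = p ^ i" using p(1) divides_primepow_nat by blast
  have "card {\<one>, w} \<le> card F"
    using F finite_M finite_subset subgroup.one_closed[OF F(1)] by (intro card_mono) auto
  then have "i \<noteq> 0" using i F(4) by (intro notI) auto
  then show ?thesis using i by simp
qed

text \<open>As a \<open>p\<close>-group, \<open>M\<close> has a nontrivial central element, and all nonidentity elements of \<open>M\<close> are conjugate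
to it.\<close>
lemma M_commute:
  assumes "x \<in> M" "y \<in> M"
  shows "x \<otimes> y = y \<otimes> x"
proof -
  obtain p :: nat where p: "prime p" "\<And>x. x \<in> M \<Longrightarrow> x [^] p = \<one>" by (rule exponent_prime) (rule that)
  obtain n where n: "card M = p ^ n" using card_M_prime_power[OF p] .
  have pM: "p dvd card M"
    using prime_dvd_card_subgroup_M[OF p subgroup_M _ b_M b(2)] by simp
  obtain z where z: "z \<in> M" "z \<noteq> \<one>" "\<And>k. k \<in> M \<Longrightarrow> k \<otimes> z = z \<otimes> k"
  proof (rule p_group_conj_fixed_point[OF subgroup_M n p(1) finite_M])
    show "M \<subseteq> carrier G" using M_carrier by blast
  qed (use pM M_one M_conj M_carrier that in auto)
  have "x \<otimes> y = y \<otimes> x" if x1: "x \<noteq> \<one>"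
  proof -
    obtain g where g: "g \<in> carrier G" "x = g \<otimes> z \<otimes> inv g"
      using conj_transitive[OF z(1,2) assms(1) x1] .
    define y' where "y' = inv g \<otimes> y \<otimes> g"
    have y': "y' \<in> M" "y = g \<otimes> y' \<otimes> inv g"
      using g(1) assms(2) M_conj_left M_carrier by (auto simp: y'_def word_simps)
    show ?thesis
      using z(3)[OF y'(1)] g y' z(1) M_carrier by (simp flip: conj_mult)
  qed
  then show ?thesis using assms M_carrier by (cases "x = \<one>") auto
qed

lemma card_class_times_centralizer:
  "(card M - 1) * card (centralizer G {b}) = Coset.order G"
proof -
  interpret A: group_action G "carrier G" "\<lambda>g. \<lambda>x\<in>carrier G. g \<otimes> x \<otimes> inv g"
    by (rule group_actionI) (auto simp: word_simps)
  let ?f = "\<lambda>g. \<lambda>x\<in>carrier G. g \<otimes> x \<otimes> inv g"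
  have "orbit G ?f b = M - {\<one>}"
    using b by (auto simp: orbit_def M_eq conj_eq_one_iff)
  moreover have "stabilizer G ?f b = centralizer G {b}"
    using b(1) by (simp add: stabilizer_def centralizer_def conj_eq_iff_commute cong: conj_cong)
  moreover have "card (M - {\<one>}) = card M - 1"
    using finite_M M_one by simp
  ultimately show ?thesis using A.orbit_stabilizer_theorem[OF b(1)] by simp
qed

lemma M_subset_centralizer: "w \<in> M \<Longrightarrow> M \<subseteq> centralizer G {w}"
  using M_commute M_carrier by (auto simp: mem_centralizer_singleton)

lemma self_centralizing_if_card_centralizer:
  assumes "card (centralizer G {b}) = card M"
  shows "M = centralizer G M"
proof
  show "M \<subseteq> centralizer G M" using M_commute M_carrier by (auto simp: centralizer_def)
  have "M = centralizer G {b}"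
    using assms finite_carrier M_subset_centralizer[OF b_M]
    by (intro card_subset_eq) (auto intro: finite_subset simp: centralizer_def)
  then show "centralizer G M \<subseteq> M" using b_M by (auto simp: centralizer_def)
qed

lemma conj_of_camina_pow:
  assumes "g \<in> carrier G" "g \<notin> M" "x \<in> M" "g [^] (n::nat) = \<one>"
  shows "(g \<otimes> x) [^] n = \<one>"
  using camina[OF assms(1-3)] assms(1,4) by (auto simp: conj_pow)

text \<open>An element \<open>h\<close> of prime order \<open>q \<noteq> p\<close> that commutes with \<open>w\<close> lies outside \<open>M\<close>, so it is conjugate to
\<open>h w\<close>. The latter has order \<open>p q\<close>.\<close>
lemma centralizer_prime_power:
  assumes p: "prime p" "\<And>x. x \<in> M \<Longrightarrow> x [^] p = \<one>" and w: "w \<in> M" "w \<noteq> \<one>"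
  obtains a where "card (centralizer G {w}) = p ^ a"
proof -
  have wG: "w \<in> carrier G" using w M_carrier by blast
  have sub: "subgroup (centralizer G {w}) G" using wG by (intro subgroup_centralizer) auto
  have "q = p" if q: "prime q" "q dvd card (centralizer G {w})" for q
  proof (rule ccontr)
    assume "q \<noteq> p"
    then have cop: "coprime p q" using p(1) q(1) by (metis primes_coprime)
    obtain h where h: "h \<in> centralizer G {w}" "h \<noteq> \<one>" "h [^] q = \<one>"
      using cauchy[OF finite_carrier sub q] by blast
    then have hG: "h \<in> carrier G" "h \<otimes> w = w \<otimes> h" by (auto simp: mem_centralizer_singleton)
    have "h \<notin> M" using pow_coprime_eq_one[OF hG(1) _ h(3) cop] p(2) h(2) by blast
    then have "(h \<otimes> w) [^] q = \<one>" using conj_of_camina_pow hG h w by blast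
    then have "w [^] q = \<one>" using hG wG h(3) by (simp add: pow_mult_distrib)
    then show False using pow_coprime_eq_one[OF wG _ _ cop] p(2) w by blast
  qed
  moreover have "card (centralizer G {w}) > 0"
    using subgroup.finite_imp_card_positive[OF sub finite_carrier] .
  ultimately show thesis
    using prime_power_if_unique_prime_divisor[OF _ p(1)] that by metis
qed

text \<open>Not only \<open>t\<close> but also \<open>t x\<close> squares to the identity, as the two are conjugate.\<close>
lemma involution_inverts:
  assumes "t \<in> carrier G" "t \<notin> M" "t \<otimes> t = \<one>" "x \<in> M"
  shows "t \<otimes> x \<otimes> t = inv x"
proof -
  have x: "x \<in> carrier G" using assms M_carrier by blast
  have "(t \<otimes> x) [^] (2::nat) = \<one>"
    using assms by (intro conj_of_camina_pow) (auto simp: numeral_2_eq_2)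
  then have "(t \<otimes> x \<otimes> t) \<otimes> x = \<one>" using assms(1) x by (simp add: numeral_2_eq_2 m_assoc)
  then show ?thesis using assms(1) x by (metis inv_equality m_closed)
qed

text \<open>An involution \<open>t\<close> inverts \<open>M\<close>, and so do its conjugates. Two of them differ by an element that
centralizes \<open>M\<close>, hence by an element of \<open>M\<close>, which makes them conjugate under \<open>M\<close>. Therefore \<open>C(t)\<close> is
a complement of \<open>M\<close>, and the Camina condition for an element \<open>h\<close> of \<open>C(t)\<close> says that already the
conjugates of \<open>h\<close> under \<open>M\<close> fill the coset \<open>M h\<close>. This is impossible if \<open>h\<close> commutes with \<open>b\<close>.\<close>
lemma centralizer_subset_if_self_centralizing_odd:
  fixes p :: nat
  assumes self: "M = centralizer G M"
    and p: "prime p" "\<And>x. x \<in> M \<Longrightarrow> x [^] p = \<one>" "odd p"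
  shows "centralizer G {b} \<subseteq> M"
proof
  fix h0 assume h0: "h0 \<in> centralizer G {b}"
  obtain n where n: "card M = p ^ n" using card_M_prime_power[OF p(1,2)] .
  have "even (Coset.order G)"
    using n p(3) by (simp flip: card_class_times_centralizer)
  then obtain t where t: "t \<in> carrier G" "t \<noteq> \<one>" "t [^] (2::nat) = \<one>"
    using cauchy[OF finite_carrier subgroup_self two_is_prime_nat] by (auto simp: Coset.order_def)
  have p2: "coprime p 2" using p(3) by simp
  have tM: "t \<notin> M" using pow_coprime_eq_one[OF t(1) p(2) t(3) p2] t(2) by blast
  have tt: "t \<otimes> t = \<one>" using t by (simp add: numeral_2_eq_2)
  have inv_t: "inv t = t" using t(1) tt by (metis inv_equality)
  define T where "T = centralizer G {t}"
  have T: "c \<in> T \<longleftrightarrow> c \<in> carrier G \<and> c \<otimes> t = t \<otimes> c" for c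
    by (simp add: T_def mem_centralizer_singleton)
  have subT: "subgroup T G" unfolding T_def using t(1) by (intro subgroup_centralizer) simp
  have TM: "x = \<one>" if "x \<in> T" "x \<in> M" for x
  proof -
    have x: "x \<in> carrier G" "x \<otimes> t = t \<otimes> x" using that T by auto
    have "inv x = t \<otimes> x \<otimes> t" using involution_inverts[OF t(1) tM tt that(2)] by simp
    also have "\<dots> = x" using x t(1) tt by (simp add: m_assoc) (simp flip: m_assoc add: tt)
    finally have "x [^] (2::nat) = \<one>" using x(1) by (metis numeral_2_eq_2 nat_pow_Suc nat_pow_0 l_one r_inv)
    then show ?thesis using pow_coprime_eq_one[OF x(1) p(2)[OF that(2)] _ p2] by blast
  qed
  \<comment> \<open>the Frattini argument: \<open>t\<close> and \<open>g t inv g\<close> are conjugate under \<open>M\<close>\<close>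
  have factor: "\<exists>y\<in>M. \<exists>c\<in>T. g = y \<otimes> c" if g: "g \<in> carrier G" for g
  proof -
    define s where "s = g \<otimes> t \<otimes> inv g"
    have sG: "s \<in> carrier G" using g t(1) by (simp add: s_def)
    have ss: "s \<otimes> s = \<one>" using g t(1) tt unfolding s_def by (simp flip: conj_mult)
    have sM: "s \<notin> M"
    proof
      assume "s \<in> M"
      then have "inv g \<otimes> s \<otimes> g \<in> M" using g M_conj_left by blast
      moreover have "inv g \<otimes> s \<otimes> g = t" using g t(1) by (simp add: s_def word_simps)
      ultimately show False using tM by simp
    qed
    have "s \<otimes> t \<in> centralizer G M"
    proof -
      have "(s \<otimes> t) \<otimes> x = x \<otimes> (s \<otimes> t)" if x: "x \<in> M" for x
      proof -
        have xG: "x \<in> carrier G" using x M_carrier by blast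
        have 1: "t \<otimes> x \<otimes> t = inv x" using involution_inverts[OF t(1) tM tt x] .
        have 2: "s \<otimes> inv x \<otimes> s = x" using involution_inverts[OF sG sM ss M_inv[OF x]] xG by simp
        have "(s \<otimes> t) \<otimes> x = s \<otimes> (t \<otimes> x \<otimes> t) \<otimes> t"
          using sG t(1) xG tt by (simp add: m_assoc)
        also have "\<dots> = (s \<otimes> inv x \<otimes> s) \<otimes> s \<otimes> t"
          using sG t(1) xG ss by (simp add: m_assoc 1[symmetric])
        also have "\<dots> = x \<otimes> (s \<otimes> t)" using 2 sG t(1) xG by (simp add: m_assoc)
        finally show ?thesis .
      qed
      then show ?thesis using sG t(1) by (auto simp: centralizer_def)
    qed
    then have stM: "s \<otimes> t \<in> M" using self by simp
    \<comment> \<open>a square root of \<open>s t\<close>, since \<open>p\<close> is odd\<close>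
    define y where "y = (s \<otimes> t) [^] ((p + 1) div 2)"
    have yM: "y \<in> M" unfolding y_def by (rule M_pow[OF stM])
    have yG: "y \<in> carrier G" using yM M_carrier by blast
    have "y \<otimes> y = (s \<otimes> t) [^] (Suc p)"
    proof -
      have "(p + 1) div 2 + (p + 1) div 2 = Suc p" using p(3) by presburger
      then show ?thesis unfolding y_def using sG t(1) by (simp add: nat_pow_mult)
    qed
    also have "\<dots> = s \<otimes> t" using p(2)[OF stM] sG t(1) by simp
    finally have yy: "y \<otimes> y = s \<otimes> t" .
    have tyt: "t \<otimes> y \<otimes> t = inv y" using involution_inverts[OF t(1) tM tt yM] .
    have "t \<otimes> inv y = y \<otimes> t"
    proof -
      have "t \<otimes> inv y = t \<otimes> (t \<otimes> y \<otimes> t)" by (simp add: tyt)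
      also have "\<dots> = (t \<otimes> t) \<otimes> (y \<otimes> t)" using t(1) yG by (simp add: m_assoc)
      finally show ?thesis using tt t(1) yG by simp
    qed
    then have "y \<otimes> t \<otimes> inv y = y \<otimes> y \<otimes> t" using t(1) yG by (simp add: m_assoc)
    also have "\<dots> = s" using yy sG t(1) tt by (simp add: m_assoc)
    finally have ys: "y \<otimes> t \<otimes> inv y = g \<otimes> t \<otimes> inv g" by (simp add: s_def)
    define c where "c = inv y \<otimes> g"
    have cG: "c \<in> carrier G" using yG g by (simp add: c_def)
    have "c \<otimes> t \<otimes> inv c = inv y \<otimes> (y \<otimes> t \<otimes> inv y) \<otimes> y"
      unfolding ys c_def using yG g t(1) by (simp add: word_simps)
    also have "\<dots> = t" using yG t(1) by (simp add: word_simps)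
    finally have "c \<in> T" using cG t(1) T conj_eq_iff_commute by simp
    moreover have "g = y \<otimes> c" using yG g by (simp add: c_def mult_inv_cancel)
    ultimately show ?thesis using yM by blast
  qed
  show "h0 \<in> M"
  proof (rule ccontr)
    assume h0M: "h0 \<notin> M"
    have h0G: "h0 \<in> carrier G" using h0 by (simp add: mem_centralizer_singleton)
    obtain y h where y: "y \<in> M" and h: "h \<in> T" and yh: "h0 = y \<otimes> h" using factor[OF h0G] by blast
    have yG: "y \<in> carrier G" and hG: "h \<in> carrier G" using y M_carrier h T by auto
    have hM: "h \<notin> M" using yh y h0M M_mult by blast
    have Cb: "subgroup (centralizer G {b}) G" using b by (intro subgroup_centralizer) auto
    have "h = inv y \<otimes> h0" using yh yG hG by (simp add: inv_mult_cancel)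
    moreover have "inv y \<in> centralizer G {b}" using M_subset_centralizer[OF b_M] M_inv[OF y] by blast
    ultimately have "h \<in> centralizer G {b}" using subgroup.m_closed[OF Cb _ h0] by simp
    then have hb: "h \<otimes> b = b \<otimes> h" by (simp add: mem_centralizer_singleton)
    \<comment> \<open>\<open>y \<mapsto> [y, h]\<close> maps \<open>M\<close> onto \<open>M\<close>, but sends \<open>b\<close> and the identity to the same element\<close>
    let ?f = "\<lambda>y. y \<otimes> h \<otimes> inv y \<otimes> inv h"
    have "x \<in> ?f ` M" if x: "x \<in> M" for x
    proof -
      have xG: "x \<in> carrier G" using x M_carrier by blast
      have "inv h \<otimes> x \<otimes> h \<in> M" using M_conj_left[OF hG x] .
      then obtain g where g: "g \<in> carrier G" "h \<otimes> (inv h \<otimes> x \<otimes> h) = g \<otimes> h \<otimes> inv g"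
        using camina[OF hG hM] by blast
      then have xh: "x \<otimes> h = g \<otimes> h \<otimes> inv g" using hG xG by (simp add: word_simps)
      obtain y c where y: "y \<in> M" and c: "c \<in> T" and yc: "g = y \<otimes> c" using factor[OF g(1)] by blast
      have yG: "y \<in> carrier G" and cG: "c \<in> carrier G" using y M_carrier c T by auto
      \<comment> \<open>\<open>k\<close> and \<open>h\<close> lie in the complement \<open>C(t)\<close> and agree modulo \<open>M\<close>\<close>
      define k where "k = c \<otimes> h \<otimes> inv c"
      have kT: "k \<in> T"
        unfolding k_def using subT c h by (simp add: subgroup.m_closed subgroup.m_inv_closed)
      then have kG: "k \<in> carrier G" using T by blast
      have xk: "x \<otimes> h = y \<otimes> k \<otimes> inv y"
        unfolding xh yc k_def using yG cG hG by (simp add: conj_conj)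
      have "k \<otimes> inv h = inv y \<otimes> (y \<otimes> k \<otimes> inv y) \<otimes> y \<otimes> inv h"
        using yG kG hG by (simp add: word_simps)
      also have "\<dots> = inv y \<otimes> x \<otimes> (h \<otimes> y \<otimes> inv h)"
        using yG xG hG by (simp add: word_simps flip: xk)
      also have "\<dots> \<in> M" using x y hG by (intro M_mult M_inv M_conj)
      finally have "k \<otimes> inv h \<in> M" .
      moreover have "k \<otimes> inv h \<in> T" using subT kT h by (simp add: subgroup.m_closed subgroup.m_inv_closed)
      ultimately have "k \<otimes> inv h = \<one>" using TM by blast
      then have "k = h" using inv_equality[of k "inv h"] kG hG by simp
      then have "x \<otimes> h \<otimes> inv h = ?f y" using xk by simp
      then have "x = ?f y" using xG hG by (simp add: m_assoc)
      then show ?thesis using y by blast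
    qed
    then have "M \<subseteq> ?f ` M" by (rule subsetI)
    then have "card M \<le> card (?f ` M)" by (rule card_mono[OF finite_imageI[OF finite_M]])
    then have "card (?f ` M) = card M" by (rule le_antisym[OF card_image_le[OF finite_M]])
    then have "inj_on ?f M" by (rule eq_card_imp_inj_on[OF finite_M])
    moreover have "?f b = ?f \<one>"
    proof -
      have "b \<otimes> h \<otimes> inv b = h" using conj_eq_iff_commute[OF b(1) hG] hb by simp
      then show ?thesis using hG by simp
    qed
    ultimately have "b = \<one>" by (rule inj_onD[OF _ _ b_M M_one])
    then show False using b(2) by simp
  qed
qed

end

locale self_centralizing_even = camina_single_class +
  assumes self: "M = centralizer G M" and two: "x \<in> M \<Longrightarrow> x \<otimes> x = \<one>"
begin

lemma two_pow: "x \<in> M \<Longrightarrow> x [^] (2::nat) = \<one>"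
  using two[of x] M_carrier[of x] by (simp add: numeral_2_eq_2)

lemma inv_eq_self: "x \<in> M \<Longrightarrow> inv x = x"
  using two[of x] M_carrier[of x] by (simp add: inv_equality)

text \<open>An involution outside \<open>M\<close> would invert, that is centralize, \<open>M\<close>.\<close>
lemma no_involution:
  assumes t: "t \<in> carrier G" "t \<notin> M"
  shows "t \<otimes> t \<noteq> \<one>"
proof
  assume tt: "t \<otimes> t = \<one>"
  have "t \<otimes> x = x \<otimes> t" if x: "x \<in> M" for x
  proof -
    have "t \<otimes> x \<otimes> t = x" using involution_inverts[OF t tt x] inv_eq_self[OF x] by simp
    then have "x \<otimes> t = t \<otimes> x \<otimes> (t \<otimes> t)" using t(1) M_carrier[OF x] by (metis m_assoc m_closed)
    then show ?thesis using t(1) M_carrier[OF x] tt by simp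
  qed
  then have "t \<in> centralizer G M" using t(1) by (auto simp: centralizer_def)
  then show False using self t(2) by simp
qed

text \<open>Otherwise \<open>|C\<^sub>M(x)| |C\<^sub>M(y)| \<le> |M|\<close>. As \<open>[M, x]\<close> has order \<open>|M| / |C\<^sub>M(x)|\<close> and lies in \<open>C\<^sub>M(x)\<close>, also
\<open>|M| \<le> |C\<^sub>M(x)|\<^sup>2\<close>, and the same holds for \<open>y\<close>. Together this forces \<open>|C\<^sub>M(x)|\<^sup>2 = |M|\<close> and
\<open>[M, x] = C\<^sub>M(x)\<close>. So \<open>x\<^sup>2\<close> is a commutator \<open>[m, x]\<close> with \<open>m \<in> M\<close>, and then \<open>m x\<close> is an involution.\<close>
lemma common_fixed_point:
  assumes x: "x \<in> carrier G" "x \<notin> M" "x \<otimes> x \<in> M"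
    and y: "y \<in> carrier G" "y \<notin> M" "y \<otimes> y \<in> M"
  shows "\<exists>w\<in>M. w \<noteq> \<one> \<and> x \<otimes> w = w \<otimes> x \<and> y \<otimes> w = w \<otimes> y"
proof (rule ccontr)
  assume no: "\<not> ?thesis"
  define Z where "Z u = {m \<in> M. u \<otimes> m = m \<otimes> u}" for u
  have finZ: "finite (Z u)" for u using finite_M by (simp add: Z_def)
  have Z_sub: "Z u \<subseteq> M" for u by (auto simp: Z_def)
  \<comment> \<open>the commutator \<open>[m, u]\<close>, as \<open>m\<close> is its own inverse\<close>
  define f where "f u m = m \<otimes> (u \<otimes> m \<otimes> inv u)" for u m
  have fZ: "f u m \<in> Z u" if u: "u \<in> carrier G" "u \<otimes> u \<in> M" and m: "m \<in> M" for u m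
  proof -
    have mG: "m \<in> carrier G" using m M_carrier by blast
    have cM: "u \<otimes> m \<otimes> inv u \<in> M" using M_conj u m by blast
    have "u \<otimes> (u \<otimes> m \<otimes> inv u) \<otimes> inv u = (u \<otimes> u) \<otimes> m \<otimes> inv (u \<otimes> u)"
      using u mG by (simp add: conj_conj)
    also have "\<dots> = m" using conj_eq_iff_commute[of "u \<otimes> u" m] M_commute[OF u(2) m] u(1) mG by blast
    finally have "u \<otimes> f u m \<otimes> inv u = (u \<otimes> m \<otimes> inv u) \<otimes> m"
      unfolding f_def using u mG by (simp add: conj_mult)
    also have "\<dots> = f u m" unfolding f_def using M_commute[OF m cM] by simp
    finally have "u \<otimes> f u m = f u m \<otimes> u"
      using conj_eq_iff_commute[OF u(1), of "f u m"] u mG by (simp add: f_def)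
    moreover have "f u m \<in> M" unfolding f_def using m cM M_mult by blast
    ultimately show ?thesis by (simp add: Z_def)
  qed
  have f_mult: "f u (m \<otimes> m') = f u m \<otimes> f u m'"
    if u: "u \<in> carrier G" and m: "m \<in> M" "m' \<in> M" for u m m'
  proof -
    have mG: "m \<in> carrier G" "m' \<in> carrier G" using m M_carrier by auto
    have cM: "u \<otimes> m \<otimes> inv u \<in> M" using M_conj u m by blast
    have cG: "u \<otimes> m \<otimes> inv u \<in> carrier G" "u \<otimes> m' \<otimes> inv u \<in> carrier G" using u mG by auto
    have "f u (m \<otimes> m') = m \<otimes> (m' \<otimes> (u \<otimes> m \<otimes> inv u)) \<otimes> (u \<otimes> m' \<otimes> inv u)"
      unfolding f_def conj_mult[OF u mG] using mG cG by (simp only: m_assoc m_closed)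
    also have "\<dots> = m \<otimes> ((u \<otimes> m \<otimes> inv u) \<otimes> m') \<otimes> (u \<otimes> m' \<otimes> inv u)"
      by (simp only: M_commute[OF m(2) cM])
    also have "\<dots> = f u m \<otimes> f u m'"
      unfolding f_def using mG cG by (simp only: m_assoc m_closed)
    finally show ?thesis .
  qed
  have kernel: "m \<in> Z u" if u: "u \<in> carrier G" and m: "m \<in> M" "f u m = \<one>" for u m
  proof -
    have mG: "m \<in> carrier G" using m M_carrier by blast
    have "(u \<otimes> m \<otimes> inv u) \<otimes> m = \<one>"
      using m M_commute[OF m(1) M_conj[OF u m(1)]] by (simp add: f_def)
    then have "u \<otimes> m \<otimes> inv u = inv m" using u mG by (metis inv_equality conj_closed inv_inv inv_closed)
    then have "u \<otimes> m \<otimes> inv u = m" using inv_eq_self[OF m(1)] by simp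
    then have "u \<otimes> m = m \<otimes> u" using conj_eq_iff_commute[OF u mG] by simp
    then show ?thesis using m by (simp add: Z_def)
  qed
  \<comment> \<open>\<open>f u\<close> is a homomorphism on \<open>M\<close> with kernel \<open>Z u\<close>\<close>
  have card_M_le: "card M \<le> card (f u ` M) * card (Z u)" if u: "u \<in> carrier G" for u
  proof -
    let ?r = "inv_into M (f u)"
    let ?g = "\<lambda>m. (f u m, ?r (f u m) \<otimes> m)"
    have r: "?r (f u m) \<in> M" "f u (?r (f u m)) = f u m" if "m \<in> M" for m
      using that by (auto intro: inv_into_into f_inv_into_f)
    have "?g m \<in> f u ` M \<times> Z u" if m: "m \<in> M" for m
    proof -
      have fM: "f u m \<in> M" unfolding f_def using M_mult[OF m M_conj[OF u m]] .
      have "f u (?r (f u m) \<otimes> m) = f u m \<otimes> f u m" using f_mult[OF u r(1)[OF m] m] r(2)[OF m] by simp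
      also have "\<dots> = \<one>" using two[OF fM] .
      finally show ?thesis using kernel[OF u M_mult[OF r(1)[OF m] m]] m by simp
    qed
    moreover have "inj_on ?g M"
    proof (rule inj_onI)
      fix m m' assume m: "m \<in> M" "m' \<in> M" and eq: "?g m = ?g m'"
      from eq have e1: "f u m = f u m'" by simp
      from eq have e2: "?r (f u m) \<otimes> m = ?r (f u m') \<otimes> m'" by (rule Pair_inject)
      have "?r (f u m) \<otimes> m = ?r (f u m) \<otimes> m'" using e2 by (simp only: e1)
      then show "m = m'" using r(1)[OF m(1)] m M_carrier by simp
    qed
    ultimately have "card M \<le> card (f u ` M \<times> Z u)"
      using finite_M finZ by (intro card_inj_on_le[of ?g]) auto
    then show ?thesis by (simp add: card_cartesian_product)
  qed
  have image_le: "card (f u ` M) \<le> card (Z u)" if "u \<in> carrier G" "u \<otimes> u \<in> M" for u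
    using fZ that finZ by (intro card_mono) auto
  have le_sq: "card M \<le> card (Z u) * card (Z u)" if "u \<in> carrier G" "u \<otimes> u \<in> M" for u
    using card_M_le[OF that(1)] image_le[OF that] by (meson le_trans mult_le_mono1)
  have Zmult: "m \<otimes> m' \<in> Z u" if "u \<in> carrier G" "m \<in> Z u" "m' \<in> Z u" for u m m'
  proof -
    have m: "m \<in> M" "m' \<in> M" "u \<otimes> m = m \<otimes> u" "u \<otimes> m' = m' \<otimes> u" using that by (auto simp: Z_def)
    then have "m \<in> carrier G" "m' \<in> carrier G" using M_carrier by auto
    then have "u \<otimes> (m \<otimes> m') = (m \<otimes> m') \<otimes> u" using m that(1) by (metis m_assoc)
    then show ?thesis using m M_mult by (simp add: Z_def)
  qed
  \<comment> \<open>\<open>Z x\<close> and \<open>Z y\<close> intersect trivially, so their product has \<open>|Z x| |Z y|\<close> elements\<close>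
  have "inj_on (\<lambda>(m, m'). m \<otimes> m') (Z x \<times> Z y)"
  proof (rule inj_onI, clarify)
    fix m m' n n' assume m: "m \<in> Z x" "n \<in> Z x" "m' \<in> Z y" "n' \<in> Z y" and eq: "m \<otimes> m' = n \<otimes> n'"
    then have mM: "m \<in> M" "n \<in> M" "m' \<in> M" "n' \<in> M" using Z_sub by blast+
    then have mG: "m \<in> carrier G" "n \<in> carrier G" "m' \<in> carrier G" "n' \<in> carrier G"
      using M_carrier by auto
    have "n \<otimes> m = n \<otimes> (m \<otimes> m') \<otimes> m'" using mG two[OF mM(3)] by (simp add: m_assoc)
    also have "\<dots> = (n \<otimes> n) \<otimes> (n' \<otimes> m')" using eq mG by (simp add: m_assoc)
    also have "\<dots> = n' \<otimes> m'" using two[OF mM(2)] mG by simp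
    finally have e: "n \<otimes> m = n' \<otimes> m'" .
    have "n \<otimes> m \<in> Z x" "n' \<otimes> m' \<in> Z y" using Zmult x(1) y(1) m by auto
    then have nm: "n \<otimes> m = \<one>" using no e Z_sub by (auto simp: Z_def)
    then have "n = m" using mG inv_eq_self[OF mM(1)] by (metis inv_equality inv_inv)
    moreover have "n' = m'" using nm e mG inv_eq_self[OF mM(3)] by (metis inv_equality inv_inv)
    ultimately show "m = n \<and> m' = n'" by simp
  qed
  moreover have "(\<lambda>(m, m'). m \<otimes> m') ` (Z x \<times> Z y) \<subseteq> M"
    using M_mult by (auto simp: Z_def)
  ultimately have "card (Z x \<times> Z y) \<le> card M" using finite_M card_inj_on_le by blast
  then have le: "card (Z x) * card (Z y) \<le> card M" by (simp add: card_cartesian_product)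
  have pos: "card (Z u) > 0" if "u \<in> carrier G" for u
    using finZ that M_one card_gt_0_iff by (fastforce simp: Z_def)
  have "card (Z y) \<le> card (Z x)"
    using le le_sq[OF x(1,3)] pos[OF x(1)] by (metis le_trans mult_le_cancel1 not_less0)
  moreover have "card (Z x) \<le> card (Z y)"
    using le le_sq[OF y(1,3)] pos[OF y(1)] by (metis le_trans mult_le_cancel2 not_less0)
  \<comment> \<open>now \<open>|Z x|\<^sup>2 = |M|\<close>, so \<open>f x\<close> maps \<open>M\<close> onto \<open>Z x\<close>, which contains \<open>x\<^sup>2\<close>\<close>
  ultimately have eq: "card (Z x) * card (Z x) \<le> card M" using le by simp
  then have "card (Z x) * card (Z x) \<le> card (f x ` M) * card (Z x)"
    using card_M_le[OF x(1)] by linarith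
  then have "card (Z x) \<le> card (f x ` M)" using pos[OF x(1)] by simp
  then have "f x ` M = Z x"
    using finZ fZ x(1,3) by (intro card_seteq) auto
  moreover have "x \<otimes> x \<in> Z x" using x by (simp add: Z_def m_assoc)
  ultimately obtain m where m: "m \<in> M" "f x m = x \<otimes> x" by (metis imageE)
  have mG: "m \<in> carrier G" using m M_carrier by blast
  have "(m \<otimes> x) \<otimes> (m \<otimes> x) = f x m \<otimes> (x \<otimes> x)"
    using mG x(1) unfolding f_def by (simp add: word_simps)
  also have "\<dots> = \<one>" using m(2) two[OF x(3)] by simp
  finally have "(m \<otimes> x) \<otimes> (m \<otimes> x) = \<one>" .
  moreover have "m \<otimes> x \<notin> M"
  proof
    assume "m \<otimes> x \<in> M"
    then have "inv m \<otimes> (m \<otimes> x) \<in> M" using M_mult M_inv m by blast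
    then show False using x mG by (simp add: inv_mult_cancel)
  qed
  ultimately show False using no_involution[of "m \<otimes> x"] mG x(1) by simp
qed

text \<open>The elements of \<open>C(w)\<close> that are involutions modulo \<open>M\<close>.\<close>
definition \<Omega> :: "'a \<Rightarrow> 'a set" where
  "\<Omega> w = {x \<in> carrier G. x \<notin> M \<and> x \<otimes> x \<in> M \<and> x \<otimes> w = w \<otimes> x}"

lemma finite_\<Omega>: "finite (\<Omega> w)"
  using finite_carrier by (simp add: \<Omega>_def)

lemma \<Omega>_subset_centralizer: "\<Omega> w \<subseteq> centralizer G {w}"
  by (auto simp: \<Omega>_def mem_centralizer_singleton)

lemma conj_\<Omega>:
  assumes g: "g \<in> carrier G" and x: "x \<in> \<Omega> w" and w: "w \<in> carrier G"
  shows "g \<otimes> x \<otimes> inv g \<in> \<Omega> (g \<otimes> w \<otimes> inv g)"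
proof -
  have x': "x \<in> carrier G" "x \<notin> M" "x \<otimes> x \<in> M" "x \<otimes> w = w \<otimes> x" using x by (auto simp: \<Omega>_def)
  have "g \<otimes> x \<otimes> inv g \<notin> M"
  proof
    assume "g \<otimes> x \<otimes> inv g \<in> M"
    then have "inv g \<otimes> (g \<otimes> x \<otimes> inv g) \<otimes> g \<in> M" using M_conj_left g by blast
    then show False using x' g by (simp add: word_simps)
  qed
  moreover have "(g \<otimes> x \<otimes> inv g) \<otimes> (g \<otimes> x \<otimes> inv g) \<in> M"
    using M_conj[OF g x'(3)] x' g by (simp add: conj_mult)
  moreover have "(g \<otimes> x \<otimes> inv g) \<otimes> (g \<otimes> w \<otimes> inv g) = (g \<otimes> w \<otimes> inv g) \<otimes> (g \<otimes> x \<otimes> inv g)"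
    using x' g w by (simp flip: conj_mult)
  ultimately show ?thesis using x' g by (simp add: \<Omega>_def)
qed

lemma card_\<Omega>_le:
  assumes w: "w \<in> M" "w \<noteq> \<one>" and w': "w' \<in> M" "w' \<noteq> \<one>"
  shows "card (\<Omega> w) \<le> card (\<Omega> w')"
proof -
  obtain g where g: "g \<in> carrier G" "w' = g \<otimes> w \<otimes> inv g" using conj_transitive[OF w w'] .
  have "inj_on (\<lambda>x. g \<otimes> x \<otimes> inv g) (\<Omega> w)"
    using g(1) by (intro conj_inj_on) (auto simp: \<Omega>_def)
  moreover have "(\<lambda>x. g \<otimes> x \<otimes> inv g) ` \<Omega> w \<subseteq> \<Omega> w'"
    using conj_\<Omega>[OF g(1)] g(2) M_carrier[OF w(1)] by auto
  ultimately show ?thesis using finite_\<Omega> card_inj_on_le by blast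
qed

text \<open>The argument of the Baer-Suzuki theorem. Choose two different sets of this kind with an intersection
\<open>\<Delta>\<close> as large as possible. As the centralizers are \<open>2\<close>-groups, each of the two sets has an element
outside \<open>\<Delta>\<close> that normalizes \<open>\<Delta>\<close>. These two elements have a common fixed point in \<open>M - {1}\<close>, and even
one, \<open>z\<close>, that is also fixed by \<open>\<Delta>\<close>. Then \<open>\<Omega> z\<close> meets both sets in more than \<open>\<Delta>\<close>, so it equals both.\<close>
lemma \<Omega>_all_equal:
  assumes w: "w \<in> M" "w \<noteq> \<one>" and w': "w' \<in> M" "w' \<noteq> \<one>"
  shows "\<Omega> w = \<Omega> w'"
proof (rule ccontr)
  assume ne: "\<Omega> w \<noteq> \<Omega> w'"
  define P where "P = (\<lambda>(v, v'). v \<in> M - {\<one>} \<and> v' \<in> M - {\<one>} \<and> \<Omega> v \<noteq> \<Omega> v')"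
  define c where "c = (\<lambda>(v, v'). card (\<Omega> v \<inter> \<Omega> v'))"
  have Pw: "P (w, w')" using w w' ne by (simp add: P_def)
  have bound: "\<forall>q. P q \<longrightarrow> c q < Suc (card (carrier G))"
    using finite_carrier by (auto simp: less_Suc_eq_le c_def \<Omega>_def intro!: card_mono)
  obtain q where q: "P q" "\<forall>r. P r \<longrightarrow> c r \<le> c q"
    using ex_has_greatest_nat[OF Pw bound] by (elim exE conjE) (rule that)
  obtain v v' where vv: "q = (v, v')" by fastforce
  have v: "v \<in> M" "v \<noteq> \<one>" "v' \<in> M" "v' \<noteq> \<one>" "\<Omega> v \<noteq> \<Omega> v'" using q(1) vv by (auto simp: P_def)
  have max: "\<Omega> u = \<Omega> u'" if "u \<in> M" "u \<noteq> \<one>" "u' \<in> M" "u' \<noteq> \<one>"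
    "card (\<Omega> v \<inter> \<Omega> v') < card (\<Omega> u \<inter> \<Omega> u')" for u u'
    using q(2)[rule_format, of "(u, u')"] that vv by (auto simp: P_def c_def)
  have grow: "\<exists>x\<in>\<Omega> u. x \<notin> \<Omega> u' \<and> (\<lambda>d. x \<otimes> d \<otimes> inv x) ` (\<Omega> u \<inter> \<Omega> u') = \<Omega> u \<inter> \<Omega> u'"
    if u: "u \<in> M" "u \<noteq> \<one>" "u' \<in> M" "u' \<noteq> \<one>" "\<Omega> u \<noteq> \<Omega> u'" for u u'
  proof -
    have uG: "u \<in> carrier G" "u' \<in> carrier G" using u M_carrier by auto
    obtain a where a: "card (centralizer G {u}) = 2 ^ a"
      using centralizer_prime_power[OF two_is_prime_nat two_pow u(1,2)] .
    let ?S = "centralizer G {u}" and ?Q = "centralizer G {u, u'}"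
    have S: "subgroup ?S G" and Q: "subgroup ?Q G" using uG by (auto intro!: subgroup_centralizer)
    have X: "\<Omega> u \<inter> ?Q = \<Omega> u \<inter> \<Omega> u'" by (auto simp: \<Omega>_def centralizer_def)
    have "\<not> \<Omega> u \<subseteq> \<Omega> u'"
      using u(5) card_\<Omega>_le[OF u(3,4,1,2)] finite_\<Omega> card_seteq by blast
    then have nsub: "\<not> \<Omega> u \<subseteq> ?Q" using X by blast
    have inv: "s \<otimes> x \<otimes> inv s \<in> \<Omega> u" if s: "s \<in> ?S" and x: "x \<in> \<Omega> u" for s x
    proof -
      have "s \<in> carrier G" "s \<otimes> u = u \<otimes> s" using s by (auto simp: mem_centralizer_singleton)
      then have "s \<in> carrier G" "s \<otimes> u \<otimes> inv s = u" using uG conj_eq_iff_commute by blast+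
      then show ?thesis using conj_\<Omega>[of s x u] x uG by simp
    qed
    have QS: "?Q \<subseteq> ?S" by (auto simp: centralizer_def)
    obtain x where x: "x \<in> \<Omega> u" "x \<notin> ?Q" "(\<lambda>d. x \<otimes> d \<otimes> inv x) ` (\<Omega> u \<inter> ?Q) = \<Omega> u \<inter> ?Q"
      using p_group_normal_set_normalizer[OF finite_carrier S a two_is_prime_nat \<Omega>_subset_centralizer inv Q QS nsub] .
    then have "x \<notin> \<Omega> u'" using X by blast
    then show ?thesis using x X by auto
  qed
  define \<Delta> where "\<Delta> = \<Omega> v \<inter> \<Omega> v'"
  obtain x where x: "x \<in> \<Omega> v" "x \<notin> \<Omega> v'" "(\<lambda>d. x \<otimes> d \<otimes> inv x) ` \<Delta> = \<Delta>"
    using grow[OF v] unfolding \<Delta>_def by blast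
  obtain y where y: "y \<in> \<Omega> v'" "y \<notin> \<Omega> v" "(\<lambda>d. y \<otimes> d \<otimes> inv y) ` \<Delta> = \<Delta>"
    using grow[OF v(3,4,1,2)] v(5) unfolding \<Delta>_def by (metis Int_commute)
  have \<Delta>G: "\<Delta> \<subseteq> carrier G" by (auto simp: \<Delta>_def \<Omega>_def)
  define F where "F = {m \<in> M. \<forall>d\<in>\<Delta>. d \<otimes> m = m \<otimes> d}"
  have F: "subgroup F G"
  proof (rule finite_mult_closed_imp_subgroup)
    show "F \<noteq> {}" using M_one \<Delta>G by (auto simp: F_def intro!: exI[of _ \<one>])
    fix m m' assume m: "m \<in> F" "m' \<in> F"
    then have mG: "m \<in> carrier G" "m' \<in> carrier G" using M_carrier by (auto simp: F_def)
    have "d \<otimes> (m \<otimes> m') = (m \<otimes> m') \<otimes> d" if "d \<in> \<Delta>" for d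
      using m mG that \<Delta>G by (auto simp: F_def subset_iff) (metis m_assoc)
    then show "m \<otimes> m' \<in> F" using m M_mult by (simp add: F_def)
  qed (use finite_M M_carrier in \<open>auto simp: F_def\<close>)
  have vF: "v \<in> F" using v(1) by (auto simp: F_def \<Delta>_def \<Omega>_def)
  have norm: "u \<otimes> m \<otimes> inv u \<in> F"
    if u: "u \<in> carrier G" "(\<lambda>d. u \<otimes> d \<otimes> inv u) ` \<Delta> = \<Delta>" and m: "m \<in> F" for u m
  proof -
    have mM: "m \<in> M" using m by (simp add: F_def)
    have "d \<otimes> (u \<otimes> m \<otimes> inv u) = (u \<otimes> m \<otimes> inv u) \<otimes> d" if d: "d \<in> \<Delta>" for d
    proof -
      from d have "d \<in> (\<lambda>d. u \<otimes> d \<otimes> inv u) ` \<Delta>" by (simp only: u(2))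
      then obtain d' where d': "d = u \<otimes> d' \<otimes> inv u" "d' \<in> \<Delta>" by (rule imageE)
      have "d' \<otimes> m = m \<otimes> d'" using d'(2) m by (simp add: F_def)
      moreover have "d' \<in> carrier G" using d'(2) \<Delta>G by (rule rev_subsetD)
      ultimately show ?thesis unfolding d'(1) using u(1) M_carrier[OF mM] by (simp flip: conj_mult)
    qed
    then show ?thesis using M_conj[OF u(1) mM] by (simp add: F_def)
  qed
  obtain w0 where w0: "w0 \<in> M" "w0 \<noteq> \<one>" "x \<otimes> w0 = w0 \<otimes> x" "y \<otimes> w0 = w0 \<otimes> y"
    using common_fixed_point[of x y] x(1) y(1) by (auto simp: \<Omega>_def)
  obtain a where a: "card (centralizer G {w0}) = 2 ^ a"
    using centralizer_prime_power[OF two_is_prime_nat two_pow w0(1,2)] .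
  \<comment> \<open>a \<open>2\<close>-group that contains \<open>x\<close> and \<open>y\<close> and acts on the fixed points \<open>F\<close> of \<open>\<Delta>\<close>\<close>
  define K where "K = {g \<in> centralizer G {w0}. \<forall>m\<in>F. g \<otimes> m \<otimes> inv g \<in> F}"
  have Cw0: "subgroup (centralizer G {w0}) G" using M_carrier[OF w0(1)] by (intro subgroup_centralizer) simp
  have KG: "K \<subseteq> carrier G" by (auto simp: K_def mem_centralizer_singleton)
  have FG: "F \<subseteq> carrier G" using F subgroup.subset by blast
  have xy: "x \<in> K" "y \<in> K"
    using x y w0 norm by (auto simp: K_def mem_centralizer_singleton \<Omega>_def)
  have K: "subgroup K G"
  proof (rule finite_mult_closed_imp_subgroup)
    show "finite K" using KG finite_carrier finite_subset by blast
    show "K \<noteq> {}" using xy by blast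
    fix s t assume st: "s \<in> K" "t \<in> K"
    have "(s \<otimes> t) \<otimes> m \<otimes> inv (s \<otimes> t) \<in> F" if "m \<in> F" for m
      using st that KG FG by (subst conj_conj[symmetric]) (auto simp: K_def)
    then show "s \<otimes> t \<in> K" using st subgroup.m_closed[OF Cw0] by (simp add: K_def)
  qed (rule KG)
  have "card K dvd 2 ^ a"
    using subgroup_card_dvd[OF K Cw0] a by (auto simp: K_def)
  then obtain i where i: "card K = 2 ^ i" using divides_primepow_nat[OF two_is_prime_nat] by blast
  obtain z where z: "z \<in> F" "z \<noteq> \<one>" "\<And>k. k \<in> K \<Longrightarrow> k \<otimes> z = z \<otimes> k"
  proof (rule p_group_conj_fixed_point[OF K i two_is_prime_nat _ FG])
    show "finite F" using FG finite_carrier finite_subset by blast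
    show "2 dvd card F"
      using prime_dvd_card_subgroup_M[OF two_is_prime_nat two_pow F _ vF v(2)] by (auto simp: F_def)
    show "\<one> \<in> F" using subgroup.one_closed[OF F] .
  qed (auto simp: K_def that)
  have zM: "z \<in> M" using z(1) by (simp add: F_def)
  have \<Delta>z: "\<Delta> \<subseteq> \<Omega> z" using z(1) by (auto simp: F_def \<Delta>_def \<Omega>_def)
  have "x \<in> \<Omega> z" "y \<in> \<Omega> z" using x(1) y(1) z(3) xy by (auto simp: \<Omega>_def)
  then have "insert x \<Delta> \<subseteq> \<Omega> z \<inter> \<Omega> v" "insert y \<Delta> \<subseteq> \<Omega> z \<inter> \<Omega> v'"
    using \<Delta>z x(1) y(1) by (auto simp: \<Delta>_def)
  moreover have "x \<notin> \<Delta>" "y \<notin> \<Delta>" "finite \<Delta>" using x(2) y(2) finite_\<Omega> by (auto simp: \<Delta>_def)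
  ultimately have "card \<Delta> < card (\<Omega> z \<inter> \<Omega> v)" "card \<Delta> < card (\<Omega> z \<inter> \<Omega> v')"
    using finite_\<Omega> by (metis Suc_le_eq card_insert_disjoint card_mono finite_Int)+
  then have "\<Omega> z = \<Omega> v" "\<Omega> z = \<Omega> v'" using max zM z(2) v(1-4) unfolding \<Delta>_def by auto
  then show False using v(5) by simp
qed

text \<open>If the \<open>2\<close>-group \<open>C(b)\<close> were larger than \<open>M\<close>, some \<open>\<Omega> w\<close> would have an element. It would lie in all of
these sets, so it would centralize \<open>M\<close>.\<close>
lemma centralizer_subset_if_self_centralizing_even: "centralizer G {b} \<subseteq> M"
proof (rule ccontr)
  assume "\<not> centralizer G {b} \<subseteq> M"
  then obtain h where h: "h \<in> centralizer G {b}" "h \<notin> M" by blast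
  obtain a where a: "card (centralizer G {b}) = 2 ^ a"
    using centralizer_prime_power[OF two_is_prime_nat two_pow b_M b(2)] .
  have hG: "h \<in> carrier G" using h by (simp add: mem_centralizer_singleton)
  have "ord h dvd 2 ^ a"
  proof -
    interpret Cb: group "G\<lparr>carrier := centralizer G {b}\<rparr>"
      using b(1) by (intro subgroup_imp_group subgroup_centralizer) simp
    have "h [^]\<^bsub>G\<lparr>carrier := centralizer G {b}\<rparr>\<^esub> card (centralizer G {b}) = \<one>"
      using Cb.pow_order_eq_1[of h] h by (simp add: Coset.order_def)
    then have "h [^] (2 ^ a :: nat) = \<one>" using a by (simp add: nat_pow_consistent[symmetric])
    then show ?thesis using pow_eq_id[OF hG] by blast
  qed
  then have "h [^] (2 ^ a :: nat) = \<one>" by (rule iffD2[OF pow_eq_id[OF hG]])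
  then have ex: "h [^] (2 ^ a :: nat) \<in> M" using M_one by simp
  \<comment> \<open>the last of the iterated squares of \<open>h\<close> outside \<open>M\<close> lies in some \<open>\<Omega> w\<close>\<close>
  define i where "i = (LEAST i. h [^] (2 ^ i :: nat) \<in> M)"
  have i: "h [^] (2 ^ i :: nat) \<in> M" unfolding i_def using ex by (rule LeastI)
  have "i \<noteq> 0" using i h(2) hG by (intro notI) simp
  then obtain j where j: "i = Suc j" by (cases i) auto
  define x where "x = h [^] (2 ^ j :: nat)"
  have xG: "x \<in> carrier G" using hG by (simp add: x_def)
  have "x \<notin> M" unfolding x_def using not_less_Least[of j "\<lambda>i. h [^] (2 ^ i :: nat) \<in> M"] j i_def by simp
  moreover have "x \<otimes> x \<in> M" using i j hG by (simp add: x_def nat_pow_mult mult_2)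
  ultimately obtain w where w: "w \<in> M" "w \<noteq> \<one>" "x \<in> \<Omega> w"
    using common_fixed_point[of x x] xG by (auto simp: \<Omega>_def)
  have "x \<otimes> m = m \<otimes> x" if "m \<in> M" for m
    using \<Omega>_all_equal[OF w(1,2) that] w(3) xG by (cases "m = \<one>") (auto simp: \<Omega>_def)
  then have "x \<in> centralizer G M" using xG by (simp add: centralizer_def)
  then show False using \<open>x \<notin> M\<close> self by simp
qed

end

context camina_single_class
begin

text \<open>The orders decide because \<open>M \<le> C(b)\<close> always holds.\<close>
theorem self_centralizing_iff_card_centralizer:
  "M = centralizer G M \<longleftrightarrow> card (centralizer G {b}) = card M"
proof
  assume self: "M = centralizer G M"
  obtain p :: nat where p: "prime p" "\<And>x. x \<in> M \<Longrightarrow> x [^] p = \<one>" by (rule exponent_prime) (rule that)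
  have "centralizer G {b} \<subseteq> M"
  proof (cases "odd p")
    case True
    then show ?thesis using centralizer_subset_if_self_centralizing_odd[OF self p] by simp
  next
    case False
    then have "p = 2" using p(1) by (metis primes_dvd_imp_eq two_is_prime_nat)
    have two: "x \<otimes> x = \<one>" if "x \<in> M" for x
      using p(2)[OF that] M_carrier[OF that] by (simp add: \<open>p = 2\<close> numeral_2_eq_2)
    interpret self_centralizing_even G M b
      by unfold_locales (rule self, rule two)
    show ?thesis by (rule centralizer_subset_if_self_centralizing_even)
  qed
  then show "card (centralizer G {b}) = card M"
    using M_subset_centralizer[OF b_M] by (metis subset_antisym)
qed (rule self_centralizing_if_card_centralizer)

end

section \<open>Schur's lemma and the convolution of irreducible characters\<close>

lemma mult_mat_entry:
  fixes A B :: "'a :: semiring_0 mat"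
  assumes "A \<in> carrier_mat n k" "B \<in> carrier_mat k m" "i < n" "j < m"
  shows "(A * B) $$ (i, j) = (\<Sum>l<k. A $$ (i, l) * B $$ (l, j))"
  using assms by (simp add: scalar_prod_def atLeast0LessThan)

lemma mat_trace_eq_sum: "A \<in> carrier_mat n n \<Longrightarrow> mat_trace A = (\<Sum>i<n. A $$ (i, i))"
  by (simp add: mat_trace_def diag_mat_def interv_sum_list_conv_sum_set_nat atLeast0LessThan)

lemma mat_trace_mult_comm:
  assumes A: "A \<in> carrier_mat n m" and B: "B \<in> carrier_mat m n"
  shows "mat_trace (A * B) = mat_trace (B * A)"
proof -
  have "mat_trace (A * B) = (\<Sum>i<n. \<Sum>j<m. A $$ (i, j) * B $$ (j, i))"
    using A B by (subst mat_trace_eq_sum[of _ n]) (auto intro!: sum.cong mult_mat_entry simp del: index_mult_mat)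
  also have "\<dots> = (\<Sum>j<m. \<Sum>i<n. B $$ (j, i) * A $$ (i, j))"
    by (subst sum.swap) (simp add: mult.commute)
  also have "\<dots> = mat_trace (B * A)"
    using A B by (subst mat_trace_eq_sum[of _ m]) (auto intro!: sum.cong mult_mat_entry[symmetric] simp del: index_mult_mat)
  finally show ?thesis .
qed

text \<open>The type of matrices of all sizes has no zero that fits every size, so the sum of a family is taken
entry by entry for a given size.\<close>
definition mat_family_sum :: "nat \<Rightarrow> nat \<Rightarrow> 'b set \<Rightarrow> ('b \<Rightarrow> complex mat) \<Rightarrow> complex mat" where
  "mat_family_sum n m I F = mat n m (\<lambda>(i, j). \<Sum>x\<in>I. F x $$ (i, j))"

lemma mat_family_sum_carrier [simp]: "mat_family_sum n m I F \<in> carrier_mat n m"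
  by (simp add: mat_family_sum_def)

lemma mat_family_sum_entry:
  "\<lbrakk>i < n; j < m\<rbrakk> \<Longrightarrow> mat_family_sum n m I F $$ (i, j) = (\<Sum>x\<in>I. F x $$ (i, j))"
  by (simp add: mat_family_sum_def)

lemma mult_mat_family_sum:
  assumes "A \<in> carrier_mat k n" "\<And>x. x \<in> I \<Longrightarrow> F x \<in> carrier_mat n m"
  shows "A * mat_family_sum n m I F = mat_family_sum k m I (\<lambda>x. A * F x)"
proof (rule eq_matI)
  fix i j assume "i < dim_row (mat_family_sum k m I (\<lambda>x. A * F x))"
    "j < dim_col (mat_family_sum k m I (\<lambda>x. A * F x))"
  then have ij: "i < k" "j < m" by (simp_all add: mat_family_sum_def)
  have "(A * mat_family_sum n m I F) $$ (i, j) = (\<Sum>l<n. A $$ (i, l) * (\<Sum>x\<in>I. F x $$ (l, j)))"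
    using assms(1) ij by (simp add: mult_mat_entry[OF assms(1) mat_family_sum_carrier] mat_family_sum_entry)
  also have "\<dots> = (\<Sum>x\<in>I. \<Sum>l<n. A $$ (i, l) * F x $$ (l, j))"
    by (simp add: sum_distrib_left) (rule sum.swap)
  also have "\<dots> = mat_family_sum k m I (\<lambda>x. A * F x) $$ (i, j)"
    using ij by (simp add: mat_family_sum_entry mult_mat_entry[OF assms] del: index_mult_mat)
  finally show "(A * mat_family_sum n m I F) $$ (i, j) = mat_family_sum k m I (\<lambda>x. A * F x) $$ (i, j)" .
qed (use assms(1) in \<open>simp_all add: mat_family_sum_def\<close>)

lemma mat_family_sum_mult:
  assumes "\<And>x. x \<in> I \<Longrightarrow> F x \<in> carrier_mat k n" "A \<in> carrier_mat n m"
  shows "mat_family_sum k n I F * A = mat_family_sum k m I (\<lambda>x. F x * A)"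
proof (rule eq_matI)
  fix i j assume "i < dim_row (mat_family_sum k m I (\<lambda>x. F x * A))"
    "j < dim_col (mat_family_sum k m I (\<lambda>x. F x * A))"
  then have ij: "i < k" "j < m" by (simp_all add: mat_family_sum_def)
  have "(mat_family_sum k n I F * A) $$ (i, j) = (\<Sum>l<n. (\<Sum>x\<in>I. F x $$ (i, l)) * A $$ (l, j))"
    using assms(2) ij by (simp add: mult_mat_entry[OF mat_family_sum_carrier assms(2)] mat_family_sum_entry)
  also have "\<dots> = (\<Sum>x\<in>I. \<Sum>l<n. F x $$ (i, l) * A $$ (l, j))"
    by (simp add: sum_distrib_right) (rule sum.swap)
  also have "\<dots> = mat_family_sum k m I (\<lambda>x. F x * A) $$ (i, j)"
    using ij by (simp add: mat_family_sum_entry mult_mat_entry[OF assms] del: index_mult_mat)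
  finally show "(mat_family_sum k n I F * A) $$ (i, j) = mat_family_sum k m I (\<lambda>x. F x * A) $$ (i, j)" .
qed (use assms(2) in \<open>simp_all add: mat_family_sum_def\<close>)

lemma mat_trace_family_sum:
  assumes "\<And>x. x \<in> I \<Longrightarrow> F x \<in> carrier_mat n n"
  shows "mat_trace (mat_family_sum n n I F) = (\<Sum>x\<in>I. mat_trace (F x))"
proof -
  have "mat_trace (mat_family_sum n n I F) = (\<Sum>i<n. \<Sum>x\<in>I. F x $$ (i, i))"
    by (simp add: mat_trace_eq_sum[OF mat_family_sum_carrier] mat_family_sum_entry)
  also have "\<dots> = (\<Sum>x\<in>I. \<Sum>i<n. F x $$ (i, i))" by (rule sum.swap)
  also have "\<dots> = (\<Sum>x\<in>I. mat_trace (F x))"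
    by (rule sum.cong) (simp_all add: mat_trace_eq_sum[OF assms])
  finally show ?thesis .
qed

definition matrix_rep :: "('a, 'm) monoid_scheme \<Rightarrow> nat \<Rightarrow> ('a \<Rightarrow> complex mat) \<Rightarrow> bool" where
  "matrix_rep G n \<rho> \<longleftrightarrow>
     (\<forall>g\<in>carrier G. \<rho> g \<in> carrier_mat n n) \<and> \<rho> \<one>\<^bsub>G\<^esub> = 1\<^sub>m n \<and>
     (\<forall>g\<in>carrier G. \<forall>h\<in>carrier G. \<rho> (g \<otimes>\<^bsub>G\<^esub> h) = \<rho> g * \<rho> h)"

definition invariant_subspace ::
    "('a, 'm) monoid_scheme \<Rightarrow> nat \<Rightarrow> ('a \<Rightarrow> complex mat) \<Rightarrow> complex vec set \<Rightarrow> bool" where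
  "invariant_subspace G n \<rho> W \<longleftrightarrow>
     W \<subseteq> carrier_vec n \<and> 0\<^sub>v n \<in> W \<and> (\<forall>v\<in>W. \<forall>w\<in>W. v + w \<in> W) \<and>
     (\<forall>c. \<forall>v\<in>W. c \<cdot>\<^sub>v v \<in> W) \<and> (\<forall>g\<in>carrier G. \<forall>w\<in>W. \<rho> g *\<^sub>v w \<in> W)"

lemma subspace_module_vec_iff:
  fixes W :: "complex vec set"
  shows "VectorSpace.subspace class_ring W (module_vec TYPE(complex) n) \<longleftrightarrow>
    W \<subseteq> carrier_vec n \<and> 0\<^sub>v n \<in> W \<and> (\<forall>v\<in>W. \<forall>w\<in>W. v + w \<in> W) \<and> (\<forall>c. \<forall>v\<in>W. c \<cdot>\<^sub>v v \<in> W)"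
  using vec_vs[of n, where 'a = complex] vec_module[of n, where 'a = complex]
  by (auto simp: VectorSpace.subspace_def submodule_def module_vec_simps)

lemma (in group) irreducible_rep_iff:
  "irreducible_rep G n \<rho> \<longleftrightarrow>
     matrix_rep G n \<rho> \<and> n > 0 \<and>
     (\<forall>W. invariant_subspace G n \<rho> W \<longrightarrow> W = {0\<^sub>v n} \<or> W = carrier_vec n)"
proof -
  interpret R: Ring.ring "ring_mat TYPE(complex) n ()"
    by (rule ring_mat)
  have "\<rho> \<in> hom G (GL n) \<longleftrightarrow> matrix_rep G n \<rho>"
  proof
    assume hom: "\<rho> \<in> hom G (GL n)"
    then have "group_hom G (GL n) \<rho>"
      using is_group R.units_group by (simp add: group_hom_def group_hom_axioms_def)
    then have "\<rho> \<one> = 1\<^sub>m n"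
      using group_hom.hom_one by (fastforce simp: units_of_def ring_mat_def)
    then show "matrix_rep G n \<rho>"
      using hom by (auto simp: matrix_rep_def hom_def units_of_def Units_def ring_mat_def Pi_iff)
  next
    assume rep: "matrix_rep G n \<rho>"
    then have "\<rho> g * \<rho> (inv g) = 1\<^sub>m n" "\<rho> (inv g) * \<rho> g = 1\<^sub>m n" if "g \<in> carrier G" for g
      using that by (metis inv_closed matrix_rep_def r_inv, metis inv_closed matrix_rep_def l_inv)
    then show "\<rho> \<in> hom G (GL n)"
      using rep by (auto simp: matrix_rep_def hom_def units_of_def Units_def ring_mat_def Pi_iff)
        (metis inv_closed)
  qed
  then show ?thesis
    by (auto simp: irreducible_rep_def subspace_module_vec_iff invariant_subspace_def)
qed

lemma matrix_repD:
  assumes "matrix_rep G n \<rho>"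
  shows "g \<in> carrier G \<Longrightarrow> \<rho> g \<in> carrier_mat n n" "\<rho> \<one>\<^bsub>G\<^esub> = 1\<^sub>m n"
    "g \<in> carrier G \<Longrightarrow> h \<in> carrier G \<Longrightarrow> \<rho> (g \<otimes>\<^bsub>G\<^esub> h) = \<rho> g * \<rho> h"
  using assms by (auto simp: matrix_rep_def)

lemma eq_mat_if_mult_vec_eq:
  fixes A B :: "complex mat"
  assumes AB: "A \<in> carrier_mat n m" "B \<in> carrier_mat n m"
    and eq: "\<And>v. v \<in> carrier_vec m \<Longrightarrow> A *\<^sub>v v = B *\<^sub>v v"
  shows "A = B"
proof (rule eq_matI)
  fix i j assume "i < dim_row B" "j < dim_col B"
  then have ij: "i < n" "j < m" using AB by auto
  have "A $$ (i, j) = (A *\<^sub>v unit_vec m j) $ i" using AB ij by (simp add: mult_mat_vec_def)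
  also have "\<dots> = B $$ (i, j)" using AB ij eq[of "unit_vec m j"] by (simp add: mult_mat_vec_def)
  finally show "A $$ (i, j) = B $$ (i, j)" .
qed (use AB in auto)

lemma mult_mat_vec_zero_imp_zero:
  fixes A :: "complex mat"
  assumes A: "A \<in> carrier_mat n m" and zero: "\<And>v. v \<in> carrier_vec m \<Longrightarrow> A *\<^sub>v v = 0\<^sub>v n"
  shows "A = 0\<^sub>m n m"
  using A by (rule eq_mat_if_mult_vec_eq) (auto simp: zero)

lemma mult_mat_vec_zero_vec: "A \<in> carrier_mat n m \<Longrightarrow> A *\<^sub>v 0\<^sub>v m = (0\<^sub>v n :: complex vec)"
  by auto

text \<open>Schur's lemma for two representations, in a form that avoids comparing dimensions: the kernel of
\<open>T\<close> is zero and its image is everything, so \<open>T\<close> has a two-sided inverse \<open>S\<close>, and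
\<open>\<sigma> g = S (\<rho> g) T\<close> has the trace of \<open>\<rho> g\<close>.\<close>
lemma schur_intertwiner_imp_same_trace:
  assumes \<rho>: "matrix_rep G n \<rho>" and irr\<rho>: "\<And>W. invariant_subspace G n \<rho> W \<Longrightarrow> W = {0\<^sub>v n} \<or> W = carrier_vec n"
    and \<sigma>: "matrix_rep G m \<sigma>" and irr\<sigma>: "\<And>W. invariant_subspace G m \<sigma> W \<Longrightarrow> W = {0\<^sub>v m} \<or> W = carrier_vec m"
    and T: "T \<in> carrier_mat n m" "\<And>h. h \<in> carrier G \<Longrightarrow> \<rho> h * T = T * \<sigma> h" "T \<noteq> 0\<^sub>m n m"
    and g: "g \<in> carrier G"
  shows "mat_trace (\<rho> g) = mat_trace (\<sigma> g)"
proof -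
  note \<rho>c = matrix_repD(1)[OF \<rho>] and \<sigma>c = matrix_repD(1)[OF \<sigma>]
  have step: "\<rho> h *\<^sub>v (T *\<^sub>v v) = T *\<^sub>v (\<sigma> h *\<^sub>v v)" if "h \<in> carrier G" "v \<in> carrier_vec m" for h v
    using T(1) T(2)[OF that(1)] \<rho>c[OF that(1)] \<sigma>c[OF that(1)] that(2)
    by (metis assoc_mult_mat_vec)
  define K where "K = {v \<in> carrier_vec m. T *\<^sub>v v = 0\<^sub>v n}"
  have "invariant_subspace G m \<sigma> K"
    unfolding invariant_subspace_def K_def
  proof (intro conjI ballI allI)
    show "0\<^sub>v m \<in> {v \<in> carrier_vec m. T *\<^sub>v v = 0\<^sub>v n}" using T(1) by auto
  next
    fix v w assume "v \<in> {v \<in> carrier_vec m. T *\<^sub>v v = 0\<^sub>v n}" "w \<in> {v \<in> carrier_vec m. T *\<^sub>v v = 0\<^sub>v n}"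
    then show "v + w \<in> {v \<in> carrier_vec m. T *\<^sub>v v = 0\<^sub>v n}"
      using T(1) by (auto simp: mult_add_distrib_mat_vec)
  next
    fix c v assume "v \<in> {v \<in> carrier_vec m. T *\<^sub>v v = 0\<^sub>v n}"
    then show "c \<cdot>\<^sub>v v \<in> {v \<in> carrier_vec m. T *\<^sub>v v = 0\<^sub>v n}"
      using T(1) by (auto simp: mult_mat_vec)
  next
    fix h v assume h: "h \<in> carrier G" and "v \<in> {v \<in> carrier_vec m. T *\<^sub>v v = 0\<^sub>v n}"
    then have v: "v \<in> carrier_vec m" "T *\<^sub>v v = 0\<^sub>v n" by auto
    have "T *\<^sub>v (\<sigma> h *\<^sub>v v) = 0\<^sub>v n" using step[OF h v(1)] v(2) \<rho>c[OF h] by (simp add: mult_mat_vec_zero_vec[OF \<rho>c[OF h]])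
    then show "\<sigma> h *\<^sub>v v \<in> {v \<in> carrier_vec m. T *\<^sub>v v = 0\<^sub>v n}" using \<sigma>c[OF h] v(1) by auto
  qed auto
  moreover have "K \<noteq> carrier_vec m"
    using mult_mat_vec_zero_imp_zero[OF T(1)] T(3) by (auto simp: K_def)
  ultimately have K: "K = {0\<^sub>v m}" using irr\<sigma> by blast
  define I where "I = (\<lambda>v. T *\<^sub>v v) ` carrier_vec m"
  have "invariant_subspace G n \<rho> I"
    unfolding invariant_subspace_def
  proof (intro conjI ballI allI)
    show "I \<subseteq> carrier_vec n" using T(1) by (auto simp: I_def)
    show "0\<^sub>v n \<in> I" unfolding I_def using T(1) by (intro image_eqI[of _ _ "0\<^sub>v m"]) auto
  next
    fix v w assume "v \<in> I" "w \<in> I"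
    then obtain v' w' where "v' \<in> carrier_vec m" "w' \<in> carrier_vec m" "v = T *\<^sub>v v'" "w = T *\<^sub>v w'"
      by (auto simp: I_def)
    then show "v + w \<in> I"
      unfolding I_def using T(1) by (intro image_eqI[of _ _ "v' + w'"]) (auto simp: mult_add_distrib_mat_vec)
  next
    fix c v assume "v \<in> I"
    then obtain v' where "v' \<in> carrier_vec m" "v = T *\<^sub>v v'" by (auto simp: I_def)
    then show "c \<cdot>\<^sub>v v \<in> I"
      unfolding I_def using T(1) by (intro image_eqI[of _ _ "c \<cdot>\<^sub>v v'"]) (auto simp: mult_mat_vec)
  next
    fix h v assume h: "h \<in> carrier G" and "v \<in> I"
    then obtain v' where "v' \<in> carrier_vec m" "v = T *\<^sub>v v'" by (auto simp: I_def)
    then show "\<rho> h *\<^sub>v v \<in> I"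
      unfolding I_def using step[OF h] \<sigma>c[OF h] by (intro image_eqI[of _ _ "\<sigma> h *\<^sub>v v'"]) auto
  qed
  moreover have "I \<noteq> {0\<^sub>v n}"
    using mult_mat_vec_zero_imp_zero[OF T(1)] T(3) by (auto simp: I_def)
  ultimately have I: "I = carrier_vec n" using irr\<rho> by blast
  have "\<forall>i. \<exists>v. v \<in> carrier_vec m \<and> T *\<^sub>v v = unit_vec n i"
    using I unfolding I_def by (metis imageE unit_vec_carrier)
  then obtain u where u: "\<And>i. u i \<in> carrier_vec m" "\<And>i. T *\<^sub>v u i = unit_vec n i" by metis
  define S where "S = mat m n (\<lambda>(i, j). u j $ i)"
  have S: "S \<in> carrier_mat m n" by (simp add: S_def)
  have col_S: "col S j = u j" if "j < n" for j
    using that u(1)[of j] by (intro eq_vecI) (auto simp: S_def)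
  have TS: "T * S = 1\<^sub>m n"
  proof (rule eq_matI)
    fix i j assume "i < dim_row (1\<^sub>m n :: complex mat)" "j < dim_col (1\<^sub>m n :: complex mat)"
    then have ij: "i < n" "j < n" by auto
    have "(T * S) $$ (i, j) = (T *\<^sub>v col S j) $ i" using T(1) S ij by simp
    also have "\<dots> = 1\<^sub>m n $$ (i, j)" using ij by (simp add: col_S u(2))
    finally show "(T * S) $$ (i, j) = 1\<^sub>m n $$ (i, j)" .
  qed (use T(1) S in auto)
  have ST: "S * T = 1\<^sub>m m"
  proof (rule eq_matI)
    fix i j assume "i < dim_row (1\<^sub>m m :: complex mat)" "j < dim_col (1\<^sub>m m :: complex mat)"
    then have ij: "i < m" "j < m" by auto
    let ?w = "(S * T) *\<^sub>v unit_vec m j - unit_vec m j"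
    have "T *\<^sub>v ?w = T *\<^sub>v ((S * T) *\<^sub>v unit_vec m j) - T *\<^sub>v unit_vec m j"
      using T(1) S by (intro mult_minus_distrib_mat_vec) auto
    also have "T *\<^sub>v ((S * T) *\<^sub>v unit_vec m j) = (T * S) *\<^sub>v (T *\<^sub>v unit_vec m j)"
      using T(1) S by (simp add: assoc_mult_mat_vec[of _ n m _ n] assoc_mult_mat_vec[of _ m n _ m])
    finally have "T *\<^sub>v ?w = 0\<^sub>v n" using T(1) by (simp add: TS)
    moreover have "?w \<in> carrier_vec m" using S T(1) by auto
    ultimately have "?w = 0\<^sub>v m" using K by (auto simp: K_def)
    then have "((S * T) *\<^sub>v unit_vec m j) $ i - unit_vec m j $ i = 0"
      using ij S T(1) by (metis index_minus_vec(1) index_zero_vec(1) unit_vec_carrier carrier_vecD)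
    moreover have "((S * T) *\<^sub>v unit_vec m j) $ i = (S * T) $$ (i, j)"
      using ij S T(1) by (simp add: mult_mat_vec_def)
    ultimately show "(S * T) $$ (i, j) = 1\<^sub>m m $$ (i, j)" using ij by simp
  qed (use T(1) S in auto)
  have "\<sigma> g = (S * T) * \<sigma> g" using left_mult_one_mat[OF \<sigma>c[OF g]] by (simp only: ST)
  also have "\<dots> = S * (T * \<sigma> g)" by (rule assoc_mult_mat[OF S T(1) \<sigma>c[OF g]])
  also have "\<dots> = S * (\<rho> g * T)" using T(2)[OF g] by simp
  finally have "mat_trace (\<sigma> g) = mat_trace ((\<rho> g * T) * S)"
    using S T(1) \<rho>c[OF g] mat_trace_mult_comm[of S m n "\<rho> g * T"] by simp
  also have "(\<rho> g * T) * S = \<rho> g * (T * S)" by (rule assoc_mult_mat[OF \<rho>c[OF g] T(1) S])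
  also have "\<dots> = \<rho> g" unfolding TS by (rule right_mult_one_mat[OF \<rho>c[OF g]])
  finally show ?thesis by simp
qed

text \<open>An eigenspace of \<open>T\<close> is a nonzero invariant subspace.\<close>
lemma schur_scalar:
  assumes \<rho>: "matrix_rep G n \<rho>" and n: "n > 0"
    and irr: "\<And>W. invariant_subspace G n \<rho> W \<Longrightarrow> W = {0\<^sub>v n} \<or> W = carrier_vec n"
    and T: "T \<in> carrier_mat n n" "\<And>h. h \<in> carrier G \<Longrightarrow> \<rho> h * T = T * \<rho> h"
  obtains c where "T = c \<cdot>\<^sub>m 1\<^sub>m n"
proof -
  note \<rho>c = matrix_repD(1)[OF \<rho>]
  obtain c where "eigenvalue T c" using spectrum_non_empty[OF T(1) n] by (auto simp: spectrum_def)
  then obtain v where v: "v \<in> carrier_vec n" "v \<noteq> 0\<^sub>v n" "T *\<^sub>v v = c \<cdot>\<^sub>v v"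
    using T(1) by (auto simp: eigenvalue_def eigenvector_def)
  define W where "W = {v \<in> carrier_vec n. T *\<^sub>v v = c \<cdot>\<^sub>v v}"
  have "invariant_subspace G n \<rho> W"
    unfolding invariant_subspace_def
  proof (intro conjI ballI allI)
    show "0\<^sub>v n \<in> W" using T(1) by (auto simp: W_def)
  next
    fix v w assume "v \<in> W" "w \<in> W"
    then show "v + w \<in> W"
      using T(1) by (auto simp: W_def mult_add_distrib_mat_vec smult_add_distrib_vec)
  next
    fix d v assume "v \<in> W"
    then show "d \<cdot>\<^sub>v v \<in> W"
      using T(1) by (auto simp: W_def mult_mat_vec smult_smult_assoc mult.commute)
  next
    fix h v assume h: "h \<in> carrier G" and "v \<in> W"
    then have v: "v \<in> carrier_vec n" "T *\<^sub>v v = c \<cdot>\<^sub>v v" by (auto simp: W_def)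
    have "T *\<^sub>v (\<rho> h *\<^sub>v v) = \<rho> h *\<^sub>v (T *\<^sub>v v)"
      using T(1) T(2)[OF h] \<rho>c[OF h] v(1) by (metis assoc_mult_mat_vec)
    also have "\<dots> = c \<cdot>\<^sub>v (\<rho> h *\<^sub>v v)" using v \<rho>c[OF h] by (simp add: mult_mat_vec)
    finally show "\<rho> h *\<^sub>v v \<in> W" using \<rho>c[OF h] v(1) by (auto simp: W_def)
  qed (auto simp: W_def)
  moreover have "W \<noteq> {0\<^sub>v n}" using v by (auto simp: W_def)
  ultimately have W: "W = carrier_vec n" using irr by blast
  have "T = c \<cdot>\<^sub>m 1\<^sub>m n"
  proof (rule eq_matI)
    fix i j assume "i < dim_row (c \<cdot>\<^sub>m 1\<^sub>m n)" "j < dim_col (c \<cdot>\<^sub>m 1\<^sub>m n)"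
    then have ij: "i < n" "j < n" by auto
    have "unit_vec n j \<in> W" using W by simp
    then have "T *\<^sub>v unit_vec n j = c \<cdot>\<^sub>v unit_vec n j" by (simp add: W_def)
    then have "(T *\<^sub>v unit_vec n j) $ i = c * unit_vec n j $ i" using ij by simp
    moreover have "(T *\<^sub>v unit_vec n j) $ i = T $$ (i, j)" using ij T(1) by (simp add: mult_mat_vec_def)
    ultimately show "T $$ (i, j) = (c \<cdot>\<^sub>m 1\<^sub>m n) $$ (i, j)" using ij by simp
  qed (use T(1) in auto)
  then show thesis by (rule that)
qed

lemma bilinear_sum_times_sum:
  fixes s t :: "nat \<Rightarrow> nat \<Rightarrow> complex"
  shows "(\<Sum>a\<in>A. \<Sum>b\<in>B. s a b * t b a) * (\<Sum>i\<in>I. r i) = (\<Sum>a\<in>A. \<Sum>b\<in>B. \<Sum>i\<in>I. s a b * (r i * t b a))"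
  unfolding sum_distrib_right unfolding sum_distrib_left by (intro sum.cong refl) (simp add: mult_ac)

lemma sum_swap_triple:
  "(\<Sum>h\<in>H. \<Sum>a\<in>A. \<Sum>b\<in>B. \<Sum>i\<in>I. f h a b i) = (\<Sum>a\<in>A. \<Sum>b\<in>B. \<Sum>i\<in>I. \<Sum>h\<in>H. f h a b i)"
  by (subst sum.swap, rule sum.cong[OF refl], subst sum.swap, rule sum.cong[OF refl], rule sum.swap)

context finite_group
begin

lemma sum_left_translate:
  "h \<in> carrier G \<Longrightarrow> (\<Sum>g\<in>carrier G. f (h \<otimes> g)) = (\<Sum>g\<in>carrier G. f g)"
  by (rule sum.reindex_bij_witness[where i = "\<lambda>g. inv h \<otimes> g" and j = "\<lambda>g. h \<otimes> g"])
    (simp_all add: word_simps)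

lemma sum_inverse:
  "(\<Sum>g\<in>carrier G. f (inv g)) = (\<Sum>g\<in>carrier G. f g)"
  by (rule sum.reindex_bij_witness[where i = "\<lambda>g. inv g" and j = "\<lambda>g. inv g"]) simp_all

definition average :: "nat \<Rightarrow> nat \<Rightarrow> ('a \<Rightarrow> complex mat) \<Rightarrow> ('a \<Rightarrow> complex mat) \<Rightarrow> complex mat \<Rightarrow> complex mat" where
  "average n m \<rho> \<sigma> X = mat_family_sum n m (carrier G) (\<lambda>g. \<rho> g * X * \<sigma> (inv g))"

lemma average_carrier [simp]: "average n m \<rho> \<sigma> X \<in> carrier_mat n m"
  by (simp add: average_def)

lemma average_intertwines:
  assumes \<rho>: "matrix_rep G n \<rho>" and \<sigma>: "matrix_rep G m \<sigma>" and X: "X \<in> carrier_mat n m"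
    and h: "h \<in> carrier G"
  shows "\<rho> h * average n m \<rho> \<sigma> X = average n m \<rho> \<sigma> X * \<sigma> h"
proof -
  note \<rho>c = matrix_repD(1)[OF \<rho>] and \<sigma>c = matrix_repD(1)[OF \<sigma>]
  define F where "F g = \<rho> g * X * \<sigma> (inv g)" for g
  have F: "F g \<in> carrier_mat n m" if "g \<in> carrier G" for g
    unfolding F_def using \<rho>c[OF that] \<sigma>c[of "inv g"] X that by simp
  have shift: "\<rho> h * F g = F (h \<otimes> g) * \<sigma> h" if g: "g \<in> carrier G" for g
  proof -
    have c: "\<rho> h \<in> carrier_mat n n" "\<rho> g \<in> carrier_mat n n" "\<sigma> (inv g) \<in> carrier_mat m m"
      "\<sigma> (inv (h \<otimes> g)) \<in> carrier_mat m m" "\<sigma> h \<in> carrier_mat m m"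
      using \<rho>c \<sigma>c g h by simp_all
    have "inv g = inv (h \<otimes> g) \<otimes> h" using g h by (simp add: word_simps)
    then have "\<sigma> (inv g) = \<sigma> (inv (h \<otimes> g)) * \<sigma> h"
      using matrix_repD(3)[OF \<sigma>, of "inv (h \<otimes> g)" h] g h by simp
    then have "\<rho> h * F g = \<rho> h * (\<rho> g * X * (\<sigma> (inv (h \<otimes> g)) * \<sigma> h))" by (simp add: F_def)
    also have "\<dots> = \<rho> h * (\<rho> g * X * \<sigma> (inv (h \<otimes> g))) * \<sigma> h"
      using c X by (simp add: assoc_mult_mat[of _ n n _ m _ m] assoc_mult_mat[of _ n m _ m _ m])
    also have "\<rho> h * (\<rho> g * X * \<sigma> (inv (h \<otimes> g))) = \<rho> h * \<rho> g * X * \<sigma> (inv (h \<otimes> g))"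
      using c X by (simp add: assoc_mult_mat[of _ n n _ m _ m] assoc_mult_mat[of _ n n _ n _ m])
    also have "\<dots> = F (h \<otimes> g)" using matrix_repD(3)[OF \<rho> h g] by (simp add: F_def)
    finally show ?thesis .
  qed
  have "\<rho> h * average n m \<rho> \<sigma> X = mat_family_sum n m (carrier G) (\<lambda>g. \<rho> h * F g)"
    unfolding average_def F_def[symmetric] by (rule mult_mat_family_sum[OF \<rho>c[OF h] F])
  also have "\<dots> = mat_family_sum n m (carrier G) (\<lambda>g. F g * \<sigma> h)"
    unfolding mat_family_sum_def
    using sum_left_translate[OF h, of "\<lambda>g. (F g * \<sigma> h) $$ (_, _)"] shift
    by (intro cong_mat) (auto simp del: index_mult_mat intro!: trans[OF _ sum_left_translate[OF h]] sum.cong)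
  also have "\<dots> = average n m \<rho> \<sigma> X * \<sigma> h"
    unfolding average_def F_def[symmetric] by (rule mat_family_sum_mult[OF F \<sigma>c[OF h], symmetric])
  finally show ?thesis .
qed

definition elementary_mat :: "nat \<Rightarrow> nat \<Rightarrow> nat \<Rightarrow> nat \<Rightarrow> complex mat" where
  "elementary_mat n m j k = mat n m (\<lambda>(a, b). if a = j \<and> b = k then 1 else 0)"

lemma average_elementary_entry:
  assumes \<rho>: "matrix_rep G n \<rho>" and \<sigma>: "matrix_rep G m \<sigma>"
    and i: "i < n" and j: "j < n" and k: "k < m" and l: "l < m"
  shows "average n m \<rho> \<sigma> (elementary_mat n m j k) $$ (i, l) =
    (\<Sum>g\<in>carrier G. \<rho> g $$ (i, j) * \<sigma> (inv g) $$ (k, l))"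
proof -
  let ?X = "elementary_mat n m j k"
  have X: "?X \<in> carrier_mat n m" by (simp add: elementary_mat_def)
  have "(\<rho> g * ?X * \<sigma> (inv g)) $$ (i, l) = \<rho> g $$ (i, j) * \<sigma> (inv g) $$ (k, l)"
    if g: "g \<in> carrier G" for g
  proof -
    have c: "\<rho> g \<in> carrier_mat n n" "\<sigma> (inv g) \<in> carrier_mat m m"
      using matrix_repD(1)[OF \<rho> g] matrix_repD(1)[OF \<sigma>, of "inv g"] g by simp_all
    have row: "(\<rho> g * ?X) $$ (i, b) = (if b = k then \<rho> g $$ (i, j) else 0)" if "b < m" for b
    proof -
      have "(\<rho> g * ?X) $$ (i, b) = (\<Sum>a<n. if a = j then (if b = k then \<rho> g $$ (i, j) else 0) else 0)"
        unfolding mult_mat_entry[OF c(1) X i that]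
        using that by (intro sum.cong) (auto simp: elementary_mat_def)
      then show ?thesis using j by simp
    qed
    have "(\<rho> g * ?X * \<sigma> (inv g)) $$ (i, l) =
        (\<Sum>b<m. (\<rho> g * ?X) $$ (i, b) * \<sigma> (inv g) $$ (b, l))"
      by (rule mult_mat_entry[OF _ c(2) i l]) (use c X in simp)
    also have "\<dots> = (\<Sum>b<m. if b = k then \<rho> g $$ (i, j) * \<sigma> (inv g) $$ (k, l) else 0)"
      by (rule sum.cong) (auto simp: row simp del: index_mult_mat)
    finally show ?thesis using k by simp
  qed
  then show ?thesis
    unfolding average_def mat_family_sum_entry[OF i l] by (intro sum.cong) auto
qed

text \<open>The sum is an entry of the intertwiner that arises by averaging an elementary matrix; by Schur's
lemma it vanishes.\<close>
lemma schur_relations_distinct: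
  assumes irr: "irreducible_rep G n \<rho>" "irreducible_rep G m \<sigma>"
    and ne: "rep_character G \<rho> \<noteq> rep_character G \<sigma>"
    and ijkl: "i < n" "j < n" "k < m" "l < m"
  shows "(\<Sum>g\<in>carrier G. \<rho> g $$ (i, j) * \<sigma> (inv g) $$ (k, l)) = 0"
proof -
  have \<rho>: "matrix_rep G n \<rho>" "\<And>W. invariant_subspace G n \<rho> W \<Longrightarrow> W = {0\<^sub>v n} \<or> W = carrier_vec n"
    and \<sigma>: "matrix_rep G m \<sigma>" "\<And>W. invariant_subspace G m \<sigma> W \<Longrightarrow> W = {0\<^sub>v m} \<or> W = carrier_vec m"
    using irr by (auto simp: irreducible_rep_iff)
  let ?X = "elementary_mat n m j k"
  have X: "?X \<in> carrier_mat n m" by (simp add: elementary_mat_def)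
  have "average n m \<rho> \<sigma> ?X = 0\<^sub>m n m"
  proof (rule ccontr)
    assume "average n m \<rho> \<sigma> ?X \<noteq> 0\<^sub>m n m"
    then have "mat_trace (\<rho> g) = mat_trace (\<sigma> g)" if "g \<in> carrier G" for g
      using schur_intertwiner_imp_same_trace[OF \<rho> \<sigma> average_carrier average_intertwines[OF \<rho>(1) \<sigma>(1) X] _ that]
      by blast
    then show False using ne by (auto simp: rep_character_def intro!: restrict_ext)
  qed
  then show ?thesis
    using average_elementary_entry[OF \<rho>(1) \<sigma>(1) ijkl] ijkl by simp
qed

lemma mat_trace_smult_one: "mat_trace (c \<cdot>\<^sub>m 1\<^sub>m n) = c * of_nat n"
  by (simp add: mat_trace_eq_sum[of _ n])

text \<open>Here the averaged elementary matrix is a scalar matrix, and its trace determines the scalar.\<close>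
lemma schur_relations_same:
  assumes irr: "irreducible_rep G n \<rho>" and ijkl: "i < n" "j < n" "k < n" "l < n"
  shows "(\<Sum>g\<in>carrier G. \<rho> g $$ (i, j) * \<rho> (inv g) $$ (k, l)) =
    (if i = l \<and> j = k then of_nat (card (carrier G)) / of_nat n else 0)"
proof -
  have \<rho>: "matrix_rep G n \<rho>" "n > 0" "\<And>W. invariant_subspace G n \<rho> W \<Longrightarrow> W = {0\<^sub>v n} \<or> W = carrier_vec n"
    using irr by (auto simp: irreducible_rep_iff)
  let ?X = "elementary_mat n n j k"
  have X: "?X \<in> carrier_mat n n" by (simp add: elementary_mat_def)
  obtain c where c: "average n n \<rho> \<rho> ?X = c \<cdot>\<^sub>m 1\<^sub>m n"
    using schur_scalar[OF \<rho> average_carrier average_intertwines[OF \<rho>(1) \<rho>(1) X]] .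
  have "c * of_nat n = (\<Sum>a<n. \<Sum>g\<in>carrier G. \<rho> g $$ (a, j) * \<rho> (inv g) $$ (k, a))"
    unfolding mat_trace_smult_one[symmetric] c[symmetric] mat_trace_eq_sum[OF average_carrier]
    by (intro sum.cong refl average_elementary_entry[OF \<rho>(1) \<rho>(1)]) (use ijkl in auto)
  also have "\<dots> = (\<Sum>g\<in>carrier G. \<Sum>a<n. \<rho> (inv g) $$ (k, a) * \<rho> g $$ (a, j))"
    by (subst sum.swap) (simp add: mult.commute)
  also have "\<dots> = (\<Sum>g\<in>carrier G. if j = k then 1 else 0)"
  proof (rule sum.cong)
    fix g assume g: "g \<in> carrier G"
    have "(\<Sum>a<n. \<rho> (inv g) $$ (k, a) * \<rho> g $$ (a, j)) = (\<rho> (inv g) * \<rho> g) $$ (k, j)"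
      using matrix_repD(1)[OF \<rho>(1)] g ijkl by (intro mult_mat_entry[symmetric]) auto
    also have "\<rho> (inv g) * \<rho> g = 1\<^sub>m n"
      using matrix_repD(2,3)[OF \<rho>(1)] g by (metis inv_closed l_inv)
    finally show "(\<Sum>a<n. \<rho> (inv g) $$ (k, a) * \<rho> g $$ (a, j)) = (if j = k then 1 else 0)"
      using ijkl by auto
  qed simp
  finally have "c = (if j = k then of_nat (card (carrier G)) / of_nat n else 0)"
    using \<rho>(2) by (auto simp: field_simps)
  then show ?thesis
    using average_elementary_entry[OF \<rho>(1) \<rho>(1) ijkl] c ijkl by auto
qed

lemma IrrE:
  assumes "\<chi> \<in> Irr G"
  obtains n \<rho> where "irreducible_rep G n \<rho>" "matrix_rep G n \<rho>" "n > 0" "\<chi> = rep_character G \<rho>"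
    "\<chi> \<one> = of_nat n" "\<And>g. g \<in> carrier G \<Longrightarrow> \<chi> g = (\<Sum>i<n. \<rho> g $$ (i, i))"
    "\<And>g. g \<in> carrier G \<Longrightarrow> \<chi> g = mat_trace (\<rho> g)"
proof -
  obtain n \<rho> where irr: "irreducible_rep G n \<rho>" and \<chi>: "\<chi> = rep_character G \<rho>"
    using assms by (auto simp: Irr_def)
  then have \<rho>: "matrix_rep G n \<rho>" "n > 0" by (auto simp: irreducible_rep_iff)
  show thesis
    by (rule that[OF irr \<rho> \<chi>])
      (simp_all add: \<chi> rep_character_def matrix_repD(2)[OF \<rho>(1)] mat_trace_one
        mat_trace_eq_sum[OF matrix_repD(1)[OF \<rho>(1)]])
qed

lemma character_mult_expand:
  assumes \<rho>: "matrix_rep G n \<rho>" and gh: "g \<in> carrier G" "h \<in> carrier G"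
  shows "mat_trace (\<rho> (g \<otimes> h)) = (\<Sum>a<n. \<Sum>b<n. \<rho> g $$ (a, b) * \<rho> h $$ (b, a))"
proof -
  note c = matrix_repD(1)[OF \<rho> gh(1)] matrix_repD(1)[OF \<rho> gh(2)]
  show ?thesis
    unfolding matrix_repD(3)[OF \<rho> gh] mat_trace_eq_sum[OF mult_carrier_mat[OF c]]
    by (intro sum.cong refl mult_mat_entry[OF c]) auto
qed

text \<open>Both factors are expanded into entries of representing matrices, to which the Schur relations apply.\<close>
theorem Irr_convolution_distinct:
  assumes "\<chi> \<in> Irr G" "\<psi> \<in> Irr G" "\<chi> \<noteq> \<psi>" and g: "g \<in> carrier G"
  shows "(\<Sum>h\<in>carrier G. \<psi> (g \<otimes> inv h) * \<chi> h) = 0"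
proof -
  obtain n \<rho> where \<rho>: "irreducible_rep G n \<rho>" "\<chi> = rep_character G \<rho>"
    "\<And>g. g \<in> carrier G \<Longrightarrow> \<chi> g = (\<Sum>i<n. \<rho> g $$ (i, i))"
    by (rule IrrE[OF assms(1)]) (rule that)
  obtain m \<sigma> where \<sigma>: "irreducible_rep G m \<sigma>" "matrix_rep G m \<sigma>" "\<psi> = rep_character G \<sigma>"
    "\<And>g. g \<in> carrier G \<Longrightarrow> \<psi> g = mat_trace (\<sigma> g)"
    by (rule IrrE[OF assms(2)]) (rule that)
  have "(\<Sum>h\<in>carrier G. \<psi> (g \<otimes> inv h) * \<chi> h) =
      (\<Sum>h\<in>carrier G. \<Sum>a<m. \<Sum>b<m. \<Sum>i<n. \<sigma> g $$ (a, b) * (\<rho> h $$ (i, i) * \<sigma> (inv h) $$ (b, a)))"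
  proof (rule sum.cong[OF refl])
    fix h assume h: "h \<in> carrier G"
    show "\<psi> (g \<otimes> inv h) * \<chi> h = (\<Sum>a<m. \<Sum>b<m. \<Sum>i<n. \<sigma> g $$ (a, b) * (\<rho> h $$ (i, i) * \<sigma> (inv h) $$ (b, a)))"
      unfolding \<sigma>(4)[OF m_closed[OF g inv_closed[OF h]]] \<rho>(3)[OF h]
        character_mult_expand[OF \<sigma>(2) g inv_closed[OF h]] by (rule bilinear_sum_times_sum)
  qed
  also have "\<dots> = (\<Sum>a<m. \<Sum>b<m. \<Sum>i<n. \<sigma> g $$ (a, b) *
      (\<Sum>h\<in>carrier G. \<rho> h $$ (i, i) * \<sigma> (inv h) $$ (b, a)))"
    unfolding sum_distrib_left by (rule sum_swap_triple)
  also have "\<dots> = 0"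
    using schur_relations_distinct[OF \<rho>(1) \<sigma>(1)] \<rho>(2) \<sigma>(3) assms(3) by simp
  finally show ?thesis .
qed

theorem Irr_convolution_same:
  assumes "\<chi> \<in> Irr G" and g: "g \<in> carrier G"
  shows "(\<Sum>h\<in>carrier G. \<chi> (g \<otimes> inv h) * \<chi> h) = of_nat (card (carrier G)) / \<chi> \<one> * \<chi> g"
proof -
  obtain n \<rho> where \<rho>: "irreducible_rep G n \<rho>" "matrix_rep G n \<rho>" "n > 0" "\<chi> \<one> = of_nat n"
    "\<And>g. g \<in> carrier G \<Longrightarrow> \<chi> g = (\<Sum>i<n. \<rho> g $$ (i, i))"
    "\<And>g. g \<in> carrier G \<Longrightarrow> \<chi> g = mat_trace (\<rho> g)"
    by (rule IrrE[OF assms(1)]) (rule that)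
  let ?c = "of_nat (card (carrier G)) / of_nat n :: complex"
  have "(\<Sum>h\<in>carrier G. \<chi> (g \<otimes> inv h) * \<chi> h) =
      (\<Sum>h\<in>carrier G. \<Sum>a<n. \<Sum>b<n. \<Sum>i<n. \<rho> g $$ (a, b) * (\<rho> h $$ (i, i) * \<rho> (inv h) $$ (b, a)))"
  proof (rule sum.cong[OF refl])
    fix h assume h: "h \<in> carrier G"
    show "\<chi> (g \<otimes> inv h) * \<chi> h = (\<Sum>a<n. \<Sum>b<n. \<Sum>i<n. \<rho> g $$ (a, b) * (\<rho> h $$ (i, i) * \<rho> (inv h) $$ (b, a)))"
      unfolding \<rho>(6)[OF m_closed[OF g inv_closed[OF h]]] \<rho>(5)[OF h]
        character_mult_expand[OF \<rho>(2) g inv_closed[OF h]] by (rule bilinear_sum_times_sum)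
  qed
  also have "\<dots> = (\<Sum>a<n. \<Sum>b<n. \<Sum>i<n. \<rho> g $$ (a, b) *
      (\<Sum>h\<in>carrier G. \<rho> h $$ (i, i) * \<rho> (inv h) $$ (b, a)))"
    unfolding sum_distrib_left by (rule sum_swap_triple)
  also have "\<dots> = (\<Sum>a<n. \<Sum>b<n. \<Sum>i<n. if i = b then (if b = a then \<rho> g $$ (a, a) * ?c else 0) else 0)"
    by (intro sum.cong refl) (auto simp: schur_relations_same[OF \<rho>(1)])
  also have "\<dots> = ?c * \<chi> g"
    by (simp add: \<rho>(5)[OF g] sum_distrib_left mult.commute)
  finally show ?thesis using \<rho>(4) by simp
qed

lemma Irr_conj:
  assumes "\<chi> \<in> Irr G" "g \<in> carrier G" "z \<in> carrier G"
  shows "\<chi> (z \<otimes> g \<otimes> inv z) = \<chi> g"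
proof -
  obtain n \<rho> where \<rho>: "matrix_rep G n \<rho>" "\<And>g. g \<in> carrier G \<Longrightarrow> \<chi> g = mat_trace (\<rho> g)"
    by (rule IrrE[OF assms(1)]) (rule that)
  have "mat_trace (\<rho> (z \<otimes> (g \<otimes> inv z))) = mat_trace (\<rho> ((g \<otimes> inv z) \<otimes> z))"
    using mat_trace_mult_comm[OF matrix_repD(1)[OF \<rho>(1) assms(3)] matrix_repD(1)[OF \<rho>(1), of "g \<otimes> inv z"]] assms(2,3)
    by (simp only: matrix_repD(3)[OF \<rho>(1)] m_closed inv_closed)
  then show ?thesis using assms(2,3) by (simp add: \<rho>(2) m_assoc)
qed

text \<open>Averaging the conjugates of \<open>\<rho> h\<close> gives a scalar matrix with the trace of \<open>\<rho> h\<close> times the order of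
the group; multiplication by \<open>\<rho> g\<close> and another trace give the formula.\<close>
theorem Irr_class_mult:
  assumes "\<chi> \<in> Irr G" and gh: "g \<in> carrier G" "h \<in> carrier G"
  shows "of_nat (card (carrier G)) * (\<chi> g * \<chi> h) =
    \<chi> \<one> * (\<Sum>z\<in>carrier G. \<chi> (g \<otimes> (z \<otimes> h \<otimes> inv z)))"
proof -
  obtain n \<rho> where irr: "irreducible_rep G n \<rho>" and \<rho>: "matrix_rep G n \<rho>" "n > 0" and deg: "\<chi> \<one> = of_nat n"
    and \<chi>: "\<And>g. g \<in> carrier G \<Longrightarrow> \<chi> g = mat_trace (\<rho> g)"
    by (rule IrrE[OF assms(1)]) (rule that)
  have \<rho>': "\<And>W. invariant_subspace G n \<rho> W \<Longrightarrow> W = {0\<^sub>v n} \<or> W = carrier_vec n"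
    using irr by (auto simp: irreducible_rep_iff)
  note c = matrix_repD(1)[OF \<rho>(1)]
  let ?F = "\<lambda>z. \<rho> z * \<rho> h * \<rho> (inv z)"
  have F: "?F z = \<rho> (z \<otimes> h \<otimes> inv z)" if "z \<in> carrier G" for z
    using that gh by (simp add: matrix_repD(3)[OF \<rho>(1)])
  have Fc: "?F z \<in> carrier_mat n n" if "z \<in> carrier G" for z
    unfolding F[OF that] using that gh by (intro c) simp
  obtain k where k: "average n n \<rho> \<rho> (\<rho> h) = k \<cdot>\<^sub>m 1\<^sub>m n"
    using schur_scalar[OF \<rho> \<rho>' average_carrier average_intertwines[OF \<rho>(1) \<rho>(1) c[OF gh(2)]]] .
  have "k * of_nat n = (\<Sum>z\<in>carrier G. mat_trace (?F z))"
    unfolding mat_trace_smult_one[symmetric] k[symmetric] average_def by (rule mat_trace_family_sum[OF Fc])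
  also have "\<dots> = (\<Sum>z\<in>carrier G. \<chi> h)"
    using gh by (intro sum.cong) (simp_all add: F flip: \<chi> add: Irr_conj[OF assms(1)])
  finally have k': "k * of_nat n = of_nat (card (carrier G)) * \<chi> h" by simp
  have "(\<Sum>z\<in>carrier G. \<chi> (g \<otimes> (z \<otimes> h \<otimes> inv z))) = (\<Sum>z\<in>carrier G. mat_trace (\<rho> g * ?F z))"
    using gh by (intro sum.cong refl) (simp add: \<chi> F matrix_repD(3)[OF \<rho>(1), of g])
  also have "\<dots> = mat_trace (mat_family_sum n n (carrier G) (\<lambda>z. \<rho> g * ?F z))"
    using c[OF gh(1)] Fc by (intro mat_trace_family_sum[symmetric]) auto
  also have "mat_family_sum n n (carrier G) (\<lambda>z. \<rho> g * ?F z) = \<rho> g * average n n \<rho> \<rho> (\<rho> h)"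
    unfolding average_def by (rule mult_mat_family_sum[OF c[OF gh(1)] Fc, symmetric])
  also have "\<dots> = k \<cdot>\<^sub>m \<rho> g" unfolding k using c[OF gh(1)] by (simp add: mult_smult_distrib[of _ n n _ n])
  also have "mat_trace (k \<cdot>\<^sub>m \<rho> g) = k * \<chi> g"
    using c[OF gh(1)] by (simp add: mat_trace_eq_sum[of _ n] \<chi>[OF gh(1)] sum_distrib_left)
  finally show ?thesis using k' deg by (simp add: mult_ac)
qed

end

section \<open>Completeness and column orthogonality\<close>

interpretation function_space: vector_space "\<lambda>(c::complex) (f :: 'b \<Rightarrow> complex) x. c * f x"
  by unfold_locales (auto simp: fun_eq_iff algebra_simps)

lemma sum_of_functions_apply: "(\<Sum>i\<in>A. F i) x = (\<Sum>i\<in>A. F i x)"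
  for F :: "'i \<Rightarrow> 'b \<Rightarrow> complex"
  by (induction A rule: infinite_finite_induct) auto

context finite_group
begin

text \<open>The left regular representation, on the complex functions that vanish outside the carrier.\<close>
definition translate :: "'a \<Rightarrow> ('a \<Rightarrow> complex) \<Rightarrow> 'a \<Rightarrow> complex" where
  "translate g v = (\<lambda>x. if x \<in> carrier G then v (inv g \<otimes> x) else 0)"

definition translation_invariant :: "('a \<Rightarrow> complex) set \<Rightarrow> bool" where
  "translation_invariant U \<longleftrightarrow>
     function_space.subspace U \<and> (\<forall>v\<in>U. \<forall>x. x \<notin> carrier G \<longrightarrow> v x = 0) \<and>
     (\<forall>g\<in>carrier G. \<forall>v\<in>U. translate g v \<in> U)"

lemma translate_one: "(\<And>x. x \<notin> carrier G \<Longrightarrow> v x = 0) \<Longrightarrow> translate \<one> v = v"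
  by (auto simp: translate_def)

lemma translate_mult:
  "\<lbrakk>g \<in> carrier G; h \<in> carrier G\<rbrakk> \<Longrightarrow> translate (g \<otimes> h) v = translate g (translate h v)"
  by (auto simp: translate_def word_simps)

lemma invariant_subspace_in_finite_span:
  assumes "translation_invariant U"
  obtains D :: "('a \<Rightarrow> complex) set" where "finite D" "U \<subseteq> function_space.span D"
proof -
  define \<delta> where "\<delta> g = (\<lambda>x. if x = g then 1 else 0 :: complex)" for g :: 'a
  have "v \<in> function_space.span (\<delta> ` carrier G)" if "v \<in> U" for v
  proof -
    have supp: "v x = 0" if "x \<notin> carrier G" for x
      using assms \<open>v \<in> U\<close> that by (auto simp: translation_invariant_def)
    have "v = (\<Sum>g\<in>carrier G. (\<lambda>x. v g * \<delta> g x))"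
    proof
      fix x
      have "(\<Sum>g\<in>carrier G. v g * \<delta> g x) = (\<Sum>g\<in>carrier G. if x = g then v g else 0)"
        by (rule sum.cong) (auto simp: \<delta>_def)
      also have "\<dots> = v x" using finite_carrier supp[of x] by (auto simp: sum.delta)
      finally show "v x = (\<Sum>g\<in>carrier G. (\<lambda>x. v g * \<delta> g x)) x" by (simp add: sum_of_functions_apply)
    qed
    also have "\<dots> \<in> function_space.span (\<delta> ` carrier G)"
      by (intro function_space.span_sum function_space.span_scale function_space.span_base imageI)
    finally show ?thesis .
  qed
  then show thesis using that[of "\<delta> ` carrier G"] finite_carrier by blast
qed

text \<open>A nonzero invariant subspace of smallest dimension is irreducible; \<open>\<tau>\<close> is the matrix representation
that it affords in the basis \<open>u\<close>. Linear independence of the basis is spelled out with pointwise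
sums, the form in which it is applied.\<close>
theorem irreducible_in_translation_invariant:
  assumes W: "translation_invariant W" and ne: "w \<in> W" "w \<noteq> 0"
  obtains n \<tau> u where "irreducible_rep G n \<tau>" "\<And>j. j < n \<Longrightarrow> u j \<in> W"
    "\<And>g j x. \<lbrakk>g \<in> carrier G; j < n\<rbrakk> \<Longrightarrow> translate g (u j) x = (\<Sum>i<n. \<tau> g $$ (i, j) * u i x)"
    "\<forall>c. (\<forall>x. (\<Sum>i<n. c i * u i x) = 0) \<longrightarrow> (\<forall>i<n. c i = 0)"
proof -
  define P where "P U \<longleftrightarrow> translation_invariant U \<and> U \<subseteq> W \<and> U \<noteq> {0}" for U
  have "P W" using W ne by (auto simp: P_def)
  then obtain U where U: "P U" and min: "\<And>U'. P U' \<Longrightarrow> function_space.dim U \<le> function_space.dim U'"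
    using ex_has_least_nat[of P W function_space.dim] by blast
  have inv: "translation_invariant U" and UW: "U \<subseteq> W" and U0: "U \<noteq> {0}" using U by (auto simp: P_def)
  have sub: "function_space.subspace U" and supp: "\<And>v x. \<lbrakk>v \<in> U; x \<notin> carrier G\<rbrakk> \<Longrightarrow> v x = 0"
    and tr: "\<And>g v. \<lbrakk>g \<in> carrier G; v \<in> U\<rbrakk> \<Longrightarrow> translate g v \<in> U"
    using inv by (auto simp: translation_invariant_def)
  obtain D where D: "finite D" "U \<subseteq> function_space.span D"
    using invariant_subspace_in_finite_span[OF inv] .
  obtain B where B: "B \<subseteq> U" "function_space.independent B" "U \<subseteq> function_space.span B"
    "card B = function_space.dim U"
    using function_space.basis_exists[of U] by blast
  have finB: "finite B" using function_space.independent_span_bound[OF D(1) B(2)] B(1) D(2) by blast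
  define n where "n = card B"
  obtain u where u: "bij_betw u {..<n} B"
    using ex_bij_betw_nat_finite[OF finB] by (auto simp: n_def atLeast0LessThan)
  have uB: "u i \<in> B" if "i < n" for i using u that by (auto simp: bij_betw_def)
  have uU: "u i \<in> U" if "i < n" for i using uB[OF that] B(1) by blast
  \<comment> \<open>the isomorphism from coordinate vectors onto \<open>U\<close>\<close>
  define lc where "lc w = (\<lambda>x. \<Sum>i<n. w $ i * u i x)" for w :: "complex vec"
  have lc_sum: "lc w = (\<Sum>i<n. (\<lambda>x. w $ i * u i x))" for w
    by (rule ext) (simp add: lc_def sum_of_functions_apply)
  have lc_U: "lc w \<in> U" for w
    unfolding lc_sum using uU
    by (intro function_space.subspace_sum[OF sub] function_space.subspace_scale[OF sub]) auto
  have zero: "c i = 0" if "\<And>x. (\<Sum>i<n. c i * u i x) = 0" "i < n" for c i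
  proof -
    let ?c = "\<lambda>b. c (inv_into {..<n} u b)"
    have "(\<Sum>b\<in>B. (\<lambda>x. ?c b * b x)) = (\<Sum>i<n. (\<lambda>x. ?c (u i) * u i x))"
      by (rule sum.reindex_bij_betw[OF u, symmetric])
    also have "\<dots> = (\<Sum>i<n. (\<lambda>x. c i * u i x))"
      using u by (intro sum.cong) (auto simp: bij_betw_def)
    also have "\<dots> = 0" using that(1) by (auto simp: fun_eq_iff sum_of_functions_apply)
    finally have "?c (u i) = 0"
      using function_space.independentD[OF B(2) finB subset_refl, of ?c "u i"] uB[OF that(2)] by blast
    then show "c i = 0" using u that(2) by (auto simp: bij_betw_def)
  qed
  have lc_inj: "w = w'" if "lc w = lc w'" "w \<in> carrier_vec n" "w' \<in> carrier_vec n" for w w'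
  proof (rule eq_vecI)
    fix i assume i: "i < dim_vec w'"
    have "(\<Sum>i<n. (w $ i - w' $ i) * u i x) = 0" for x
      using fun_cong[OF that(1), of x] by (simp add: lc_def algebra_simps sum_subtractf)
    from zero[of "\<lambda>i. w $ i - w' $ i", OF this] show "w $ i = w' $ i" using i that(3) by auto
  qed (use that in auto)
  have lc_ex: "\<exists>w\<in>carrier_vec n. v = lc w" if "v \<in> U" for v
  proof -
    have "v \<in> function_space.span B" using that B(3) by blast
    then obtain c where c: "v = (\<Sum>b\<in>B. (\<lambda>x. c b * b x))"
      using function_space.span_finite[OF finB] by auto
    have "v = (\<Sum>i<n. (\<lambda>x. c (u i) * u i x))"
      unfolding c by (rule sum.reindex_bij_betw[OF u, symmetric])
    also have "\<dots> = lc (vec n (\<lambda>i. c (u i)))" unfolding lc_sum by (rule sum.cong) auto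
    finally show ?thesis by (intro bexI[of _ "vec n (\<lambda>i. c (u i))"]) auto
  qed
  have "\<forall>g j. \<exists>w. g \<in> carrier G \<longrightarrow> j < n \<longrightarrow> w \<in> carrier_vec n \<and> translate g (u j) = lc w"
    using lc_ex tr uU by blast
  then obtain t where t: "\<And>g j. \<lbrakk>g \<in> carrier G; j < n\<rbrakk> \<Longrightarrow> t g j \<in> carrier_vec n \<and> translate g (u j) = lc (t g j)"
    by metis
  define \<tau> where "\<tau> g = mat n n (\<lambda>(i, j). t g j $ i)" for g
  have \<tau>c: "\<tau> g \<in> carrier_mat n n" for g by (simp add: \<tau>_def)
  have trans_u: "translate g (u j) x = (\<Sum>i<n. \<tau> g $$ (i, j) * u i x)" if "g \<in> carrier G" "j < n" for g j x
    using t[OF that] that by (auto simp: lc_def \<tau>_def intro!: sum.cong)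
  have trans_lc: "translate g (lc w) = lc (\<tau> g *\<^sub>v w)" if g: "g \<in> carrier G" and w: "w \<in> carrier_vec n" for g w
  proof
    fix x
    have "translate g (lc w) x = (\<Sum>j<n. w $ j * translate g (u j) x)"
      by (simp add: translate_def lc_def)
    also have "\<dots> = (\<Sum>j<n. \<Sum>i<n. \<tau> g $$ (i, j) * w $ j * u i x)"
      using g by (simp add: trans_u sum_distrib_left mult_ac)
    also have "\<dots> = (\<Sum>i<n. (\<Sum>j<n. \<tau> g $$ (i, j) * w $ j) * u i x)"
      by (subst sum.swap) (simp add: sum_distrib_right)
    also have "\<dots> = lc (\<tau> g *\<^sub>v w) x"
      unfolding lc_def using \<tau>c[of g] w
      by (intro sum.cong refl) (simp add: mult_mat_vec_def scalar_prod_def atLeast0LessThan)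
    finally show "translate g (lc w) x = lc (\<tau> g *\<^sub>v w) x" .
  qed
  have rep: "matrix_rep G n \<tau>"
    unfolding matrix_rep_def
  proof (intro conjI ballI)
    show "\<tau> \<one> = 1\<^sub>m n"
    proof (rule eq_mat_if_mult_vec_eq[where n = n and m = n])
      fix w :: "complex vec" assume w: "w \<in> carrier_vec n"
      have "lc (\<tau> \<one> *\<^sub>v w) = lc w"
        using trans_lc[OF one_closed w] translate_one[OF supp[OF lc_U]] by simp
      then have "\<tau> \<one> *\<^sub>v w = w" using lc_inj w \<tau>c by (metis mult_mat_vec_carrier)
      then show "\<tau> \<one> *\<^sub>v w = 1\<^sub>m n *\<^sub>v w" using w by simp
    qed (use \<tau>c in auto)
  next
    fix g h assume g: "g \<in> carrier G" and h: "h \<in> carrier G"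
    show "\<tau> (g \<otimes> h) = \<tau> g * \<tau> h"
    proof (rule eq_mat_if_mult_vec_eq[where n = n and m = n])
      fix w :: "complex vec" assume w: "w \<in> carrier_vec n"
      have hw: "\<tau> h *\<^sub>v w \<in> carrier_vec n" by (rule mult_mat_vec_carrier[OF \<tau>c w])
      have "lc (\<tau> (g \<otimes> h) *\<^sub>v w) = lc (\<tau> g *\<^sub>v (\<tau> h *\<^sub>v w))"
        using trans_lc[OF m_closed[OF g h] w] trans_lc[OF g hw] trans_lc[OF h w] translate_mult[OF g h]
        by simp
      then have "\<tau> (g \<otimes> h) *\<^sub>v w = \<tau> g *\<^sub>v (\<tau> h *\<^sub>v w)"
        by (rule lc_inj) (rule mult_mat_vec_carrier[OF \<tau>c w], rule mult_mat_vec_carrier[OF \<tau>c hw])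
      then show "\<tau> (g \<otimes> h) *\<^sub>v w = (\<tau> g * \<tau> h) *\<^sub>v w"
        using assoc_mult_mat_vec[OF \<tau>c \<tau>c w] by simp
    qed (use \<tau>c in \<open>auto intro: mult_carrier_mat\<close>)
  qed (rule \<tau>c)
  have "n > 0"
  proof (rule ccontr)
    assume "\<not> n > 0"
    then have "B = {}" using finB by (simp add: n_def)
    then have "U \<subseteq> {0}" using B(3) by simp
    then show False using U0 function_space.subspace_0[OF sub] by blast
  qed
  have irr: "V = {0\<^sub>v n} \<or> V = carrier_vec n" if V: "invariant_subspace G n \<tau> V" for V
  proof (rule disjCI)
    assume Vne: "V \<noteq> carrier_vec n"
    show "V = {0\<^sub>v n}"
    proof (rule ccontr)
      assume V0: "V \<noteq> {0\<^sub>v n}"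
      have V1: "V \<subseteq> carrier_vec n" "0\<^sub>v n \<in> V" "\<And>v w. \<lbrakk>v \<in> V; w \<in> V\<rbrakk> \<Longrightarrow> v + w \<in> V"
        "\<And>c v. v \<in> V \<Longrightarrow> c \<cdot>\<^sub>v v \<in> V" "\<And>g w. \<lbrakk>g \<in> carrier G; w \<in> V\<rbrakk> \<Longrightarrow> \<tau> g *\<^sub>v w \<in> V"
        using V by (auto simp: invariant_subspace_def)
      define U' where "U' = lc ` V"
      have lc0: "lc (0\<^sub>v n) = 0" by (auto simp: lc_def fun_eq_iff)
      have "function_space.subspace U'"
      proof (rule function_space.subspaceI)
        show "0 \<in> U'" unfolding U'_def using V1(2) lc0 by (metis imageI)
      next
        fix v w assume "v \<in> U'" "w \<in> U'"
        then obtain v' w' where vw: "v' \<in> V" "w' \<in> V" "v = lc v'" "w = lc w'" by (auto simp: U'_def)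
        then have "v + w = lc (v' + w')"
          using V1(1) by (auto simp: lc_def fun_eq_iff algebra_simps sum.distrib)
        then show "v + w \<in> U'" using V1(3)[OF vw(1,2)] by (simp add: U'_def)
      next
        fix c v assume "v \<in> U'"
        then obtain v' where v: "v' \<in> V" "v = lc v'" by (auto simp: U'_def)
        then have "(\<lambda>x. c * v x) = lc (c \<cdot>\<^sub>v v')"
          using V1(1) by (auto simp: lc_def fun_eq_iff sum_distrib_left mult.assoc)
        then show "(\<lambda>x. c * v x) \<in> U'" using V1(4)[OF v(1)] by (simp add: U'_def)
      qed
      moreover have "U' \<subseteq> U" using lc_U by (auto simp: U'_def)
      moreover have "translate g v \<in> U'" if "g \<in> carrier G" "v \<in> U'" for g v
        using that trans_lc V1(1,5) by (auto simp: U'_def)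
      ultimately have inv': "translation_invariant U'" and sub': "function_space.subspace U'" and U'U: "U' \<subseteq> U"
        using supp by (auto simp: translation_invariant_def)
      obtain v where v: "v \<in> V" "v \<noteq> 0\<^sub>v n" using V0 V1(2) by blast
      have "lc v \<noteq> 0" using lc_inj[of v "0\<^sub>v n"] v V1(1) lc0 by auto
      then have "U' \<noteq> {0}" using v(1) by (auto simp: U'_def)
      then have "function_space.dim U \<le> function_space.dim U'"
        using min[of U'] inv' U'U UW by (auto simp: P_def)
      obtain B' where B': "B' \<subseteq> U'" "function_space.independent B'" "U' \<subseteq> function_space.span B'"
        "card B' = function_space.dim U'"
        using function_space.basis_exists[of U'] by blast
      have "U \<subseteq> U'"
      proof
        fix v assume v: "v \<in> U"
        show "v \<in> U'"
        proof (rule ccontr)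
          assume "v \<notin> U'"
          then have vs: "v \<notin> function_space.span B'"
            using function_space.span_minimal[OF B'(1) sub'] by blast
          then have "function_space.independent (insert v B')"
            using B'(2) by (rule function_space.independent_insertI)
          moreover have "insert v B' \<subseteq> function_space.span B" using v B'(1) U'U B(3) by auto
          ultimately have bound: "finite (insert v B') \<and> card (insert v B') \<le> card B"
            by (rule function_space.independent_span_bound[OF finB])
          moreover have "v \<notin> B'" using vs function_space.span_base by blast
          ultimately show False
            using B(4) B'(4) \<open>function_space.dim U \<le> function_space.dim U'\<close> by auto
        qed
      qed
      have "carrier_vec n \<subseteq> V"
      proof
        fix w :: "complex vec" assume w: "w \<in> carrier_vec n"
        have "lc w \<in> U'" using lc_U \<open>U \<subseteq> U'\<close> by blast
        then obtain w' where "w' \<in> V" "lc w = lc w'" by (auto simp: U'_def)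
        then show "w \<in> V" using lc_inj[of w w'] w V1(1) by auto
      qed
      then show False using Vne V1(1) by blast
    qed
  qed
  have "irreducible_rep G n \<tau>" using rep \<open>n > 0\<close> irr by (simp add: irreducible_rep_iff)
  then show thesis
    by (rule that[where u = u]) (use uU UW trans_u zero in blast)+
qed

lemma Irr_one_nonzero: "\<chi> \<in> Irr G \<Longrightarrow> \<chi> \<one> \<noteq> 0"
  using Irr_one[OF is_group] by fastforce

text \<open>The function \<open>e\<close> below is the sum of the central idempotents of all irreducible characters: it is
idempotent, and convolution with it fixes every irreducible character. If \<open>e\<close> were not the delta
function, the functions \<open>v\<close> with \<open>v * e = 0\<close> would form a nonzero translation-invariant space. On an
irreducible subspace \<open>e\<close> acts as zero, so its character \<open>\<psi>\<close> satisfies \<open>\<Sum>y. e y * \<psi> y = 0\<close>, whereas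
the sum equals the degree of \<open>\<psi>\<close>.\<close>
theorem regular_character:
  assumes fin: "finite (Irr G)" and g: "g \<in> carrier G"
  shows "(\<Sum>\<chi>\<in>Irr G. \<chi> \<one> * \<chi> g) = (if g = \<one> then of_nat (card (carrier G)) else 0)"
proof -
  let ?N = "of_nat (card (carrier G)) :: complex"
  have N: "?N \<noteq> 0" using finite_carrier one_closed by (auto simp: card_eq_0_iff)
  define e where "e x = (\<Sum>\<chi>\<in>Irr G. \<chi> \<one> * \<chi> (inv x)) / ?N" for x

  have key: "(\<Sum>y\<in>carrier G. \<chi> (inv y) * \<psi> (inv x \<otimes> y)) = (if \<chi> = \<psi> then ?N / \<chi> \<one> * \<chi> (inv x) else 0)"
    if "\<chi> \<in> Irr G" "\<psi> \<in> Irr G" "x \<in> carrier G" for \<chi> \<psi> x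
  proof -
    have "(\<Sum>y\<in>carrier G. \<chi> (inv y) * \<psi> (inv x \<otimes> y)) =
        (\<Sum>y\<in>carrier G. (\<lambda>h. \<psi> (inv x \<otimes> inv h) * \<chi> h) (inv y))"
      by (intro sum.cong) (simp_all add: mult.commute)
    also have "\<dots> = (\<Sum>h\<in>carrier G. \<psi> (inv x \<otimes> inv h) * \<chi> h)" by (rule sum_inverse)
    finally show ?thesis
      using Irr_convolution_distinct[OF that(1,2) _ inv_closed[OF that(3)]]
        Irr_convolution_same[OF that(1) inv_closed[OF that(3)]] by auto
  qed
  have e_conv: "(\<Sum>y\<in>carrier G. e y * \<psi> (inv x \<otimes> y)) = \<psi> (inv x)"
    if \<psi>: "\<psi> \<in> Irr G" and x: "x \<in> carrier G" for \<psi> x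
  proof -
    have "(\<Sum>y\<in>carrier G. e y * \<psi> (inv x \<otimes> y)) =
        (\<Sum>y\<in>carrier G. \<Sum>\<chi>\<in>Irr G. \<chi> \<one> / ?N * (\<chi> (inv y) * \<psi> (inv x \<otimes> y)))"
      by (simp add: e_def sum_divide_distrib sum_distrib_right mult.assoc)
    also have "\<dots> = (\<Sum>\<chi>\<in>Irr G. \<chi> \<one> / ?N * (\<Sum>y\<in>carrier G. \<chi> (inv y) * \<psi> (inv x \<otimes> y)))"
      by (subst sum.swap) (simp add: sum_distrib_left)
    also have "\<dots> = (\<Sum>\<chi>\<in>Irr G. if \<chi> = \<psi> then \<psi> (inv x) else 0)"
      using N Irr_one_nonzero by (intro sum.cong refl) (auto simp: key[OF _ \<psi> x])
    also have "\<dots> = \<psi> (inv x)" using fin \<psi> by simp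
    finally show ?thesis .
  qed
  have idem: "(\<Sum>y\<in>carrier G. e y * e (inv y \<otimes> x)) = e x" if x: "x \<in> carrier G" for x
  proof -
    have "(\<Sum>y\<in>carrier G. e y * e (inv y \<otimes> x)) =
        (\<Sum>y\<in>carrier G. \<Sum>\<psi>\<in>Irr G. \<psi> \<one> / ?N * (e y * \<psi> (inv x \<otimes> y)))"
      using x by (intro sum.cong refl)
        (simp add: e_def[of "inv _ \<otimes> x"] sum_divide_distrib sum_distrib_left inv_mult_group mult_ac)
    also have "\<dots> = (\<Sum>\<psi>\<in>Irr G. \<psi> \<one> / ?N * (\<Sum>y\<in>carrier G. e y * \<psi> (inv x \<otimes> y)))"
      by (subst sum.swap) (simp add: sum_distrib_left)
    also have "\<dots> = (\<Sum>\<psi>\<in>Irr G. \<psi> \<one> / ?N * \<psi> (inv x))"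
      by (intro sum.cong refl) (simp only: e_conv[OF _ x])
    also have "\<dots> = e x" by (simp add: e_def sum_divide_distrib)
    finally show ?thesis .
  qed
  define W where "W = {v :: 'a \<Rightarrow> complex. (\<forall>x. x \<notin> carrier G \<longrightarrow> v x = 0) \<and>
    (\<forall>x\<in>carrier G. (\<Sum>y\<in>carrier G. v y * e (inv y \<otimes> x)) = 0)}"
  have W: "translation_invariant W"
    unfolding translation_invariant_def
  proof (intro conjI ballI allI impI)
    show "function_space.subspace W"
      by (rule function_space.subspaceI)
        (auto simp: W_def distrib_right sum.distrib mult.assoc simp flip: sum_distrib_left)
  next
    fix g v assume g: "g \<in> carrier G" and v: "v \<in> W"
    have "(\<Sum>y\<in>carrier G. translate g v y * e (inv y \<otimes> x)) = 0" if x: "x \<in> carrier G" for x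
    proof -
      have "(\<Sum>y\<in>carrier G. translate g v y * e (inv y \<otimes> x)) =
          (\<Sum>y\<in>carrier G. translate g v (g \<otimes> y) * e (inv (g \<otimes> y) \<otimes> x))"
        by (rule sum_left_translate[OF g, symmetric])
      also have "\<dots> = (\<Sum>y\<in>carrier G. v y * e (inv y \<otimes> (inv g \<otimes> x)))"
        using g x by (intro sum.cong) (simp_all add: translate_def word_simps)
      also have "\<dots> = 0" using v g x by (simp add: W_def)
      finally show ?thesis .
    qed
    then show "translate g v \<in> W" by (simp add: W_def translate_def)
  qed (auto simp: W_def)
  define f where "f x = (if x \<in> carrier G then (if x = \<one> then 1 else 0) - e x else 0)" for x
  have "f \<in> W"
  proof -
    have "(\<Sum>y\<in>carrier G. f y * e (inv y \<otimes> x)) = 0" if x: "x \<in> carrier G" for x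
    proof -
      have "(\<Sum>y\<in>carrier G. f y * e (inv y \<otimes> x)) =
          (\<Sum>y\<in>carrier G. (if y = \<one> then e x else 0) - e y * e (inv y \<otimes> x))"
        using x by (intro sum.cong) (auto simp: f_def algebra_simps)
      also have "\<dots> = 0" using idem[OF x] finite_carrier by (simp add: sum_subtractf)
      finally show ?thesis .
    qed
    then show ?thesis by (auto simp: W_def f_def)
  qed
  have "f = 0"
  proof (rule ccontr)
    assume "f \<noteq> 0"
    obtain n \<tau> u where irr: "irreducible_rep G n \<tau>" and uW: "\<And>j. j < n \<Longrightarrow> u j \<in> W"
      and tr: "\<And>g j x. \<lbrakk>g \<in> carrier G; j < n\<rbrakk> \<Longrightarrow> translate g (u j) x = (\<Sum>i<n. \<tau> g $$ (i, j) * u i x)"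
      and indep0: "\<forall>c. (\<forall>x. (\<Sum>i<n. c i * u i x) = 0) \<longrightarrow> (\<forall>i<n. c i = 0)"
      by (rule irreducible_in_translation_invariant[OF W \<open>f \<in> W\<close> \<open>f \<noteq> 0\<close>]) (rule that)
    have indep: "c i = 0" if "\<And>x. (\<Sum>i<n. c i * u i x) = 0" "i < n" for c i
      using indep0 that by blast
    have e_conj: "e (inv x \<otimes> g \<otimes> x) = e g" if "x \<in> carrier G" "g \<in> carrier G" for x g
    proof -
      have "\<chi> (inv (inv x \<otimes> g \<otimes> x)) = \<chi> (inv g)" if \<chi>: "\<chi> \<in> Irr G" for \<chi>
        using Irr_conj[OF \<chi>, of "inv g" "inv x"] \<open>x \<in> carrier G\<close> \<open>g \<in> carrier G\<close>
        by (simp add: word_simps)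
      then show ?thesis
        unfolding e_def by (intro arg_cong2[where f = "(/)"] arg_cong2[where f = "(*)"] sum.cong refl)
    qed
    have coeff: "(\<Sum>g\<in>carrier G. e g * \<tau> g $$ (i, j)) = 0" if ij: "i < n" "j < n" for i j
    proof (rule indep[OF _ ij(1)])
      fix x
      show "(\<Sum>i<n. (\<Sum>g\<in>carrier G. e g * \<tau> g $$ (i, j)) * u i x) = 0"
      proof (cases "x \<in> carrier G")
        case True
        have "(\<Sum>i<n. (\<Sum>g\<in>carrier G. e g * \<tau> g $$ (i, j)) * u i x) =
            (\<Sum>g\<in>carrier G. e g * (\<Sum>i<n. \<tau> g $$ (i, j) * u i x))"
          unfolding sum_distrib_right sum_distrib_left by (subst sum.swap) (simp add: mult.assoc)
        also have "\<dots> = (\<Sum>g\<in>carrier G. e g * u j (inv g \<otimes> x))"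
          using True by (intro sum.cong refl) (simp add: translate_def flip: tr[OF _ ij(2)])
        also have "\<dots> = (\<Sum>g\<in>carrier G. e (x \<otimes> g) * u j (inv (x \<otimes> g) \<otimes> x))"
          by (rule sum_left_translate[OF True, symmetric])
        also have "\<dots> = (\<Sum>g\<in>carrier G. e (x \<otimes> inv g) * u j (inv (x \<otimes> inv g) \<otimes> x))"
          by (rule sum_inverse[symmetric])
        also have "\<dots> = (\<Sum>y\<in>carrier G. u j y * e (inv y \<otimes> x))"
        proof (rule sum.cong[OF refl])
          fix y assume y: "y \<in> carrier G"
          have "e (x \<otimes> inv y) = e (inv y \<otimes> x)"
            using e_conj[OF True, of "x \<otimes> inv y"] True y by (simp add: word_simps)
          then show "e (x \<otimes> inv y) * u j (inv (x \<otimes> inv y) \<otimes> x) = u j y * e (inv y \<otimes> x)"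
            using True y by (simp add: word_simps)
        qed
        also have "\<dots> = 0" using uW[OF ij(2)] True by (simp add: W_def)
        finally show ?thesis .
      next
        case False
        then show ?thesis using uW by (simp add: W_def)
      qed
    qed
    define \<psi> where "\<psi> = rep_character G \<tau>"
    have \<psi>: "\<psi> \<in> Irr G" using irr by (auto simp: Irr_def \<psi>_def)
    have \<tau>: "matrix_rep G n \<tau>" using irr by (simp add: irreducible_rep_iff)
    have \<psi>_eq: "\<psi> g = (\<Sum>i<n. \<tau> g $$ (i, i))" if "g \<in> carrier G" for g
      using that mat_trace_eq_sum[OF matrix_repD(1)[OF \<tau> that]] by (simp add: \<psi>_def rep_character_def)
    have "\<psi> \<one> = (\<Sum>y\<in>carrier G. e y * \<psi> y)"
      using e_conv[OF \<psi> one_closed] by (simp cong: sum.cong)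
    also have "\<dots> = (\<Sum>i<n. \<Sum>y\<in>carrier G. e y * \<tau> y $$ (i, i))"
      by (subst sum.swap) (simp add: \<psi>_eq sum_distrib_left)
    also have "\<dots> = 0" by (simp add: coeff)
    finally show False using Irr_one_nonzero[OF \<psi>] by simp
  qed
  then have "f (inv g) = 0" by simp
  then have "e (inv g) = (if g = \<one> then 1 else 0)" using g by (simp add: f_def)
  then show ?thesis using g N by (auto simp: e_def split: if_splits)
qed

text \<open>The product of two character values becomes, by \<open>Irr_class_mult\<close>, a sum of values of the regular
character, which counts the elements that conjugate \<open>h\<close> to \<open>g\<close>.\<close>
theorem column_orthogonality:
  assumes fin: "finite (Irr G)" and gh: "g \<in> carrier G" "h \<in> carrier G"
  shows "(\<Sum>\<chi>\<in>Irr G. \<chi> g * \<chi> (inv h)) = of_nat (card {z \<in> carrier G. g = z \<otimes> h \<otimes> inv z})"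
proof -
  let ?N = "of_nat (card (carrier G)) :: complex"
  have N: "?N \<noteq> 0" using finite_carrier one_closed by (auto simp: card_eq_0_iff)
  have iff: "g \<otimes> (z \<otimes> inv h \<otimes> inv z) = \<one> \<longleftrightarrow> g = z \<otimes> h \<otimes> inv z" if z: "z \<in> carrier G" for z
  proof -
    have "z \<otimes> inv h \<otimes> inv z = inv (z \<otimes> h \<otimes> inv z)" using z gh by (simp add: word_simps)
    moreover have "g \<otimes> inv y = \<one> \<longleftrightarrow> g = y" if "y \<in> carrier G" for y
      using gh that inv_solve_right'[of \<one> g y] by auto
    ultimately show ?thesis using z gh by simp
  qed
  have "?N * (\<Sum>\<chi>\<in>Irr G. \<chi> g * \<chi> (inv h)) =
      (\<Sum>\<chi>\<in>Irr G. \<Sum>z\<in>carrier G. \<chi> \<one> * \<chi> (g \<otimes> (z \<otimes> inv h \<otimes> inv z)))"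
    using gh by (simp add: sum_distrib_left Irr_class_mult)
  also have "\<dots> = (\<Sum>z\<in>carrier G. \<Sum>\<chi>\<in>Irr G. \<chi> \<one> * \<chi> (g \<otimes> (z \<otimes> inv h \<otimes> inv z)))"
    by (rule sum.swap)
  also have "\<dots> = (\<Sum>z\<in>carrier G. if g = z \<otimes> h \<otimes> inv z then ?N else 0)"
    using gh by (intro sum.cong refl) (simp add: regular_character[OF fin] iff)
  also have "\<dots> = ?N * of_nat (card {z \<in> carrier G. g = z \<otimes> h \<otimes> inv z})"
    using finite_carrier by (simp add: sum.If_cases Int_def)
  finally show ?thesis using N by simp
qed

end

section \<open>The character that separates two columns\<close>

context finite_group
begin

lemma column_orthogonality_nonzero_imp_conj:
  assumes "finite (Irr G)" "g \<in> carrier G" "h \<in> carrier G" "(\<Sum>\<chi>\<in>Irr G. \<chi> g * \<chi> (inv h)) \<noteq> 0"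
  shows "\<exists>z\<in>carrier G. g = z \<otimes> h \<otimes> inv z"
proof (rule ccontr)
  assume "\<not> ?thesis"
  then have "{z \<in> carrier G. g = z \<otimes> h \<otimes> inv z} = {}" by blast
  with column_orthogonality[OF assms(1-3)]
  have "(\<Sum>\<chi>\<in>Irr G. \<chi> g * \<chi> (inv h)) = of_nat (card ({} :: 'a set))" by (simp only:)
  then show False using assms(4) by simp
qed

text \<open>The columns of \<open>a\<close> and of \<open>b\<close> are both orthogonal to the column of \<open>g\<close>, and their difference has a
single nonzero entry.\<close>
lemma distinguishing_character_vanishes:
  assumes fin: "finite (Irr G)" and ab: "a \<in> carrier G" "b \<in> carrier G"
    and \<chi>: "\<chi> \<in> Irr G" "\<chi> a \<noteq> \<chi> b" and agree: "\<And>\<psi>. \<psi> \<in> Irr G - {\<chi>} \<Longrightarrow> \<psi> a = \<psi> b"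
    and g: "g \<in> carrier G" and na: "\<not> (\<exists>z\<in>carrier G. a = z \<otimes> g \<otimes> inv z)"
    and nb: "\<not> (\<exists>z\<in>carrier G. b = z \<otimes> g \<otimes> inv z)"
  shows "\<chi> (inv g) = 0"
proof -
  have "(\<Sum>\<psi>\<in>Irr G. \<psi> a * \<psi> (inv g)) = 0" "(\<Sum>\<psi>\<in>Irr G. \<psi> b * \<psi> (inv g)) = 0"
    using column_orthogonality_nonzero_imp_conj[OF fin] ab g na nb by blast+
  then have "0 = (\<Sum>\<psi>\<in>Irr G. (\<psi> a - \<psi> b) * \<psi> (inv g))"
    by (simp add: left_diff_distrib sum_subtractf)
  also have "\<dots> = (\<Sum>\<psi>\<in>Irr G. if \<psi> = \<chi> then (\<chi> a - \<chi> b) * \<chi> (inv g) else 0)"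
    using agree by (intro sum.cong) auto
  also have "\<dots> = (\<chi> a - \<chi> b) * \<chi> (inv g)" using fin \<chi>(1) by simp
  finally show ?thesis using \<chi>(2) by simp
qed

end

locale CD1_character = finite_group +
  fixes b :: 'a and \<chi> :: "'a \<Rightarrow> complex"
  assumes finite_Irr: "finite (Irr G)" and trivial_Irr: "trivial_character G \<in> Irr G"
    and b: "b \<in> carrier G" "b \<noteq> \<one>"
    and \<chi>: "\<chi> \<in> Irr G" "\<chi> \<one> \<noteq> \<chi> b"
    and agree: "\<And>\<psi>. \<lbrakk>\<psi> \<in> Irr G; \<psi> \<noteq> \<chi>\<rbrakk> \<Longrightarrow> \<psi> b = \<psi> \<one>"
    and order_gt_2: "card (carrier G) > 2"
begin

definition M :: "'a set" where
  "M = insert \<one> {z \<otimes> b \<otimes> inv z | z. z \<in> carrier G}"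

definition deg :: "('a \<Rightarrow> complex) \<Rightarrow> nat" where
  "deg \<psi> = (SOME n. n > 0 \<and> \<psi> \<one> = of_nat n)"

lemma deg: "\<psi> \<in> Irr G \<Longrightarrow> deg \<psi> > 0" "\<psi> \<in> Irr G \<Longrightarrow> \<psi> \<one> = of_nat (deg \<psi>)"
proof -
  assume "\<psi> \<in> Irr G"
  then have "\<exists>n. n > 0 \<and> \<psi> \<one> = of_nat n" using Irr_one[OF is_group] by blast
  from someI_ex[OF this] show "deg \<psi> > 0" "\<psi> \<one> = of_nat (deg \<psi>)" by (simp_all add: deg_def)
qed

definition s :: nat where
  "s = (\<Sum>\<psi>\<in>Irr G - {\<chi>}. deg \<psi> * deg \<psi>)"

lemma M_carrier: "x \<in> M \<Longrightarrow> x \<in> carrier G"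
  using b by (auto simp: M_def)

lemma finite_M: "finite M"
  by (rule finite_subset[OF _ finite_carrier]) (use M_carrier in blast)

lemma M_one: "\<one> \<in> M" by (simp add: M_def)

lemma b_M: "b \<in> M"
  using b(1) by (auto simp: M_def intro!: exI[of _ \<one>])

lemma \<chi>_on_M: "\<lbrakk>x \<in> M; x \<noteq> \<one>\<rbrakk> \<Longrightarrow> \<chi> x = \<chi> b"
  using Irr_conj[OF \<chi>(1) b(1)] by (auto simp: M_def)

lemma trivial_ne: "trivial_character G \<noteq> \<chi>"
  using \<chi>(2) b(1) by (auto simp: trivial_character_def)

lemma sum_other_squares: "(\<Sum>\<psi>\<in>Irr G - {\<chi>}. \<psi> \<one> * \<psi> \<one>) = of_nat s"
  by (simp add: s_def deg(2))

lemma sum_Irr_split: "(\<Sum>\<psi>\<in>Irr G. F \<psi>) = F \<chi> + (\<Sum>\<psi>\<in>Irr G - {\<chi>}. F \<psi>)"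
  for F :: "('a \<Rightarrow> complex) \<Rightarrow> complex"
  using finite_Irr \<chi>(1) by (rule sum.remove)

lemma order_eq: "card (carrier G) = deg \<chi> * deg \<chi> + s"
proof -
  have "(\<Sum>\<psi>\<in>Irr G. \<psi> \<one> * \<psi> (inv \<one>)) = of_nat (card (carrier G))"
    using column_orthogonality[OF finite_Irr one_closed one_closed] by (simp cong: conj_cong)
  then have "of_nat (card (carrier G)) = (of_nat (deg \<chi> * deg \<chi> + s) :: complex)"
    using sum_other_squares deg(2)[OF \<chi>(1)] by (simp add: sum_Irr_split)
  then show ?thesis by (simp only: of_nat_eq_iff)
qed

lemma \<chi>_b_times_degree: "\<chi> b * of_nat (deg \<chi>) = - of_nat s"
proof -
  have "(\<Sum>\<psi>\<in>Irr G. \<psi> b * \<psi> (inv \<one>)) = 0"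
    using column_orthogonality_nonzero_imp_conj[OF finite_Irr b(1) one_closed] b(2) by auto
  moreover have "(\<Sum>\<psi>\<in>Irr G - {\<chi>}. \<psi> b * \<psi> \<one>) = (\<Sum>\<psi>\<in>Irr G - {\<chi>}. \<psi> \<one> * \<psi> \<one>)"
    using agree by (intro sum.cong) auto
  ultimately have "\<chi> b * \<chi> \<one> + of_nat s = 0"
    using sum_other_squares by (simp add: sum_Irr_split)
  then show ?thesis using deg(2)[OF \<chi>(1)] by (simp add: add_eq_0_iff2)
qed

lemma deg_le_s: "\<lbrakk>\<psi> \<in> Irr G; \<psi> \<noteq> \<chi>\<rbrakk> \<Longrightarrow> deg \<psi> * deg \<psi> \<le> s"
  unfolding s_def using finite_Irr by (intro member_le_sum) auto

lemma s_pos: "s > 0"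
  using deg_le_s[OF trivial_Irr trivial_ne] deg(1)[OF trivial_Irr] by (metis gr0I le_zero_eq mult_is_0 not_less0)

lemma \<chi>_b_nonzero: "\<chi> b \<noteq> 0"
  using \<chi>_b_times_degree s_pos by auto

lemma vanishes_if_inv_notin_M:
  assumes g: "g \<in> carrier G" and M: "inv g \<notin> M"
  shows "\<chi> g = 0"
proof -
  have "\<chi> (inv (inv g)) = 0"
  proof (rule distinguishing_character_vanishes[OF finite_Irr one_closed b(1) \<chi>])
    show "\<psi> \<one> = \<psi> b" if "\<psi> \<in> Irr G - {\<chi>}" for \<psi> using that agree[of \<psi>] by simp
    show "inv g \<in> carrier G" using g by simp
    show "\<not> (\<exists>z\<in>carrier G. \<one> = z \<otimes> inv g \<otimes> inv z)"
    proof clarify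
      fix z assume z: "z \<in> carrier G" "\<one> = z \<otimes> inv g \<otimes> inv z"
      have "inv g = inv z \<otimes> (z \<otimes> inv g \<otimes> inv z) \<otimes> z" using z(1) g by (simp add: word_simps)
      also have "\<dots> = \<one>" using z by (simp flip: z(2))
      finally show False using M M_one by simp
    qed
    show "\<not> (\<exists>z\<in>carrier G. b = z \<otimes> inv g \<otimes> inv z)"
    proof clarify
      fix z assume z: "z \<in> carrier G" "b = z \<otimes> inv g \<otimes> inv z"
      have "inv g = inv z \<otimes> (z \<otimes> inv g \<otimes> inv z) \<otimes> inv (inv z)" using z(1) g by (simp add: word_simps)
      also have "\<dots> = inv z \<otimes> b \<otimes> inv (inv z)" by (simp only: z(2))
      also have "\<dots> \<in> M" using z(1) by (auto simp: M_def intro!: exI[of _ "inv z"])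
      finally show False using M by simp
    qed
  qed
  then show ?thesis using g by simp
qed

lemma M_inv: "x \<in> M \<Longrightarrow> inv x \<in> M"
  using vanishes_if_inv_notin_M[of x] \<chi>_on_M[of x] \<chi>_b_nonzero M_carrier M_one by (cases "x = \<one>") auto

lemma vanishes_off_M: "\<lbrakk>g \<in> carrier G; g \<notin> M\<rbrakk> \<Longrightarrow> \<chi> g = 0"
  using vanishes_if_inv_notin_M[of g] M_inv[of "inv g"] by auto

text \<open>So \<open>\<chi>\<close> is a combination of the delta function at the identity and the indicator function of \<open>M\<close>.\<close>
lemma \<chi>_formula:
  assumes "g \<in> carrier G"
  shows "\<chi> g = (if g = \<one> then \<chi> \<one> - \<chi> b else 0) + (if g \<in> M then \<chi> b else 0)"
  using assms vanishes_off_M \<chi>_on_M M_one by auto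

lemma convolution_with_\<chi>:
  fixes \<psi> :: "'a \<Rightarrow> complex"
  assumes g: "g \<in> carrier G"
  shows "(\<Sum>h\<in>carrier G. \<psi> (g \<otimes> inv h) * \<chi> h) =
    (\<chi> \<one> - \<chi> b) * \<psi> g + \<chi> b * (\<Sum>h\<in>M. \<psi> (g \<otimes> inv h))"
proof -
  have "(\<Sum>h\<in>carrier G. \<psi> (g \<otimes> inv h) * \<chi> h) =
      (\<Sum>h\<in>carrier G. (if h = \<one> then (\<chi> \<one> - \<chi> b) * \<psi> g else 0) +
        (if h \<in> M then \<chi> b * \<psi> (g \<otimes> inv h) else 0))"
  proof (rule sum.cong[OF refl])
    fix h assume h: "h \<in> carrier G"
    show "\<psi> (g \<otimes> inv h) * \<chi> h = (if h = \<one> then (\<chi> \<one> - \<chi> b) * \<psi> g else 0) +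
        (if h \<in> M then \<chi> b * \<psi> (g \<otimes> inv h) else 0)"
      using g by (subst \<chi>_formula[OF h]) (simp add: algebra_simps)
  qed
  also have "\<dots> = (\<chi> \<one> - \<chi> b) * \<psi> g + (\<Sum>h\<in>M. \<chi> b * \<psi> (g \<otimes> inv h))"
    using finite_carrier M_carrier
    by (simp add: sum.distrib sum.inter_restrict[symmetric] Int_absorb1 subset_iff)
  finally show ?thesis by (simp add: sum_distrib_left)
qed

lemma order_over_degree: "of_nat (card (carrier G)) / \<chi> \<one> = \<chi> \<one> - \<chi> b"
  using \<chi>_b_times_degree deg[OF \<chi>(1)] by (simp add: order_eq field_simps)

text \<open>The relation \<open>\<chi> * \<chi> = (|G| / \<chi>(1)) \<chi>\<close> at the point \<open>g\<close>, expanded with the explicit form of \<open>\<chi>\<close>. It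
determines in how many ways \<open>g\<close> is a product of two elements of \<open>M\<close>; in particular there are none
if \<open>g\<close> lies outside \<open>M\<close>.\<close>
lemma M_product_count:
  assumes g: "g \<in> carrier G"
  shows "(if g \<in> M then \<chi> \<one> - \<chi> b else 0) + \<chi> b * of_nat (card {h \<in> M. g \<otimes> inv h \<in> M}) = 0"
proof -
  have "\<chi> b * (\<Sum>h\<in>M. \<chi> (g \<otimes> inv h)) = 0"
    using Irr_convolution_same[OF \<chi>(1) g] convolution_with_\<chi>[OF g, of \<chi>] order_over_degree by simp
  then have "0 = (\<Sum>h\<in>M. \<chi> (g \<otimes> inv h))" using \<chi>_b_nonzero by simp
  also have "\<dots> = (\<Sum>h\<in>M. (if h = g then \<chi> \<one> - \<chi> b else 0) + (if g \<otimes> inv h \<in> M then \<chi> b else 0))"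
  proof (rule sum.cong[OF refl])
    fix h assume "h \<in> M"
    then have h: "h \<in> carrier G" by (rule M_carrier)
    have "g \<otimes> inv h = \<one> \<longleftrightarrow> h = g" using g h inv_solve_right'[of \<one> g h] by auto
    then show "\<chi> (g \<otimes> inv h) = (if h = g then \<chi> \<one> - \<chi> b else 0) + (if g \<otimes> inv h \<in> M then \<chi> b else 0)"
      using \<chi>_formula[of "g \<otimes> inv h"] g h by (simp only: m_closed inv_closed simp_thms)
  qed
  also have "\<dots> = (if g \<in> M then \<chi> \<one> - \<chi> b else 0) + \<chi> b * of_nat (card {h \<in> M. g \<otimes> inv h \<in> M})"
    using finite_M by (simp add: sum.distrib sum.If_cases Int_def mult.commute)
  finally show ?thesis by simp
qed

lemma M_mult:
  assumes "x \<in> M" "y \<in> M"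
  shows "x \<otimes> y \<in> M"
proof (rule ccontr)
  assume n: "x \<otimes> y \<notin> M"
  have xy: "x \<in> carrier G" "y \<in> carrier G" using assms M_carrier by auto
  have "of_nat (card {h \<in> M. (x \<otimes> y) \<otimes> inv h \<in> M}) = (0::complex)"
    using M_product_count[of "x \<otimes> y"] xy n \<chi>_b_nonzero by simp
  then have "{h \<in> M. (x \<otimes> y) \<otimes> inv h \<in> M} = {}" using finite_M by simp
  moreover have "y \<in> {h \<in> M. (x \<otimes> y) \<otimes> inv h \<in> M}" using assms xy by (simp add: m_assoc)
  ultimately show False by blast
qed

lemma subgroup_M: "subgroup M G"
  using finite_M M_one M_mult M_carrier by (intro finite_mult_closed_imp_subgroup) auto

lemma card_M_times_s: "card M * s = card (carrier G)"
proof -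
  have "{h \<in> M. \<one> \<otimes> inv h \<in> M} = M" using M_inv M_carrier by auto
  then have "\<chi> \<one> - \<chi> b + \<chi> b * of_nat (card M) = 0"
    using M_product_count[OF one_closed] M_one by simp
  then have "0 = (\<chi> \<one> - \<chi> b + \<chi> b * of_nat (card M)) * of_nat (deg \<chi>)" by simp
  also have "\<dots> = \<chi> \<one> * of_nat (deg \<chi>) - \<chi> b * of_nat (deg \<chi>) +
      (\<chi> b * of_nat (deg \<chi>)) * of_nat (card M)"
    by (simp add: algebra_simps)
  also have "\<dots> = of_nat (deg \<chi>) * of_nat (deg \<chi>) + of_nat s - of_nat s * of_nat (card M)"
    unfolding \<chi>_b_times_degree deg(2)[OF \<chi>(1)] by simp
  finally have "of_nat (deg \<chi>) * of_nat (deg \<chi>) + of_nat s = of_nat s * (of_nat (card M) :: complex)"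
    by simp
  then have "of_nat (deg \<chi> * deg \<chi> + s) = (of_nat (card M * s) :: complex)" by (simp add: mult.commute)
  then show ?thesis by (simp only: of_nat_eq_iff order_eq)
qed

text \<open>The relation \<open>\<psi> * \<chi> = 0\<close>, expanded in the same way, expresses \<open>\<psi>(g)\<close> by the sum of \<open>\<psi>\<close> over the coset
\<open>g M\<close>, and that sum depends on the coset only.\<close>
lemma other_characters_M_invariant:
  assumes \<psi>: "\<psi> \<in> Irr G" "\<psi> \<noteq> \<chi>" and g: "g \<in> carrier G" and x: "x \<in> M"
  shows "\<psi> (g \<otimes> x) = \<psi> g"
proof -
  have q: "\<chi> \<one> - \<chi> b \<noteq> 0" using \<chi>(2) by simp
  have conv: "(\<chi> \<one> - \<chi> b) * \<psi> h = - \<chi> b * (\<Sum>m\<in>M. \<psi> (h \<otimes> inv m))" if h: "h \<in> carrier G" for h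
    using Irr_convolution_distinct[OF \<chi>(1) \<psi>(1) _ h] convolution_with_\<chi>[OF h, of \<psi>] \<psi>(2)
    by (simp add: eq_neg_iff_add_eq_0)
  have xG: "x \<in> carrier G" using x M_carrier by blast
  have "(\<Sum>m\<in>M. \<psi> (g \<otimes> x \<otimes> inv m)) = (\<Sum>m\<in>M. \<psi> (g \<otimes> inv m))"
    by (rule sum.reindex_bij_witness[where i = "\<lambda>m. m \<otimes> x" and j = "\<lambda>m. m \<otimes> inv x"])
      (use g x xG M_carrier M_mult M_inv in \<open>auto simp: word_simps\<close>)
  then have "(\<chi> \<one> - \<chi> b) * \<psi> (g \<otimes> x) = (\<chi> \<one> - \<chi> b) * \<psi> g"
    using conv[of "g \<otimes> x"] conv[OF g] g xG by simp
  then show ?thesis using q by simp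
qed

lemma common_kernel_eq_M: "{g \<in> carrier G. \<forall>\<psi>\<in>Irr G - {\<chi>}. \<psi> g = \<psi> \<one>} = M"
proof (intro equalityI subsetI)
  fix x assume x: "x \<in> M"
  then show "x \<in> {g \<in> carrier G. \<forall>\<psi>\<in>Irr G - {\<chi>}. \<psi> g = \<psi> \<one>}"
    using other_characters_M_invariant[OF _ _ one_closed x] M_carrier by auto
next
  fix g assume g: "g \<in> {g \<in> carrier G. \<forall>\<psi>\<in>Irr G - {\<chi>}. \<psi> g = \<psi> \<one>}"
  show "g \<in> M"
  proof (rule ccontr)
    assume n: "g \<notin> M"
    then have "\<chi> g = 0" "g \<noteq> \<one>" using vanishes_off_M g M_one by auto
    have "(\<Sum>\<psi>\<in>Irr G. \<psi> g * \<psi> (inv \<one>)) = 0"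
      using column_orthogonality_nonzero_imp_conj[OF finite_Irr _ one_closed, of g] g \<open>g \<noteq> \<one>\<close> by auto
    moreover have "(\<Sum>\<psi>\<in>Irr G - {\<chi>}. \<psi> g * \<psi> \<one>) = (\<Sum>\<psi>\<in>Irr G - {\<chi>}. \<psi> \<one> * \<psi> \<one>)"
      using g by (intro sum.cong) auto
    ultimately have "of_nat s = (0::complex)"
      using sum_other_squares \<open>\<chi> g = 0\<close> by (simp add: sum_Irr_split)
    then show False using s_pos by simp
  qed
qed

text \<open>No irreducible character separates \<open>g x\<close> from \<open>g\<close>: the others are constant on cosets of \<open>M\<close>, and \<open>\<chi>\<close>
vanishes at both elements.\<close>
lemma camina_M:
  assumes g: "g \<in> carrier G" "g \<notin> M" and x: "x \<in> M"
  shows "\<exists>z\<in>carrier G. g \<otimes> x = z \<otimes> g \<otimes> inv z"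
proof -
  have xG: "x \<in> carrier G" using x M_carrier by blast
  have "g \<otimes> x \<notin> M"
  proof
    assume "g \<otimes> x \<in> M"
    then have "(g \<otimes> x) \<otimes> inv x \<in> M" using M_mult M_inv x by blast
    then show False using g xG by (simp add: m_assoc)
  qed
  then have "\<psi> (g \<otimes> x) = \<psi> g" if "\<psi> \<in> Irr G" for \<psi>
    using other_characters_M_invariant[OF that _ g(1) x] vanishes_off_M g xG by (cases "\<psi> = \<chi>") auto
  then have "(\<Sum>\<psi>\<in>Irr G. \<psi> (g \<otimes> x) * \<psi> (inv g)) = (\<Sum>\<psi>\<in>Irr G. \<psi> g * \<psi> (inv g))"
    by (intro sum.cong) auto
  also have "\<dots> = of_nat (card {z \<in> carrier G. g = z \<otimes> g \<otimes> inv z})"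
    by (rule column_orthogonality[OF finite_Irr g(1) g(1)])
  also have "\<dots> \<noteq> (0::complex)"
  proof -
    have "\<one> \<in> {z \<in> carrier G. g = z \<otimes> g \<otimes> inv z}" using g by simp
    then have "card {z \<in> carrier G. g = z \<otimes> g \<otimes> inv z} \<noteq> 0" using finite_carrier by auto
    then show ?thesis by simp
  qed
  finally show ?thesis
    using column_orthogonality_nonzero_imp_conj[OF finite_Irr, of "g \<otimes> x" g] g xG by simp
qed

text \<open>The squared length of the column of \<open>b\<close>, cleared of the denominator of \<open>\<chi>(b) = - s / \<chi>(1)\<close>.\<close>
lemma card_centralizer_b: "card (centralizer G {b}) * (deg \<chi> * deg \<chi>) = s * s * card M"
proof -
  have ib: "inv b \<in> M" "inv b \<noteq> \<one>" using M_inv[OF b_M] b by auto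
  have "\<psi> b * \<psi> (inv b) = \<psi> \<one> * \<psi> \<one>" if \<psi>: "\<psi> \<in> Irr G - {\<chi>}" for \<psi>
    using agree[of \<psi>] other_characters_M_invariant[of \<psi> \<one> "inv b"] \<psi> ib b by auto
  then have "(\<Sum>\<psi>\<in>Irr G. \<psi> b * \<psi> (inv b)) = \<chi> b * \<chi> b + of_nat s"
    using \<chi>_on_M[OF ib] sum_other_squares by (simp add: sum_Irr_split)
  moreover have "{z \<in> carrier G. b = z \<otimes> b \<otimes> inv z} = centralizer G {b}"
    using b(1) conj_eq_iff_commute[OF _ b(1)] by (auto simp: mem_centralizer_singleton) metis+
  ultimately have "of_nat (card (centralizer G {b})) = \<chi> b * \<chi> b + of_nat s"
    using column_orthogonality[OF finite_Irr b(1) b(1)] by simp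
  then have "of_nat (card (centralizer G {b}) * (deg \<chi> * deg \<chi>)) =
      (\<chi> b * of_nat (deg \<chi>)) * (\<chi> b * of_nat (deg \<chi>)) + of_nat (s * (deg \<chi> * deg \<chi>))"
    by (simp add: algebra_simps)
  also have "\<dots> = of_nat (s * (deg \<chi> * deg \<chi> + s))"
    unfolding \<chi>_b_times_degree by (simp add: algebra_simps)
  also have "deg \<chi> * deg \<chi> + s = card M * s" using card_M_times_s order_eq by simp
  finally have "card (centralizer G {b}) * (deg \<chi> * deg \<chi>) = s * (card M * s)" by (simp only: of_nat_eq_iff)
  then show ?thesis by (simp add: mult_ac)
qed

lemma card_M_pos: "card M > 0"
  using finite_M M_one by (auto simp: card_gt_0_iff)

lemma card_centralizer_eq_card_M_iff: "card (centralizer G {b}) = card M \<longleftrightarrow> \<chi> b = - 1"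
proof -
  have d: "deg \<chi> > 0" using deg(1)[OF \<chi>(1)] .
  have "card (centralizer G {b}) = card M \<longleftrightarrow>
      card (centralizer G {b}) * (deg \<chi> * deg \<chi>) = card M * (deg \<chi> * deg \<chi>)"
    using d by simp
  also have "\<dots> \<longleftrightarrow> card M * (s * s) = card M * (deg \<chi> * deg \<chi>)"
    unfolding card_centralizer_b by (simp add: mult_ac)
  also have "\<dots> \<longleftrightarrow> s * s = deg \<chi> * deg \<chi>" using card_M_pos by simp
  also have "\<dots> \<longleftrightarrow> s = deg \<chi>" by (metis power2_eq_square power2_eq_imp_eq le0)
  also have "\<dots> \<longleftrightarrow> \<chi> b * of_nat (deg \<chi>) = - of_nat (deg \<chi>)"
    unfolding \<chi>_b_times_degree by simp
  also have "\<dots> \<longleftrightarrow> \<chi> b = - 1"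
  proof -
    have "(\<chi> b * of_nat (deg \<chi>) = - of_nat (deg \<chi>)) \<longleftrightarrow> (\<chi> b * of_nat (deg \<chi>) = (-1) * of_nat (deg \<chi>))" by simp
    also have "\<dots> \<longleftrightarrow> \<chi> b = - 1" using d by (simp only: mult_cancel_right of_nat_eq_0_iff) auto
    finally show ?thesis .
  qed
  finally show ?thesis .
qed

text \<open>As the centralizer of \<open>b\<close> is at most as large as the group, \<open>s \<le> \<chi>(1)\<^sup>2\<close>. A degree \<open>\<psi>(1) \<ge> \<chi>(1)\<close> would
already exhaust \<open>s\<close>, so \<open>\<psi>\<close> would be the only other character, that is the trivial one, and the group
would have order at most \<open>2\<close>.\<close>
lemma deg_less_deg_\<chi>:
  assumes \<psi>: "\<psi> \<in> Irr G" "\<psi> \<noteq> \<chi>"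
  shows "deg \<psi> < deg \<chi>"
proof (rule ccontr)
  assume "\<not> ?thesis"
  then have ge: "deg \<chi> * deg \<chi> \<le> deg \<psi> * deg \<psi>" by (simp add: mult_le_mono)
  have "card (centralizer G {b}) \<le> card (carrier G)"
    using finite_carrier by (intro card_mono) (auto simp: centralizer_def)
  then have "card (centralizer G {b}) * (deg \<chi> * deg \<chi>) \<le> card (carrier G) * (deg \<chi> * deg \<chi>)"
    by (rule mult_le_mono1)
  then have "s * s * card M \<le> card M * s * (deg \<chi> * deg \<chi>)"
    by (simp only: card_centralizer_b card_M_times_s)
  then have "(s * card M) * s \<le> (s * card M) * (deg \<chi> * deg \<chi>)" by (simp add: mult_ac)
  then have le: "s \<le> deg \<chi> * deg \<chi>" using s_pos card_M_pos by simp
  have "deg (trivial_character G) = 1"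
    using deg(2)[OF trivial_Irr] by (simp add: trivial_character_def)
  show False
  proof (cases "\<psi> = trivial_character G")
    case True
    then have "deg \<psi> = 1" using \<open>deg (trivial_character G) = 1\<close> by simp
    then have "deg \<chi> * deg \<chi> \<le> 1" using ge by simp
    then have "card (carrier G) \<le> 2" using le order_eq by linarith
    then show False using order_gt_2 by simp
  next
    case False
    have "(\<Sum>\<phi>\<in>{\<psi>, trivial_character G}. deg \<phi> * deg \<phi>) \<le> s"
      unfolding s_def using finite_Irr \<psi> trivial_Irr trivial_ne by (intro sum_mono2) auto
    then have "deg \<psi> * deg \<psi> + 1 \<le> s"
      using False \<open>deg (trivial_character G) = 1\<close> by simp
    then show False using ge le by linarith
  qed
qed

theorem kernel_self_centralizing_iff: "M = centralizer G M \<longleftrightarrow> \<chi> b = - 1"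
proof -
  have "camina_single_class G M b"
    by (intro camina_single_class.intro camina_single_class_axioms.intro)
      (rule finite_group_axioms b M_def subgroup_M camina_M; assumption)+
  then interpret camina_single_class G M b .
  show ?thesis
    unfolding card_centralizer_eq_card_M_iff[symmetric] by (rule self_centralizing_iff_card_centralizer)
qed

end

section \<open>Self-centralizing common kernels\<close>

theorem theorem4:
  fixes G :: "('a, 'm) monoid_scheme"
    and k :: nat and \<chi> :: "nat \<Rightarrow> 'a \<Rightarrow> complex"
    and a b :: 'a and N :: "'a set"
  assumes "CD1_group G"
    and "Irr_enumeration G k \<chi>"
    and "columns_differ_once G a b" and "b \<noteq> \<one>\<^bsub>G\<^esub>"
    and "N = (\<Inter>i\<in>{1..k - 1}. char_kernel G (\<chi> i))"
  shows "N = centralizer G N \<longleftrightarrow> \<chi> k b = - 1"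
proof -
  interpret finite_group G
    using assms(1) by (simp add: CD1_group_def finite_group_def finite_group_axioms_def)
  have bij: "bij_betw \<chi> {1..k} (Irr G)" and triv: "\<chi> 1 = trivial_character G"
    and mono: "mono_on {1..k} (\<lambda>i. char_degree G (\<chi> i))"
    using assms(2) by (auto simp: Irr_enumeration_def)
  have fin: "finite (Irr G)" using bij bij_betw_finite by blast
  obtain \<xi> where ab: "a \<in> carrier G" "b \<in> carrier G" and \<xi>: "\<xi> \<in> Irr G" "\<xi> a \<noteq> \<xi> b"
    and agree: "\<And>\<psi>. \<psi> \<in> Irr G - {\<xi>} \<Longrightarrow> \<psi> a = \<psi> b"
    using assms(3) by (auto simp: columns_differ_once_def)
  have "a = \<one>\<^bsub>G\<^esub>"
  proof (rule ccontr)
    assume "a \<noteq> \<one>\<^bsub>G\<^esub>"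
    then have "\<xi> (inv\<^bsub>G\<^esub> \<one>\<^bsub>G\<^esub>) = 0"
      using assms(4) by (intro distinguishing_character_vanishes[OF fin ab \<xi> agree one_closed]) auto
    then show False using Irr_one_nonzero[OF \<xi>(1)] by simp
  qed
  have "\<xi> \<in> \<chi> ` {1..k}" using bij \<xi>(1) by (simp add: bij_betw_def)
  then obtain j where j: "j \<in> {1..k}" "\<chi> j = \<xi>" by auto
  interpret CD1_character G b \<xi>
  proof unfold_locales
    have "1 \<in> {1..k}" using j(1) by simp
    then have "\<chi> 1 \<in> Irr G" by (rule bij_betw_apply[OF bij])
    then show "trivial_character G \<in> Irr G" by (simp only: triv)
    show "card (carrier G) > 2" using assms(1) by (simp add: CD1_group_def Coset.order_def)
    show "\<psi> b = \<psi> \<one>\<^bsub>G\<^esub>" if "\<psi> \<in> Irr G" "\<psi> \<noteq> \<xi>" for \<psi> using agree[of \<psi>] that \<open>a = \<one>\<^bsub>G\<^esub>\<close> by simp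
  qed (use fin ab \<xi> \<open>a = \<one>\<^bsub>G\<^esub>\<close> assms(4) in auto)
  have k: "k \<in> {1..k}" using j(1) by simp
  have "\<chi> k = \<xi>"
  proof (rule ccontr)
    assume ne: "\<chi> k \<noteq> \<xi>"
    have kI: "\<chi> k \<in> Irr G" using bij k by (auto simp: bij_betw_def)
    have "char_degree G (\<chi> j) \<le> char_degree G (\<chi> k)"
      using mono j(1) k by (auto simp: mono_on_def)
    then have "deg \<xi> \<le> deg (\<chi> k)"
      using deg(2)[OF kI] deg(2)[OF \<xi>(1)] j(2) by (simp add: char_degree_def)
    then show False using deg_less_deg_\<chi>[OF kI ne] by simp
  qed
  have "\<chi> ` {1..k - 1} = Irr G - {\<xi>}"
  proof -
    have "{1..k - 1} = {1..k} - {k}" by auto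
    also have "\<chi> ` \<dots> = \<chi> ` {1..k} - \<chi> ` {k}"
      using bij k by (intro inj_on_image_set_diff[of \<chi> "{1..k}"]) (auto simp: bij_betw_def)
    finally show ?thesis using bij \<open>\<chi> k = \<xi>\<close> by (simp add: bij_betw_def)
  qed
  then have "N = (\<Inter>\<psi>\<in>Irr G - {\<xi>}. char_kernel G \<psi>)"
    unfolding assms(5) by (metis image_image)
  also have "\<dots> = {g \<in> carrier G. \<forall>\<psi>\<in>Irr G - {\<xi>}. \<psi> g = \<psi> \<one>\<^bsub>G\<^esub>}"
    using trivial_Irr trivial_ne by (auto simp: char_kernel_def)
  also have "\<dots> = M" by (rule common_kernel_eq_M)
  finally show ?thesis using kernel_self_centralizing_iff \<open>\<chi> k = \<xi>\<close> by simp
qed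

end
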